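(* Let $1\le p<\infty$ and let $Z=(Z,d,\mu)$ be a metric measure space for which Lipschitz functions with bounded support are dense in norm in $W^{1,p}(Z)$. Then Lipschitz functions with bounded support are dense in energy in $W^{1,p}(Z;\mathbb V)$ whenever $\mathbb V$ is a Banach space with the metric approximation property.
   Context: Metric measure space: a triple $(Z,d,\mu)$ with $(Z,d)$ a separable metric space and $\mu$ a Borel regular outer measure with $0<\mu(B)<\infty$ for all open balls $B$. $L^p(Z;\mathbb V)$: a map $u:Z\to\mathbb V$ is measurable if preimages of open sets are $\mu$-measurable and $u(Z\setminus N)$ is separable for some $\mu$-null set $N$; $L^p(Z;\mathbb V)$ is the space of a.e.-equivalence classes of measurable $u$ with $|u|\in L^p(Z)$. Newton–Sobolev functions: a path is a continuous $\gamma:[a,b]\to Z$. For Borel $\rho:Z\to[0,\infty]$, $\int_\gamma\rho\,ds$ is the usual integral with respect to the length measure of $\gamma$ if $\gamma$ is rectifiable, and $\infty$ otherwise. A family of paths $\Gamma$ is $p$-negligible if there is an $L^p$-integrable Borel $\rho:Z\to[0,\infty]$ with $\int_\gamma\rho\,ds=\infty$ for all $\gamma\in\Gamma$. A Borel $\rho:Z\to[0,\infty]$ is a $p$-weak upper gradient of $u:Z\to\mathbb V$ if $|u(\gamma(a))-u(\gamma(b))|\le\int_\gamma\rho\,ds$ for all paths $\gamma:[a,b]\to Z$ outside a $p$-negligible family. $W^{1,p}(Z;\mathbb V)$ is the set of $u\in L^p(Z;\mathbb V)$ having a representative $\widetilde u$ that admits an $L^p$-integrable $p$-weak upper gradient.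 Among $L^p$-integrable $p$-weak upper gradients of $\widetilde u$ there is an a.e.-smallest one; its class in $L^p(Z)$ does not depend on $\widetilde u$ and is denoted $\rho_u$ (minimal $p$-weak upper gradient). The norm is $\|u\|_{W^{1,p}(Z;\mathbb V)}=\|u\|_{L^p(Z;\mathbb V)}+\|\rho_u\|_{L^p(Z)}$. $W^{1,p}(Z)=W^{1,p}(Z;\mathbb R)$. A map $f:Z\to\mathbb V$ has bounded support if $\{f\ne0\}$ is bounded. Lipschitz functions with bounded support are dense in energy in $W^{1,p}(Z;\mathbb V)$ if for every $u\in W^{1,p}(Z;\mathbb V)$ there is a sequence $(u_n)$ of $\mathbb V$-valued Lipschitz functions with bounded support with $\|u-u_n\|_{L^p(Z;\mathbb V)}+\|\rho_u-\rho_{u_n}\|_{L^p(Z)}\to0$. Metric approximation property of $\mathbb V$: for every compact $K\subset\mathbb V$ and $\epsilon>0$ there is a finite rank bounded linear operator $T:\mathbb V\to\mathbb V$ with $\|T\|\le1$ and $|v-T(v)|\le\epsilon$ for every $v\in K$. *)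

theory Defs
  imports "HOL-Analysis.Analysis"
begin

section \<open>Metric measure spaces\<close>

text \<open>The metric space is the whole type. The measure is an outer measure on all subsets; its
  \<open>\<mu>\<close>-measurable sets are the Caratheodory measurable ones.\<close>

definition caratheodory_sets :: "('a set \<Rightarrow> ennreal) \<Rightarrow> 'a set set" where
  "caratheodory_sets \<mu> = lambda_system UNIV (Pow UNIV) \<mu>"

definition caratheodory_measure :: "('a set \<Rightarrow> ennreal) \<Rightarrow> 'a measure" where
  "caratheodory_measure \<mu> = measure_of UNIV (caratheodory_sets \<mu>) \<mu>"

definition borel_regular :: "('a::topological_space set \<Rightarrow> ennreal) \<Rightarrow> bool" where
  "borel_regular \<mu> \<longleftrightarrow>
     sets borel \<subseteq> caratheodory_sets \<mu> \<and>
     (\<forall>A. \<exists>B\<in>sets borel. A \<subseteq> B \<and> \<mu> B = \<mu> A)"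

definition metric_measure_space :: "('a::metric_space set \<Rightarrow> ennreal) \<Rightarrow> bool" where
  "metric_measure_space \<mu> \<longleftrightarrow>
     separable_space (euclidean :: 'a topology) \<and>
     outer_measure_space (Pow UNIV) \<mu> \<and>
     borel_regular \<mu> \<and>
     (\<forall>x r. 0 < r \<longrightarrow> 0 < \<mu> (ball x r) \<and> \<mu> (ball x r) < \<infinity>)"

section \<open>Lebesgue spaces\<close>

text \<open>Elements of \<open>L\<^sup>p\<close> and of Sobolev spaces are represented by functions. Where a notion
  depends on the choice of representative (weak upper gradients), the definitions of the Sobolev
  space and of the minimal gradient quantify over the functions equal almost everywhere.\<close>

definition ennreal_powr :: "ennreal \<Rightarrow> real \<Rightarrow> ennreal" where
  "ennreal_powr x p = (if x = \<infinity> then \<infinity> else ennreal (enn2real x powr p))"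

definition Lp_norm :: "('a set \<Rightarrow> ennreal) \<Rightarrow> real \<Rightarrow> ('a \<Rightarrow> ennreal) \<Rightarrow> ennreal" where
  "Lp_norm \<mu> p g =
     ennreal_powr (\<integral>\<^sup>+ x. ennreal_powr (g x) p \<partial>caratheodory_measure \<mu>) (1 / p)"

definition vector_measurable ::
    "('a set \<Rightarrow> ennreal) \<Rightarrow> ('a \<Rightarrow> 'v::real_normed_vector) \<Rightarrow> bool" where
  "vector_measurable \<mu> u \<longleftrightarrow>
     (\<forall>U. open U \<longrightarrow> u -` U \<in> caratheodory_sets \<mu>) \<and>
     (\<exists>N. \<mu> N = 0 \<and> separable_space (top_of_set (u ` (- N))))"

definition Lp_vec_norm ::
    "('a set \<Rightarrow> ennreal) \<Rightarrow> real \<Rightarrow> ('a \<Rightarrow> 'v::real_normed_vector) \<Rightarrow> ennreal" where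
  "Lp_vec_norm \<mu> p u = Lp_norm \<mu> p (\<lambda>x. ennreal (norm (u x)))"

definition Lp_space ::
    "('a set \<Rightarrow> ennreal) \<Rightarrow> real \<Rightarrow> ('a \<Rightarrow> 'v::real_normed_vector) set" where
  "Lp_space \<mu> p = {u. vector_measurable \<mu> u \<and> Lp_vec_norm \<mu> p u < \<infinity>}"

section \<open>Paths and path integrals\<close>

text \<open>The triple \<open>(a, b, \<gamma>)\<close> stands for the path \<open>\<gamma>\<close> on \<open>[a, b]\<close>; the values of \<open>\<gamma>\<close> outside
  \<open>[a, b]\<close> are irrelevant.\<close>

type_synonym 'a curve = "real \<times> real \<times> (real \<Rightarrow> 'a)"

definition curves :: "'a::metric_space curve set" where
  "curves = {(a, b, \<gamma>). a \<le> b \<and> continuous_on {a..b} \<gamma>}"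

definition curve_length :: "real \<Rightarrow> real \<Rightarrow> (real \<Rightarrow> 'a::metric_space) \<Rightarrow> ennreal" where
  "curve_length a b \<gamma> =
     (SUP (n, t) \<in> {(n, t). (\<forall>i\<le>n. t i \<in> {a..b}) \<and> (\<forall>i<n. t i \<le> t (Suc i))}.
        \<Sum>i<n::nat. ennreal (dist (\<gamma> (t i)) (\<gamma> (t (Suc i)))))"

text \<open>For rectifiable \<open>\<gamma>\<close> this is the Lebesgue--Stieltjes measure of the arc length function
  \<open>t \<mapsto> length (\<gamma>|[a, t])\<close>, extended to the real line as a constant on either side of
  \<open>[a, b]\<close>.\<close>

definition length_measure :: "real \<Rightarrow> real \<Rightarrow> (real \<Rightarrow> 'a::metric_space) \<Rightarrow> real measure" where
  "length_measure a b \<gamma> =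
     interval_measure (\<lambda>t. enn2real (curve_length a (max a (min b t)) \<gamma>))"

fun curve_integral :: "('a::metric_space \<Rightarrow> ennreal) \<Rightarrow> 'a curve \<Rightarrow> ennreal" where
  "curve_integral \<rho> (a, b, \<gamma>) =
     (if curve_length a b \<gamma> < \<infinity>
      then \<integral>\<^sup>+ t\<in>{a..b}. \<rho> (\<gamma> t) \<partial>length_measure a b \<gamma>
      else \<infinity>)"

section \<open>Newton--Sobolev spaces\<close>

definition Lp_borel ::
    "('a::metric_space set \<Rightarrow> ennreal) \<Rightarrow> real \<Rightarrow> ('a \<Rightarrow> ennreal) set" where
  "Lp_borel \<mu> p = {\<rho> \<in> borel_measurable borel. Lp_norm \<mu> p \<rho> < \<infinity>}"

definition negligible_family ::
    "('a::metric_space set \<Rightarrow> ennreal) \<Rightarrow> real \<Rightarrow> 'a curve set \<Rightarrow> bool" where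
  "negligible_family \<mu> p \<Gamma> \<longleftrightarrow>
     \<Gamma> \<subseteq> curves \<and> (\<exists>\<rho>\<in>Lp_borel \<mu> p. \<forall>c\<in>\<Gamma>. curve_integral \<rho> c = \<infinity>)"

definition weak_upper_gradient ::
    "('a::metric_space set \<Rightarrow> ennreal) \<Rightarrow> real \<Rightarrow> ('a \<Rightarrow> 'v::real_normed_vector) \<Rightarrow>
     ('a \<Rightarrow> ennreal) \<Rightarrow> bool" where
  "weak_upper_gradient \<mu> p u \<rho> \<longleftrightarrow>
     \<rho> \<in> borel_measurable borel \<and>
     (\<exists>\<Gamma>. negligible_family \<mu> p \<Gamma> \<and>
        (\<forall>(a, b, \<gamma>) \<in> curves - \<Gamma>.
           ennreal (norm (u (\<gamma> a) - u (\<gamma> b))) \<le> curve_integral \<rho> (a, b, \<gamma>)))"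

definition Lp_weak_upper_gradients ::
    "('a::metric_space set \<Rightarrow> ennreal) \<Rightarrow> real \<Rightarrow> ('a \<Rightarrow> 'v::real_normed_vector) \<Rightarrow>
     ('a \<Rightarrow> ennreal) set" where
  "Lp_weak_upper_gradients \<mu> p u = {\<rho> \<in> Lp_borel \<mu> p. weak_upper_gradient \<mu> p u \<rho>}"

definition sobolev_space ::
    "('a::metric_space set \<Rightarrow> ennreal) \<Rightarrow> real \<Rightarrow> ('a \<Rightarrow> 'v::real_normed_vector) set" where
  "sobolev_space \<mu> p =
     {u \<in> Lp_space \<mu> p. \<exists>u'. (AE x in caratheodory_measure \<mu>. u' x = u x) \<and>
        Lp_weak_upper_gradients \<mu> p u' \<noteq> {}}"

definition is_minimal_gradient ::
    "('a::metric_space set \<Rightarrow> ennreal) \<Rightarrow> real \<Rightarrow> ('a \<Rightarrow> 'v::real_normed_vector) \<Rightarrow>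
     ('a \<Rightarrow> ennreal) \<Rightarrow> bool" where
  "is_minimal_gradient \<mu> p u \<rho> \<longleftrightarrow>
     (\<exists>u'. (AE x in caratheodory_measure \<mu>. u' x = u x) \<and>
        \<rho> \<in> Lp_weak_upper_gradients \<mu> p u' \<and>
        (\<forall>\<sigma>\<in>Lp_weak_upper_gradients \<mu> p u'. AE x in caratheodory_measure \<mu>. \<rho> x \<le> \<sigma> x))"

text \<open>A representative of the class of minimal weak upper gradients, made real-valued (it is finite
  almost everywhere) so that differences are not truncated as they would be in the extended
  nonnegative reals.\<close>

definition minimal_gradient ::
    "('a::metric_space set \<Rightarrow> ennreal) \<Rightarrow> real \<Rightarrow> ('a \<Rightarrow> 'v::real_normed_vector) \<Rightarrow>
     'a \<Rightarrow> real" where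
  "minimal_gradient \<mu> p u = (\<lambda>x. enn2real ((SOME \<rho>. is_minimal_gradient \<mu> p u \<rho>) x))"

definition sobolev_norm ::
    "('a::metric_space set \<Rightarrow> ennreal) \<Rightarrow> real \<Rightarrow> ('a \<Rightarrow> 'v::real_normed_vector) \<Rightarrow> ennreal" where
  "sobolev_norm \<mu> p u = Lp_vec_norm \<mu> p u + Lp_vec_norm \<mu> p (minimal_gradient \<mu> p u)"

section \<open>Density of Lipschitz functions\<close>

definition lipschitz_bounded_support ::
    "('a::metric_space \<Rightarrow> 'v::real_normed_vector) set" where
  "lipschitz_bounded_support = {f. (\<exists>L. L-lipschitz_on UNIV f) \<and> bounded {x. f x \<noteq> 0}}"

definition lipschitz_dense_in_norm ::
    "('a::metric_space set \<Rightarrow> ennreal) \<Rightarrow> real \<Rightarrow> 'v::real_normed_vector itself \<Rightarrow> bool" where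
  "lipschitz_dense_in_norm \<mu> p (_ :: 'v itself) \<longleftrightarrow>
     (\<forall>u \<in> (sobolev_space \<mu> p :: ('a \<Rightarrow> 'v) set). \<forall>\<epsilon>>0.
        \<exists>f\<in>lipschitz_bounded_support. sobolev_norm \<mu> p (\<lambda>x. u x - f x) < ennreal \<epsilon>)"

definition lipschitz_dense_in_energy ::
    "('a::metric_space set \<Rightarrow> ennreal) \<Rightarrow> real \<Rightarrow> 'v::real_normed_vector itself \<Rightarrow> bool" where
  "lipschitz_dense_in_energy \<mu> p (_ :: 'v itself) \<longleftrightarrow>
     (\<forall>u \<in> (sobolev_space \<mu> p :: ('a \<Rightarrow> 'v) set).
        \<exists>f :: nat \<Rightarrow> 'a \<Rightarrow> 'v. (\<forall>n. f n \<in> lipschitz_bounded_support) \<and>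
          (\<lambda>n. Lp_vec_norm \<mu> p (\<lambda>x. u x - f n x) +
               Lp_vec_norm \<mu> p (\<lambda>x. minimal_gradient \<mu> p u x - minimal_gradient \<mu> p (f n) x))
            \<longlonglongrightarrow> 0)"

definition metric_approximation_property :: "'v::real_normed_vector itself \<Rightarrow> bool" where
  "metric_approximation_property (_ :: 'v itself) \<longleftrightarrow>
     (\<forall>(K :: 'v set) \<epsilon>. compact K \<longrightarrow> 0 < \<epsilon> \<longrightarrow>
        (\<exists>T :: 'v \<Rightarrow>\<^sub>L 'v.
           (\<exists>B. finite B \<and> range (blinfun_apply T) \<subseteq> span B) \<and>
           norm T \<le> 1 \<and> (\<forall>v\<in>K. norm (v - blinfun_apply T v) \<le> \<epsilon>)))"

end

theory Submission
  imports Defs "HOL-Probability.Distribution_Functions"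
begin

text \<open>
  Let \<open>g\<close> be the minimal weak upper gradient of a representative of \<open>u\<close>, and let \<open>v\<^sub>0, v\<^sub>1, \<dots>\<close> be dense
  in the essential range of \<open>u\<close>. For a finite rank contraction \<open>S\<close> that moves \<open>v\<^sub>0, \<dots>, v\<^sub>n\<close> by at most
  \<open>1/(n+1)\<close>, the function \<open>S \<circ> u\<close> is close to \<open>u\<close> in \<open>L\<^sup>p\<close> and has \<open>g\<close> as a weak upper gradient. The
  set \<open>C\<^sub>n\<close> of these contractions is convex. Hence so is the set of all \<open>\<theta> : Z \<rightarrow> [0, 1]\<close> such that
  \<open>\<theta> g\<close> is a weak upper gradient of \<open>S \<circ> u\<close> for some \<open>S \<in> C\<^sub>n\<close>. By the parallelogram identity, almost
  minimizers of \<open>\<integral> \<theta>\<^sup>2 g\<^sup>p\<close> over these sets form a Cauchy sequence as \<open>n \<rightarrow> \<infinity>\<close>. By Fuglede's lemma the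
  limit gives a weak upper gradient of \<open>u\<close>, so it equals \<open>1\<close> where \<open>g > 0\<close>. Therefore every weak upper
  gradient of \<open>S \<circ> u\<close>, \<open>S \<in> C\<^sub>n\<close>, is almost as large as \<open>g\<close> once \<open>n\<close> is large, and in particular the
  minimal one is close to \<open>g\<close> in \<open>L\<^sup>p\<close>; for \<open>p = 1\<close> this replaces weak compactness. Finally the finitely
  many coordinates of \<open>S \<circ> u\<close> are approximated in norm by the scalar hypothesis.
\<close>

section \<open>Length of curves\<close>

text \<open>The minimal gradient of \<open>S \<circ> u\<close> cannot exceed \<open>g\<close>, so
  only a lower bound is at stake. Writing gradients as \<open>\<theta> g\<close> makes this a
  question about functions with values in [0, 1] on the finite measure \<open>g^p d\<mu>\<close>.
  There the exponent no longer matters: a quadratic functional supplies Hilbert space geometry for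
  every \<open>p\<close>, and (1 - \<theta>)^p \<le> 1 - \<theta> \<le> 1 - \<theta>^2 leads back to
  the p-energy. To bring an arbitrary gradient into the form \<open>\<theta> g\<close> one truncates
  it by \<open>g\<close>, which needs weak upper gradients to be closed under minima; this is why
  length measures of curves are developed. The limit argument needs convergence of
  \<open>S u\<close> to \<open>u\<close> at the endpoints of almost every curve, whereas the dense
  sequence only controls almost every point. Continuity of \<open>u\<close> along curves, quantified
  by the integral of its gradient, closes this gap. Density in norm of scalar functions is what the
  last step can use: the gradients of the coordinate errors add up, while closeness of the minimal
  gradients of the coordinates would not control that of the vector-valued sum.\<close>

lemma curve_length_upper:
  assumes "\<And>i. i \<le> n \<Longrightarrow> t i \<in> {a..b}" "\<And>i. i < n \<Longrightarrow> t i \<le> t (Suc i)"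
  shows "(\<Sum>i<n. ennreal (dist (\<gamma> (t i)) (\<gamma> (t (Suc i))))) \<le> curve_length a b \<gamma>"
  unfolding curve_length_def
  by (rule SUP_upper2[of "(n, t)"]) (use assms in auto)

lemma curve_length_least:
  assumes "\<And>n t. (\<And>i. i \<le> n \<Longrightarrow> t i \<in> {a..b}) \<Longrightarrow> (\<And>i. i < n \<Longrightarrow> t i \<le> t (Suc i)) \<Longrightarrow>
    (\<Sum>i<n. ennreal (dist (\<gamma> (t i)) (\<gamma> (t (Suc i))))) \<le> c"
  shows "curve_length a b \<gamma> \<le> c"
  unfolding curve_length_def
  by (rule SUP_least) (use assms in auto)

lemma less_curve_lengthE:
  assumes "c < curve_length a b \<gamma>"
  obtains n t where "\<And>i. i \<le> n \<Longrightarrow> t i \<in> {a..b}" "\<And>i. i < n \<Longrightarrow> t i \<le> t (Suc i)"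
    "c < (\<Sum>i<n. ennreal (dist (\<gamma> (t i)) (\<gamma> (t (Suc i)))))"
proof -
  have "\<exists>n t. (\<forall>i\<le>n. t i \<in> {a..b}) \<and> (\<forall>i<n. t i \<le> t (Suc i)) \<and>
      c < (\<Sum>i<n. ennreal (dist (\<gamma> (t i)) (\<gamma> (t (Suc i)))))"
    using assms unfolding curve_length_def less_SUP_iff by (auto split: prod.splits)
  then show ?thesis using that by blast
qed

lemma dist_le_curve_length:
  assumes "a \<le> b" shows "ennreal (dist (\<gamma> a) (\<gamma> b)) \<le> curve_length a b \<gamma>"
  using curve_length_upper[of 1 "\<lambda>i. if i = 0 then a else b" a b \<gamma>] assms by auto

lemma curve_length_refl [simp]: "curve_length a a \<gamma> = 0"
proof -
  have "curve_length a a \<gamma> \<le> 0"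
    by (rule curve_length_least) (simp add: Suc_le_eq)
  then show ?thesis by simp
qed

text \<open>Clamping a partition from above and from below at \<open>s\<close> splits every jump
  without inserting \<open>s\<close> into the partition: a jump on one side of \<open>s\<close>
  survives in one of the two clamped sums, and a jump across \<open>s\<close> is split by the
  triangle inequality.\<close>

lemma curve_length_split_le:
  assumes "a \<le> s" "s \<le> b"
  shows "curve_length a b \<gamma> \<le> curve_length a s \<gamma> + curve_length s b \<gamma>"
proof (rule curve_length_least)
  fix n and t :: "nat \<Rightarrow> real"
  assume t: "\<And>i. i \<le> n \<Longrightarrow> t i \<in> {a..b}" "\<And>i. i < n \<Longrightarrow> t i \<le> t (Suc i)"
  have "(\<Sum>i<n. ennreal (dist (\<gamma> (t i)) (\<gamma> (t (Suc i))))) \<le>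
      (\<Sum>i<n. ennreal (dist (\<gamma> (min s (t i))) (\<gamma> (min s (t (Suc i))))) +
        ennreal (dist (\<gamma> (max s (t i))) (\<gamma> (max s (t (Suc i))))))"
  proof (rule sum_mono)
    fix i assume "i \<in> {..<n}"
    then have "t i \<le> t (Suc i)" using t by auto
    then show "ennreal (dist (\<gamma> (t i)) (\<gamma> (t (Suc i)))) \<le>
        ennreal (dist (\<gamma> (min s (t i))) (\<gamma> (min s (t (Suc i))))) +
        ennreal (dist (\<gamma> (max s (t i))) (\<gamma> (max s (t (Suc i)))))"
      by (auto simp: min_def max_def ennreal_plus[symmetric] dist_triangle simp del: ennreal_plus
          intro!: ennreal_leI)
  qed
  also have "\<dots> = (\<Sum>i<n. ennreal (dist (\<gamma> (min s (t i))) (\<gamma> (min s (t (Suc i)))))) +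
      (\<Sum>i<n. ennreal (dist (\<gamma> (max s (t i))) (\<gamma> (max s (t (Suc i))))))"
    by (simp add: sum.distrib)
  also have "\<dots> \<le> curve_length a s \<gamma> + curve_length s b \<gamma>"
    using assms t
    by (intro add_mono curve_length_upper[where t = "\<lambda>i. min s (t i)"]
        curve_length_upper[where t = "\<lambda>i. max s (t i)"]) (auto simp: min.coboundedI2 max.coboundedI2)
  finally show "(\<Sum>i<n. ennreal (dist (\<gamma> (t i)) (\<gamma> (t (Suc i))))) \<le>
    curve_length a s \<gamma> + curve_length s b \<gamma>" .
qed

lemma SUP_add_least_ennreal:
  fixes f :: "'a \<Rightarrow> ennreal" and g :: "'b \<Rightarrow> ennreal"
  assumes "A \<noteq> {}" "B \<noteq> {}" "\<And>x y. x \<in> A \<Longrightarrow> y \<in> B \<Longrightarrow> f x + g y \<le> c"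
  shows "(SUP x\<in>A. f x) + (SUP y\<in>B. g y) \<le> c"
proof -
  have "(SUP x\<in>A. f x) + (SUP y\<in>B. g y) = (SUP x\<in>A. f x + (SUP y\<in>B. g y))"
    using assms(1) by (rule ennreal_SUP_add_left[symmetric])
  also have "\<dots> = (SUP x\<in>A. (SUP y\<in>B. f x + g y))"
    using assms(2) by (simp add: ennreal_SUP_add_right)
  also have "\<dots> \<le> c" using assms by (intro SUP_least) auto
  finally show ?thesis .
qed

lemma curve_length_split_ge:
  assumes "a \<le> s" "s \<le> b"
  shows "curve_length a s \<gamma> + curve_length s b \<gamma> \<le> curve_length a b \<gamma>"
  unfolding curve_length_def[of a s] curve_length_def[of s b]
proof (rule SUP_add_least_ennreal, safe)
  fix n m and t r :: "nat \<Rightarrow> real"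
  assume "\<forall>i\<le>n. t i \<in> {a..s}" "\<forall>i<n. t i \<le> t (Suc i)"
    "\<forall>i\<le>m. r i \<in> {s..b}" "\<forall>i<m. r i \<le> r (Suc i)"
  then have t: "\<And>i. i \<le> n \<Longrightarrow> t i \<in> {a..s}" "\<And>i. i < n \<Longrightarrow> t i \<le> t (Suc i)"
    and r: "\<And>i. i \<le> m \<Longrightarrow> r i \<in> {s..b}" "\<And>i. i < m \<Longrightarrow> r i \<le> r (Suc i)" by auto
  \<comment> \<open>The two partitions are placed one after the other with \<open>t n\<close> and
    \<open>r 0\<close> both kept, even if they coincide. The jump between them is an extra
    nonnegative term, hence \<open>m + Suc n\<close> jumps in total.\<close>
  define q where "q i = (if i \<le> n then t i else r (i - Suc n))" for i
  have "(\<Sum>i<n. ennreal (dist (\<gamma> (t i)) (\<gamma> (t (Suc i))))) +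
      (\<Sum>i<m. ennreal (dist (\<gamma> (r i)) (\<gamma> (r (Suc i))))) \<le> (\<Sum>i<n. ennreal (dist (\<gamma> (q i)) (\<gamma> (q (Suc i))))) +
      (\<Sum>i<m. ennreal (dist (\<gamma> (q (i + Suc n))) (\<gamma> (q (Suc (i + Suc n))))))"
    by (intro add_mono sum_mono) (auto simp: q_def)
  also have "\<dots> \<le> (\<Sum>i<Suc n. ennreal (dist (\<gamma> (q i)) (\<gamma> (q (Suc i))))) +
      (\<Sum>i<m. ennreal (dist (\<gamma> (q (i + Suc n))) (\<gamma> (q (Suc (i + Suc n))))))"
    by (intro add_mono) auto
  also have "\<dots> = (\<Sum>i<m + Suc n. ennreal (dist (\<gamma> (q i)) (\<gamma> (q (Suc i)))))"
    by (induction m) (auto simp: add_ac)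
  also have "\<dots> \<le> curve_length a b \<gamma>"
  proof (rule curve_length_upper)
    show "q i \<in> {a..b}" if "i \<le> m + Suc n" for i
      using that t(1)[of i] r(1)[of "i - Suc n"] assms by (force simp: q_def)
    show "q i \<le> q (Suc i)" if "i < m + Suc n" for i
    proof -
      consider "i < n" | "i = n" | "i > n" by linarith
      then show ?thesis
      proof cases
        case 3
        then have "Suc i - Suc n = Suc (i - Suc n)" by simp
        then show ?thesis using 3 that r(2)[of "i - Suc n"] by (simp add: q_def)
      qed (use t r(1)[of 0] t(1)[of n] in \<open>auto simp: q_def intro: order_trans\<close>)
    qed
  qed
  finally show "(\<Sum>i<n. ennreal (dist (\<gamma> (t i)) (\<gamma> (t (Suc i))))) +
      (\<Sum>i<m. ennreal (dist (\<gamma> (r i)) (\<gamma> (r (Suc i))))) \<le> curve_length a b \<gamma>" .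
next
  assume "{(n, t). (\<forall>i\<le>n. t i \<in> {a..s}) \<and> (\<forall>i<n. t i \<le> t (Suc i))} = {}"
  then have "(0, \<lambda>_. a) \<in> ({} :: (nat \<times> (nat \<Rightarrow> real)) set)" using assms by force
  then show False by simp
next
  assume "{(n, t). (\<forall>i\<le>n. t i \<in> {s..b}) \<and> (\<forall>i<n. t i \<le> t (Suc i))} = {}"
  then have "(0, \<lambda>_. s) \<in> ({} :: (nat \<times> (nat \<Rightarrow> real)) set)" using assms by force
  then show False by simp
qed

lemma curve_length_split:
  assumes "a \<le> s" "s \<le> b"
  shows "curve_length a b \<gamma> = curve_length a s \<gamma> + curve_length s b \<gamma>"
  using curve_length_split_ge curve_length_split_le assms by (intro antisym)

lemma curve_length_mono:
  assumes "a \<le> s" "s \<le> t" "t \<le> b"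
  shows "curve_length s t \<gamma> \<le> curve_length a b \<gamma>"
proof -
  have "curve_length a b \<gamma> = curve_length a s \<gamma> + (curve_length s t \<gamma> + curve_length t b \<gamma>)"
    using curve_length_split[of a s b \<gamma>] curve_length_split[of s t b \<gamma>] assms by simp
  then show ?thesis by (simp add: add_increasing add_increasing2)
qed

text \<open>Clamping a partition depends continuously on the endpoints, so both \<open>curve_length a \<tau>\<close> and
  \<open>curve_length \<tau> b\<close> are lower semicontinuous in \<open>\<tau>\<close>. Their sum is constant, so both are
  continuous.\<close>

lemma curve_length_lsc:
  assumes \<gamma>: "continuous_on {a..b} \<gamma>" and \<tau>0: "\<tau>0 \<in> {a..b}"
    and l: "continuous_on {a..b} l" and r: "continuous_on {a..b} r"
    and lr: "\<And>\<tau>. \<tau> \<in> {a..b} \<Longrightarrow> a \<le> l \<tau> \<and> l \<tau> \<le> r \<tau> \<and> r \<tau> \<le> b"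
    and c: "c < curve_length (l \<tau>0) (r \<tau>0) \<gamma>"
  shows "\<forall>\<^sub>F \<tau> in at \<tau>0 within {a..b}. c < curve_length (l \<tau>) (r \<tau>) \<gamma>"
proof -
  obtain n t where t: "\<And>i. i \<le> n \<Longrightarrow> t i \<in> {l \<tau>0..r \<tau>0}" "\<And>i. i < n \<Longrightarrow> t i \<le> t (Suc i)"
      "c < (\<Sum>i<n. ennreal (dist (\<gamma> (t i)) (\<gamma> (t (Suc i)))))"
    using c by (elim less_curve_lengthE) blast
  define q where "q \<tau> i = max (l \<tau>) (min (r \<tau>) (t i))" for \<tau> i
  have lim: "((\<lambda>\<tau>. \<gamma> (q \<tau> i)) \<longlongrightarrow> \<gamma> (t i)) (at \<tau>0 within {a..b})" if "i \<le> n" for i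
  proof -
    have "continuous_on {a..b} (\<lambda>\<tau>. \<gamma> (q \<tau> i))"
      unfolding q_def
      by (rule continuous_on_compose2[OF \<gamma>]) (use lr in \<open>force intro!: continuous_intros l r\<close>)+
    then have "((\<lambda>\<tau>. \<gamma> (q \<tau> i)) \<longlongrightarrow> \<gamma> (q \<tau>0 i)) (at \<tau>0 within {a..b})"
      using \<tau>0 by (auto simp: continuous_on)
    moreover have "q \<tau>0 i = t i" using t(1)[OF that] by (auto simp: q_def)
    ultimately show ?thesis by simp
  qed
  have "((\<lambda>\<tau>. \<Sum>i<n. ennreal (dist (\<gamma> (q \<tau> i)) (\<gamma> (q \<tau> (Suc i))))) \<longlongrightarrow>
      (\<Sum>i<n. ennreal (dist (\<gamma> (t i)) (\<gamma> (t (Suc i)))))) (at \<tau>0 within {a..b})"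
    by (intro tendsto_sum tendsto_ennrealI tendsto_dist lim) auto
  from order_tendstoD(1)[OF this t(3)]
  have "\<forall>\<^sub>F \<tau> in at \<tau>0 within {a..b}. c < (\<Sum>i<n. ennreal (dist (\<gamma> (q \<tau> i)) (\<gamma> (q \<tau> (Suc i)))))" .
  moreover have "\<forall>\<^sub>F \<tau> in at \<tau>0 within {a..b}. \<tau> \<in> {a..b}"
    by (simp add: eventually_at_filter)
  ultimately show ?thesis
  proof eventually_elim
    case (elim \<tau>)
    note elim(1)
    also have "(\<Sum>i<n. ennreal (dist (\<gamma> (q \<tau> i)) (\<gamma> (q \<tau> (Suc i))))) \<le> curve_length (l \<tau>) (r \<tau>) \<gamma>"
      using lr[OF elim(2)] t(2) unfolding q_def
      by (intro curve_length_upper max.mono min.mono) auto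
    finally show ?case .
  qed
qed

lemma continuous_on_curve_length:
  assumes \<gamma>: "continuous_on {a..b} \<gamma>" and fin: "curve_length a b \<gamma> < \<infinity>"
  shows "continuous_on {a..b} (\<lambda>\<tau>. enn2real (curve_length a \<tau> \<gamma>))"
  unfolding continuous_on
proof (intro ballI order_tendstoI)
  fix \<tau>0 assume \<tau>0: "\<tau>0 \<in> {a..b}"
  have fin': "curve_length a \<tau> \<gamma> < \<infinity>" "curve_length \<tau> b \<gamma> < \<infinity>" if "\<tau> \<in> {a..b}" for \<tau>
    using that curve_length_mono[of a a \<tau> b \<gamma>] curve_length_mono[of a \<tau> b b \<gamma>] fin
    by (auto simp: order.strict_trans1)
  have sum: "enn2real (curve_length a \<tau> \<gamma>) + enn2real (curve_length \<tau> b \<gamma>) =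
      enn2real (curve_length a b \<gamma>)" if "\<tau> \<in> {a..b}" for \<tau>
    using that fin'[OF that] by (subst curve_length_split[of a \<tau> b]) (auto simp: enn2real_plus)
  have ev: "\<forall>\<^sub>F \<tau> in at \<tau>0 within {a..b}. \<tau> \<in> {a..b}"
    by (simp add: eventually_at_filter)
  {
    fix y assume y: "y < enn2real (curve_length a \<tau>0 \<gamma>)"
    show "\<forall>\<^sub>F \<tau> in at \<tau>0 within {a..b}. y < enn2real (curve_length a \<tau> \<gamma>)"
    proof (cases "y < 0")
      case True
      then show ?thesis by (auto intro!: always_eventually less_le_trans[OF True])
    next
      case False
      then have "ennreal y < curve_length a \<tau>0 \<gamma>"
        using y fin'[OF \<tau>0] by (cases "curve_length a \<tau>0 \<gamma>") (auto simp: ennreal_less_iff)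
      then have "\<forall>\<^sub>F \<tau> in at \<tau>0 within {a..b}. ennreal y < curve_length a \<tau> \<gamma>"
        by (intro curve_length_lsc[OF \<gamma> \<tau>0]) (auto intro: continuous_on_id)
      then show ?thesis using ev
      proof eventually_elim
        case (elim \<tau>)
        then show ?case using fin'[of \<tau>] False
          by (cases "curve_length a \<tau> \<gamma>") (auto simp: ennreal_less_iff)
      qed
    qed
  }
  {
    fix y assume y: "enn2real (curve_length a \<tau>0 \<gamma>) < y"
    define z where "z = enn2real (curve_length a b \<gamma>) - y"
    have z: "z < enn2real (curve_length \<tau>0 b \<gamma>)" using y sum[OF \<tau>0] by (simp add: z_def)
    have "\<forall>\<^sub>F \<tau> in at \<tau>0 within {a..b}. z < enn2real (curve_length \<tau> b \<gamma>)"
    proof (cases "z < 0")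
      case True
      then show ?thesis by (auto intro!: always_eventually less_le_trans[OF True])
    next
      case False
      then have "ennreal z < curve_length \<tau>0 b \<gamma>"
        using z fin'[OF \<tau>0] by (cases "curve_length \<tau>0 b \<gamma>") (auto simp: ennreal_less_iff)
      then have "\<forall>\<^sub>F \<tau> in at \<tau>0 within {a..b}. ennreal z < curve_length \<tau> b \<gamma>"
        by (intro curve_length_lsc[OF \<gamma> \<tau>0]) (auto intro: continuous_on_id)
      then show ?thesis using ev
      proof eventually_elim
        case (elim \<tau>)
        then show ?case using fin'[of \<tau>] False
          by (cases "curve_length \<tau> b \<gamma>") (auto simp: ennreal_less_iff)
      qed
    qed
    then show "\<forall>\<^sub>F \<tau> in at \<tau>0 within {a..b}. enn2real (curve_length a \<tau> \<gamma>) < y"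
      using ev
    proof eventually_elim
      case (elim \<tau>)
      then show ?case using sum[of \<tau>] by (simp add: z_def)
    qed
  }
qed

section \<open>The length measure\<close>

lemma UN_Ioc_eq_UNIV: "(\<Union>n. {- real n<..real n}) = UNIV"
proof (intro equalityI subsetI)
  fix x :: real
  obtain n where "\<bar>x\<bar> < real n" using reals_Archimedean2 by blast
  then show "x \<in> (\<Union>n. {- real n<..real n})" by (auto intro!: exI[of _ n])
qed simp

lemma borel_measure_eqI_Ioc:
  fixes M N :: "real measure"
  assumes "sets M = sets borel" "sets N = sets borel"
    and "\<And>s t. s \<le> t \<Longrightarrow> emeasure M {s<..t} = emeasure N {s<..t}"
    and fin: "\<And>s t. s \<le> t \<Longrightarrow> emeasure M {s<..t} \<noteq> \<infinity>"
  shows "M = N"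
proof (rule measure_eqI_generator_eq[where \<Omega> = UNIV and E = "range (\<lambda>(a, b). {a<..b::real})"
      and A = "\<lambda>n. {- real n<..real n}"])
  show "Int_stable (range (\<lambda>(a, b). {a<..b::real}))"
    by (auto simp: Int_stable_def image_iff)
  show "emeasure M X = emeasure N X" if X: "X \<in> range (\<lambda>(a, b). {a<..b})" for X
  proof -
    obtain q where "X = (case q of (s, t) \<Rightarrow> {s<..t})" using X by blast
    then obtain s t where "X = {s<..t}" by (cases q) simp
    then show ?thesis using assms(3)[of s t] by (cases "s \<le> t") auto
  qed
qed (use UN_Ioc_eq_UNIV assms in \<open>auto simp: borel_sigma_sets_Ioc fin[unfolded infinity_ennreal_def]\<close>)

text \<open>The difference of the distribution functions is nondecreasing and right-continuous, so
  it is the distribution function of a measure \<open>?K\<close>. Uniqueness on half-open intervals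
  gives that \<open>N\<close> is the sum of \<open>M\<close> and \<open>?K\<close>, so no
  subtraction of measures is required.\<close>

lemma borel_measure_mono_Ioc:
  fixes M N :: "real measure"
  assumes M: "finite_measure M" "sets M = sets borel" and N: "finite_measure N" "sets N = sets borel"
    and le: "\<And>s t. s \<le> t \<Longrightarrow> emeasure M {s<..t} \<le> emeasure N {s<..t}"
    and B: "B \<in> sets borel"
  shows "emeasure M B \<le> emeasure N B"
proof -
  interpret M: finite_borel_measure M
    using M by (simp add: finite_borel_measure_def finite_borel_measure_axioms_def)
  interpret N: finite_borel_measure N
    using N by (simp add: finite_borel_measure_def finite_borel_measure_axioms_def)
  define F where "F x = cdf N x - cdf M x" for x
  have diff: "F t - F s = measure N {s<..t} - measure M {s<..t}" if "s \<le> t" for s t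
    using that M.cdf_diff_eq[of s t] N.cdf_diff_eq[of s t] by (cases "s = t") (auto simp: F_def)
  have le': "measure M {s<..t} \<le> measure N {s<..t}" if "s \<le> t" for s t
    using le[OF that] by (simp add: M.emeasure_eq_measure N.emeasure_eq_measure)
  have F_mono: "F x \<le> F y" if "x \<le> y" for x y
    using diff[OF that] le'[OF that] by simp
  have F_cont: "continuous (at_right x) F" for x
    unfolding F_def by (intro continuous_diff N.cdf_is_right_cont M.cdf_is_right_cont)
  let ?K = "interval_measure F"
  define S where "S = measure_of UNIV (sets borel) (\<lambda>A. emeasure M A + emeasure ?K A)"
  have S_sets: "sets S = sets borel"
    unfolding S_def using sets.sigma_algebra_axioms[of borel] sigma_algebra.sigma_sets_eq
    by (auto simp: sets_measure_of_conv)
  have S: "emeasure S A = emeasure M A + emeasure ?K A" if "A \<in> sets borel" for A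
    unfolding S_def
  proof (rule emeasure_measure_of_sigma)
    show "sigma_algebra UNIV (sets borel :: real set set)"
      using sets.sigma_algebra_axioms[of "borel :: real measure"] by simp
    show "countably_additive (sets borel) (\<lambda>A. emeasure M A + emeasure ?K A)"
    proof (rule countably_additiveI)
      fix A :: "nat \<Rightarrow> real set"
      assume A: "range A \<subseteq> sets borel" "disjoint_family A"
      show "(\<Sum>i. emeasure M (A i) + emeasure ?K (A i)) = emeasure M (\<Union> (range A)) + emeasure ?K (\<Union> (range A))"
        using A M(2) by (subst suminf_add[symmetric]) (auto simp: suminf_emeasure)
    qed
  qed (use that in \<open>auto simp: positive_def\<close>)
  have "S = N"
  proof (rule borel_measure_eqI_Ioc)
    fix s t :: real assume "s \<le> t"
    have "emeasure S {s<..t} = ennreal (measure M {s<..t}) + ennreal (F t - F s)"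
      using \<open>s \<le> t\<close> by (simp add: S emeasure_interval_measure_Ioc F_mono F_cont M.emeasure_eq_measure)
    also have "\<dots> = ennreal (measure N {s<..t})"
      using diff[OF \<open>s \<le> t\<close>] le'[OF \<open>s \<le> t\<close>] by (simp add: ennreal_plus[symmetric] del: ennreal_plus)
    finally show "emeasure S {s<..t} = emeasure N {s<..t}" "emeasure S {s<..t} \<noteq> \<infinity>"
      by (auto simp: N.emeasure_eq_measure)
  qed (use S_sets N in auto)
  then show ?thesis using S[OF B] by simp
qed

locale rectifiable_curve =
  fixes a b :: real and \<gamma> :: "real \<Rightarrow> 'a::metric_space"
  assumes a_le_b: "a \<le> b" and cont: "continuous_on {a..b} \<gamma>"
    and rectifiable: "curve_length a b \<gamma> < \<infinity>"
begin

lemma curve_length_finite: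
  assumes "a \<le> s" "s \<le> t" "t \<le> b" shows "curve_length s t \<gamma> < \<infinity>"
  using curve_length_mono[OF assms] rectifiable by (rule order.strict_trans1)

lemma subcurve: "a \<le> s \<Longrightarrow> s \<le> t \<Longrightarrow> t \<le> b \<Longrightarrow> rectifiable_curve s t \<gamma>"
  using cont curve_length_finite[of s t]
  by (auto simp: rectifiable_curve_def intro: continuous_on_subset)

definition arc_length :: "real \<Rightarrow> real" where
  "arc_length \<tau> = enn2real (curve_length a (max a (min b \<tau>)) \<gamma>)"

lemma arc_length_diff:
  assumes "s \<le> t"
  shows "ennreal (arc_length t - arc_length s) = curve_length (max a (min b s)) (max a (min b t)) \<gamma>"
    and "arc_length s \<le> arc_length t"
proof -
  let ?s = "max a (min b s)" and ?t = "max a (min b t)"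
  have o: "a \<le> ?s" "?s \<le> ?t" "?t \<le> b" using assms a_le_b by auto
  have "curve_length a ?t \<gamma> = curve_length a ?s \<gamma> + curve_length ?s ?t \<gamma>"
    using o by (intro curve_length_split)
  then have "arc_length t = arc_length s + enn2real (curve_length ?s ?t \<gamma>)"
    using o curve_length_finite[of a ?s] curve_length_finite[of ?s ?t]
    by (simp add: arc_length_def enn2real_plus)
  then show "ennreal (arc_length t - arc_length s) = curve_length ?s ?t \<gamma>"
    "arc_length s \<le> arc_length t"
    using o curve_length_finite[of ?s ?t] by auto
qed

lemma continuous_on_arc_length: "continuous_on UNIV arc_length"
  unfolding arc_length_def[abs_def]
  by (rule continuous_on_compose2[OF continuous_on_curve_length[OF cont rectifiable]])
    (use a_le_b in \<open>auto intro!: continuous_intros\<close>)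

abbreviation "\<nu> \<equiv> length_measure a b \<gamma>"

lemma length_measure_eq: "\<nu> = interval_measure arc_length"
  by (simp add: length_measure_def arc_length_def[abs_def])

lemma sets_length_measure [simp, measurable_cong]: "sets \<nu> = sets borel"
  and space_length_measure [simp]: "space \<nu> = UNIV"
  by (simp_all add: length_measure_eq)

lemma length_measure_Ioc_clamp:
  assumes "s \<le> t"
  shows "emeasure \<nu> {s<..t} = curve_length (max a (min b s)) (max a (min b t)) \<gamma>"
proof -
  have "continuous (at_right x) arc_length" for x
    using continuous_on_arc_length
    by (auto simp: continuous_on_eq_continuous_within intro: continuous_within_subset)
  then show ?thesis
    unfolding length_measure_eq using assms arc_length_diff
    by (subst emeasure_interval_measure_Ioc) auto
qed

lemma length_measure_Ioc:
  assumes "a \<le> s" "s \<le> t" "t \<le> b"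
  shows "emeasure \<nu> {s<..t} = curve_length s t \<gamma>"
  using assms by (simp add: length_measure_Ioc_clamp)

lemma length_measure_singleton [simp]: "emeasure \<nu> {x} = 0"
  using emeasure_interval_measure_Icc[of x x arc_length] arc_length_diff continuous_on_arc_length
  by (simp add: length_measure_eq)

lemma finite_length_measure: "finite_measure \<nu>"
proof
  have "emeasure \<nu> (\<Union>n. {- real n<..real n}) = (SUP n. emeasure \<nu> {- real n<..real n})"
    by (rule SUP_emeasure_incseq[symmetric]) (auto simp: incseq_def)
  also have "\<dots> \<le> curve_length a b \<gamma>"
    using a_le_b by (intro SUP_least) (subst length_measure_Ioc_clamp, auto intro!: curve_length_mono)
  also note UN_Ioc_eq_UNIV
  finally show "emeasure \<nu> (space \<nu>) \<noteq> \<infinity>" using rectifiable by (auto simp: top_unique)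
qed

text \<open>By additivity of length, both measures give an interval the length of the part of the
  curve over its intersection with \<open>{s<..t}\<close>. All subcurves can thus be handled through
  the single measure \<open>\<nu>\<close>, and half-open parameter intervals fit together without
  overlap.\<close>

lemma length_measure_subcurve:
  assumes st: "a \<le> s" "s \<le> t" "t \<le> b"
  shows "length_measure s t \<gamma> = density \<nu> (indicator {s<..t})"
proof (rule borel_measure_eqI_Ioc)
  interpret st: rectifiable_curve s t \<gamma> by (rule subcurve[OF st])
  show "sets (length_measure s t \<gamma>) = sets borel" by simp
  fix x y :: real assume xy: "x \<le> y"
  have "emeasure (density \<nu> (indicator {s<..t})) {x<..y} = emeasure \<nu> ({s<..t} \<inter> {x<..y})"
    by (simp add: emeasure_density indicator_inter_arith[symmetric])
  also have "{s<..t} \<inter> {x<..y} = {max s (min t x)<..max s (min t y)}"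
    using st by (auto simp: max_def min_def)
  also have "emeasure \<nu> \<dots> = curve_length (max s (min t x)) (max s (min t y)) \<gamma>"
    using st xy by (intro length_measure_Ioc) auto
  finally show "emeasure (length_measure s t \<gamma>) {x<..y} = emeasure (density \<nu> (indicator {s<..t})) {x<..y}"
    using xy by (simp add: st.length_measure_Ioc_clamp)
  show "emeasure (length_measure s t \<gamma>) {x<..y} \<noteq> \<infinity>"
    using finite_measure.emeasure_finite[OF st.finite_length_measure] by simp
qed simp

text \<open>Outside \<open>[a, b]\<close> nothing is known about \<open>\<gamma>\<close>. The
  indicator allows it to be replaced by the curve with clamped parameter, which is continuous on the
  whole line.\<close>

lemma measurable_along_curve [measurable]:
  assumes "\<rho> \<in> borel_measurable borel" "a \<le> s" "t \<le> b"
  shows "(\<lambda>x. \<rho> (\<gamma> x) * indicator {s..t} x :: ennreal) \<in> borel_measurable borel"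
    and "(\<lambda>x. \<rho> (\<gamma> x) * indicator {s<..t} x :: ennreal) \<in> borel_measurable borel"
proof -
  have "continuous_on UNIV (\<lambda>x. \<gamma> (max a (min b x)))"
    by (rule continuous_on_compose2[OF cont]) (use a_le_b in \<open>auto intro!: continuous_intros\<close>)
  then have [measurable]: "(\<lambda>x. \<gamma> (max a (min b x))) \<in> borel_measurable borel"
    by (rule borel_measurable_continuous_onI)
  note [measurable] = assms(1)
  have clamp: "max a (min b x) = x" if "s \<le> x" "x \<le> t" for x
    using that assms(2,3) by auto
  have "(\<lambda>x. \<rho> (\<gamma> x) * indicator {s..t} x) = (\<lambda>x. \<rho> (\<gamma> (max a (min b x))) * indicator {s..t} x :: ennreal)"
    "(\<lambda>x. \<rho> (\<gamma> x) * indicator {s<..t} x) = (\<lambda>x. \<rho> (\<gamma> (max a (min b x))) * indicator {s<..t} x :: ennreal)"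
    using clamp by (auto simp: fun_eq_iff split: split_indicator)
  then show "(\<lambda>x. \<rho> (\<gamma> x) * indicator {s..t} x :: ennreal) \<in> borel_measurable borel"
    "(\<lambda>x. \<rho> (\<gamma> x) * indicator {s<..t} x :: ennreal) \<in> borel_measurable borel"
    by simp_all
qed

lemma curve_integral_subcurve:
  assumes \<rho>: "\<rho> \<in> borel_measurable borel" and st: "a \<le> s" "s \<le> t" "t \<le> b"
  shows "curve_integral \<rho> (s, t, \<gamma>) = (\<integral>\<^sup>+x\<in>{s<..t}. \<rho> (\<gamma> x) \<partial>\<nu>)"
proof -
  have "curve_integral \<rho> (s, t, \<gamma>) = (\<integral>\<^sup>+x. indicator {s<..t} x * (\<rho> (\<gamma> x) * indicator {s..t} x) \<partial>\<nu>)"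
    using curve_length_finite[OF st] measurable_along_curve(1)[OF \<rho> st(1,3)]
    by (simp add: length_measure_subcurve[OF st] nn_integral_density)
  also have "\<dots> = (\<integral>\<^sup>+x\<in>{s<..t}. \<rho> (\<gamma> x) \<partial>\<nu>)"
    by (intro nn_integral_cong) (auto split: split_indicator)
  finally show ?thesis .
qed

lemma curve_integral_eq:
  assumes "\<rho> \<in> borel_measurable borel"
  shows "curve_integral \<rho> (a, b, \<gamma>) = (\<integral>\<^sup>+x\<in>{a<..b}. \<rho> (\<gamma> x) \<partial>\<nu>)"
  using curve_integral_subcurve[OF assms] a_le_b by simp

lemma curve_integral_subcurve_le:
  assumes "\<rho> \<in> borel_measurable borel" "a \<le> s" "s \<le> t" "t \<le> b"
  shows "curve_integral \<rho> (s, t, \<gamma>) \<le> curve_integral \<rho> (a, b, \<gamma>)"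
  using assms by (simp add: curve_integral_subcurve curve_integral_eq del: curve_integral.simps)
    (auto intro!: nn_integral_mono split: split_indicator)

end

section \<open>Path integrals and exceptional families\<close>

lemma ennreal_powr_top [simp]: "ennreal_powr \<infinity> q = \<infinity>" "ennreal_powr top q = top"
  by (simp_all add: ennreal_powr_def)

lemma ennreal_powr_ennreal: "0 \<le> r \<Longrightarrow> ennreal_powr (ennreal r) q = ennreal (r powr q)"
  by (simp add: ennreal_powr_def)

lemma ennreal_powr_0 [simp]: "ennreal_powr 0 q = 0"
  by (simp add: ennreal_powr_def)

lemma ennreal_powr_1 [simp]: "ennreal_powr 1 q = 1"
  by (simp add: ennreal_powr_def)

lemma ennreal_powr_mono:
  assumes "x \<le> y" "0 \<le> q" shows "ennreal_powr x q \<le> ennreal_powr y q"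
  using assms by (cases x; cases y) (auto simp: ennreal_powr_ennreal powr_mono2 top_unique)

lemma ennreal_powr_less_top_iff [simp]: "ennreal_powr x q < \<infinity> \<longleftrightarrow> x < \<infinity>"
  by (cases x) (auto simp: ennreal_powr_ennreal)

lemma ennreal_powr_mult:
  assumes "0 < q" shows "ennreal_powr (x * y) q = ennreal_powr x q * ennreal_powr y q"
proof (cases x)
  case (real r)
  show ?thesis
  proof (cases y)
    case (real s)
    then show ?thesis using \<open>0 \<le> r\<close> \<open>x = ennreal r\<close> 
      by (simp add: ennreal_mult[symmetric] ennreal_powr_ennreal powr_mult)
  next
    case top
    then show ?thesis using real by (cases "r = 0") (auto simp: ennreal_mult_top ennreal_powr_ennreal)
  qed
next
  case top
  then show ?thesis
    by (cases y) (auto simp: ennreal_top_mult ennreal_powr_ennreal)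
qed

lemma ennreal_powr_powr:
  assumes "q \<noteq> 0" shows "ennreal_powr (ennreal_powr x q) (1 / q) = x" "ennreal_powr (ennreal_powr x (1 / q)) q = x"
  using assms by (cases x; auto simp: ennreal_powr_ennreal powr_powr)+

lemma measurable_ennreal_powr [measurable (raw)]:
  assumes [measurable]: "f \<in> borel_measurable M"
  shows "(\<lambda>x. ennreal_powr (f x) q) \<in> borel_measurable M"
  unfolding ennreal_powr_def by measurable

text \<open>A finite sum is at most the number of its terms times the largest one. The constant is
  crude, but only finiteness and smallness of energies matter later, and this takes the place of
  Minkowski's inequality.\<close>

lemma ennreal_powr_sum_le:
  assumes "finite I" "0 < q"
  shows "ennreal_powr (\<Sum>i\<in>I. x i) q \<le> ennreal_powr (of_nat (card I)) q * (\<Sum>i\<in>I. ennreal_powr (x i) q)"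
proof (cases "I = {}")
  case False
  have "Max (x ` I) \<in> x ` I" using assms False by (intro Max_in) auto
  then obtain j where j: "j \<in> I" "Max (x ` I) = x j" by (elim imageE) (rule that)
  have "(\<Sum>i\<in>I. x i) \<le> (\<Sum>i\<in>I. x j)"
    using j assms by (intro sum_mono) (auto simp flip: j(2))
  then have "ennreal_powr (\<Sum>i\<in>I. x i) q \<le> ennreal_powr (of_nat (card I) * x j) q"
    using assms by (intro ennreal_powr_mono) auto
  also have "\<dots> = ennreal_powr (of_nat (card I)) q * ennreal_powr (x j) q"
    by (rule ennreal_powr_mult[OF assms(2)])
  also have "\<dots> \<le> ennreal_powr (of_nat (card I)) q * (\<Sum>i\<in>I. ennreal_powr (x i) q)"
    using j assms by (intro mult_left_mono member_le_sum) auto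
  finally show ?thesis .
qed simp

lemma ennreal_powr_add_le:
  assumes "0 < q"
  shows "ennreal_powr (x + y) q \<le> ennreal_powr 2 q * (ennreal_powr x q + ennreal_powr y q)"
  using ennreal_powr_sum_le[of "UNIV :: bool set" q "\<lambda>i. if i then x else y"] assms
  by (simp add: UNIV_bool add.commute)

lemma suminf_half: "(\<Sum>k. ennreal ((1/2) ^ Suc k)) = 1"
proof -
  have "(\<Sum>k. ennreal ((1/2) ^ Suc k)) = ennreal 1"
    by (rule suminf_ennreal_eq[OF _ power_half_series]) simp
  then show ?thesis by (simp only: ennreal_1)
qed

text \<open>Each \<open>x k\<close> is at most the \<open>q\<close>-th root of the right-hand side,
  and the weights on the left sum to 1, so the weighted series obeys the same bound.\<close>

lemma ennreal_powr_suminf_le: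
  assumes "0 < q"
  shows "ennreal_powr (\<Sum>k. ennreal ((1/2) ^ Suc k) * x k) q \<le> (\<Sum>k. ennreal_powr (x k) q)"
proof -
  let ?S = "\<Sum>k. ennreal_powr (x k) q"
  have le: "x k \<le> ennreal_powr ?S (1 / q)" for k
  proof -
    have "ennreal_powr (x k) q = (\<Sum>i\<in>{k}. ennreal_powr (x i) q)" by simp
    also have "\<dots> \<le> ?S" by (intro sum_le_suminf) auto
    finally have "ennreal_powr (ennreal_powr (x k) q) (1 / q) \<le> ennreal_powr ?S (1 / q)"
      using assms by (intro ennreal_powr_mono) auto
    then show ?thesis using assms by (simp add: ennreal_powr_powr)
  qed
  have "(\<Sum>k. ennreal ((1/2) ^ Suc k) * x k) \<le> (\<Sum>k. ennreal ((1/2) ^ Suc k) * ennreal_powr ?S (1 / q))"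
    using le by (intro suminf_le mult_left_mono) auto
  also have "\<dots> = (\<Sum>k. ennreal ((1/2) ^ Suc k)) * ennreal_powr ?S (1 / q)"
    by (rule ennreal_suminf_multc)
  also note suminf_half
  finally have "(\<Sum>k. ennreal ((1/2) ^ Suc k) * x k) \<le> ennreal_powr ?S (1 / q)"
    by (simp only: mult_1)
  then have "ennreal_powr (\<Sum>k. ennreal ((1/2) ^ Suc k) * x k) q \<le> ennreal_powr (ennreal_powr ?S (1 / q)) q"
    using assms by (intro ennreal_powr_mono) auto
  then show ?thesis using assms by (simp add: ennreal_powr_powr)
qed

section \<open>Monotonicity and linearity of path integrals\<close>

lemma curve_integral_mono:
  assumes "\<And>x. \<rho> x \<le> \<sigma> x" shows "curve_integral \<rho> c \<le> curve_integral \<sigma> c"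
  using assms by (cases c) (auto intro!: nn_integral_mono mult_right_mono)

lemma curve_integral_finite_rectifiable:
  assumes "(a, b, \<gamma>) \<in> curves" "curve_integral \<rho> (a, b, \<gamma>) < \<infinity>"
  shows "rectifiable_curve a b \<gamma>"
  using assms by (auto simp: rectifiable_curve_def curves_def split: if_splits)

lemma curve_integral_add:
  assumes "\<rho> \<in> borel_measurable borel" "\<sigma> \<in> borel_measurable borel" and c: "c \<in> curves"
  shows "curve_integral (\<lambda>x. \<rho> x + \<sigma> x) c = curve_integral \<rho> c + curve_integral \<sigma> c"
proof -
  obtain a b \<gamma> where c_eq: "c = (a, b, \<gamma>)" by (cases c)
  show ?thesis
  proof (cases "curve_length a b \<gamma> < \<infinity>")
    case True
    then interpret rectifiable_curve a b \<gamma>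
      using c by (auto simp: c_eq curves_def rectifiable_curve_def)
    show ?thesis
      using True measurable_along_curve(1)[OF assms(1), of a b] measurable_along_curve(1)[OF assms(2), of a b]
      by (simp add: c_eq distrib_right nn_integral_add)
  qed (simp add: c_eq)
qed

lemma curve_integral_cmult:
  assumes "\<rho> \<in> borel_measurable borel" and c: "c \<in> curves" and k: "k \<noteq> 0"
  shows "curve_integral (\<lambda>x. k * \<rho> x) c = k * curve_integral \<rho> c"
proof -
  obtain a b \<gamma> where c_eq: "c = (a, b, \<gamma>)" by (cases c)
  show ?thesis
  proof (cases "curve_length a b \<gamma> < \<infinity>")
    case True
    then interpret rectifiable_curve a b \<gamma>
      using c by (auto simp: c_eq curves_def rectifiable_curve_def)
    show ?thesis
      using True measurable_along_curve(1)[OF assms(1), of a b]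
      by (simp add: c_eq mult.assoc nn_integral_cmult)
  qed (use k in \<open>simp add: c_eq ennreal_mult_top\<close>)
qed

lemma curve_integral_suminf:
  assumes "\<And>k::nat. \<rho> k \<in> borel_measurable borel" and c: "c \<in> curves"
  shows "curve_integral (\<lambda>x. \<Sum>k. \<rho> k x) c = (\<Sum>k. curve_integral (\<rho> k) c)"
proof -
  obtain a b \<gamma> where c_eq: "c = (a, b, \<gamma>)" by (cases c)
  show ?thesis
  proof (cases "curve_length a b \<gamma> < \<infinity>")
    case True
    then interpret rectifiable_curve a b \<gamma>
      using c by (auto simp: c_eq curves_def rectifiable_curve_def)
    have "(\<integral>\<^sup>+x\<in>{a..b}. (\<Sum>k. \<rho> k (\<gamma> x)) \<partial>\<nu>) = (\<integral>\<^sup>+x. (\<Sum>k. \<rho> k (\<gamma> x) * indicator {a..b} x) \<partial>\<nu>)"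
      by (intro nn_integral_cong) simp
    also have "\<dots> = (\<Sum>k. \<integral>\<^sup>+x\<in>{a..b}. \<rho> k (\<gamma> x) \<partial>\<nu>)"
      using measurable_along_curve(1)[OF assms(1), of a b] by (intro nn_integral_suminf) simp
    finally show ?thesis using True by (simp add: c_eq)
  next
    case False
    have "(\<Sum>k::nat. \<infinity>::ennreal) \<ge> (\<Sum>k\<in>{0::nat}. \<infinity>)" by (intro sum_le_suminf) auto
    then show ?thesis using False by (simp add: c_eq top_unique)
  qed
qed

section \<open>The Caratheodory measure, energies and almost every curve\<close>

locale newton_sobolev =
  fixes \<mu> :: "'a::metric_space set \<Rightarrow> ennreal" and p :: real
  assumes p_ge_1: "1 \<le> p" and mms: "metric_measure_space \<mu>"
begin

abbreviation "M \<equiv> caratheodory_measure \<mu>"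

lemma p_pos: "0 < p" using p_ge_1 by simp

lemma outer: "outer_measure_space (Pow UNIV) \<mu>"
  using mms by (simp add: metric_measure_space_def)

lemma measure_space_caratheodory: "measure_space UNIV (caratheodory_sets \<mu>) \<mu>"
proof -
  interpret sigma_algebra UNIV "Pow (UNIV :: 'a set)" by (rule sigma_algebra_Pow)
  show ?thesis unfolding caratheodory_sets_def using caratheodory_lemma[OF outer] by simp
qed

lemma space_M [simp]: "space M = UNIV"
  by (simp add: caratheodory_measure_def space_measure_of_conv)

lemma sets_M: "sets M = caratheodory_sets \<mu>"
  using measure_space_caratheodory
  by (auto simp: caratheodory_measure_def sets_measure_of_conv measure_space_def
      sigma_algebra.sigma_sets_eq)

lemma emeasure_M: "A \<in> sets M \<Longrightarrow> emeasure M A = \<mu> A"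
  using measure_space_caratheodory unfolding sets_M unfolding caratheodory_measure_def
  by (intro emeasure_measure_of_sigma) (auto simp: measure_space_def)

lemma borel_subset_M: "sets borel \<subseteq> sets M"
  using mms by (simp add: metric_measure_space_def borel_regular_def sets_M)

lemma measurable_M [measurable (raw)]:
  "f \<in> measurable borel N \<Longrightarrow> f \<in> measurable M N"
  using borel_subset_M by (auto simp: measurable_def)

lemma borel_null_cover:
  assumes "\<mu> A = 0"
  obtains B where "B \<in> sets borel" "A \<subseteq> B" "B \<in> null_sets M"
proof -
  obtain B where B: "B \<in> sets borel" "A \<subseteq> B" "\<mu> B = \<mu> A"
    using mms unfolding metric_measure_space_def borel_regular_def by blast
  moreover have "B \<in> null_sets M"
    using B assms borel_subset_M by (auto simp: null_sets_def emeasure_M)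
  ultimately show ?thesis using that by blast
qed

text \<open>Weights that define negligible families must be Borel, whereas a null set of
  \<open>M\<close> need not be. Borel regularity of the outer measure bridges the
  difference.\<close>

lemma AE_borel_cover:
  assumes "AE x in M. P x"
  obtains B where "B \<in> sets borel" "B \<in> null_sets M" "\<And>x. x \<notin> B \<Longrightarrow> P x"
proof -
  obtain N where N: "{x. \<not> P x} \<subseteq> N" "N \<in> null_sets M"
    using assms by (auto simp: eventually_ae_filter)
  then have "\<mu> N = 0" by (auto simp: null_sets_def emeasure_M)
  from borel_null_cover[OF this] N that show ?thesis by (metis (mono_tags) mem_Collect_eq subset_iff)
qed

text \<open>The \<open>p\<close>-th power of \<open>Lp_norm\<close>. It is an integral, so series
  and scalings are easy to treat, and smallness of one is smallness of the other.\<close>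

definition energy :: "('a \<Rightarrow> ennreal) \<Rightarrow> ennreal" where
  "energy g = (\<integral>\<^sup>+x. ennreal_powr (g x) p \<partial>M)"

lemma Lp_norm_energy: "Lp_norm \<mu> p g = ennreal_powr (energy g) (1 / p)"
  by (simp add: Lp_norm_def energy_def)

lemma Lp_norm_finite_iff: "Lp_norm \<mu> p g < \<infinity> \<longleftrightarrow> energy g < \<infinity>"
  by (simp only: Lp_norm_energy ennreal_powr_less_top_iff)

lemma Lp_norm_less:
  assumes "energy g < ennreal (\<epsilon> powr p)" "0 < \<epsilon>"
  shows "Lp_norm \<mu> p g < ennreal \<epsilon>"
proof (rule ccontr)
  assume "\<not> ?thesis"
  then have "ennreal \<epsilon> \<le> Lp_norm \<mu> p g" by simp
  then have "ennreal_powr (ennreal \<epsilon>) p \<le> ennreal_powr (Lp_norm \<mu> p g) p"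
    using p_pos by (intro ennreal_powr_mono) auto
  then show False using assms p_pos
    by (simp add: Lp_norm_energy ennreal_powr_powr ennreal_powr_ennreal)
qed

lemma energy_less:
  assumes "Lp_norm \<mu> p g < ennreal (\<epsilon> powr (1 / p))" "0 < \<epsilon>"
  shows "energy g < ennreal \<epsilon>"
proof (rule ccontr)
  assume "\<not> ?thesis"
  then have "ennreal \<epsilon> \<le> energy g" by simp
  then have "ennreal_powr (ennreal \<epsilon>) (1 / p) \<le> Lp_norm \<mu> p g"
    unfolding Lp_norm_energy using p_pos by (intro ennreal_powr_mono) auto
  then show False using assms p_pos by (simp add: ennreal_powr_ennreal)
qed

lemma energy_mono_AE: "AE x in M. g x \<le> h x \<Longrightarrow> energy g \<le> energy h"
  unfolding energy_def using p_pos by (intro nn_integral_mono_AE) (auto intro!: ennreal_powr_mono)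

lemma energy_cong_AE: "AE x in M. g x = h x \<Longrightarrow> energy g = energy h"
  unfolding energy_def by (intro nn_integral_cong_AE) auto

lemma energy_add:
  assumes [measurable]: "g \<in> borel_measurable M" "h \<in> borel_measurable M"
  shows "energy (\<lambda>x. g x + h x) \<le> ennreal_powr 2 p * (energy g + energy h)"
proof -
  have "energy (\<lambda>x. g x + h x) \<le>
      (\<integral>\<^sup>+x. ennreal_powr 2 p * (ennreal_powr (g x) p + ennreal_powr (h x) p) \<partial>M)"
    unfolding energy_def by (intro nn_integral_mono ennreal_powr_add_le p_pos)
  also have "\<dots> = ennreal_powr 2 p * (energy g + energy h)"
    by (simp add: nn_integral_cmult nn_integral_add energy_def)
  finally show ?thesis .
qed

lemma energy_sum:
  assumes I: "finite I" and [measurable]: "\<And>i. i \<in> I \<Longrightarrow> g i \<in> borel_measurable M"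
  shows "energy (\<lambda>x. \<Sum>i\<in>I. g i x) \<le> ennreal_powr (of_nat (card I)) p * (\<Sum>i\<in>I. energy (g i))"
proof -
  have "energy (\<lambda>x. \<Sum>i\<in>I. g i x) \<le>
      (\<integral>\<^sup>+x. ennreal_powr (of_nat (card I)) p * (\<Sum>i\<in>I. ennreal_powr (g i x) p) \<partial>M)"
    unfolding energy_def by (intro nn_integral_mono ennreal_powr_sum_le p_pos I)
  also have "\<dots> = ennreal_powr (of_nat (card I)) p * (\<Sum>i\<in>I. energy (g i))"
    by (simp add: nn_integral_cmult nn_integral_sum energy_def)
  finally show ?thesis .
qed

lemma energy_cmult:
  assumes "g \<in> borel_measurable M"
  shows "energy (\<lambda>x. k * g x) = ennreal_powr k p * energy g"
  using assms by (simp add: energy_def ennreal_powr_mult[OF p_pos] nn_integral_cmult)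

lemma energy_suminf:
  assumes [measurable]: "\<And>k::nat. g k \<in> borel_measurable M"
  shows "energy (\<lambda>x. \<Sum>k. ennreal ((1/2) ^ Suc k) * g k x) \<le> (\<Sum>k. energy (g k))"
proof -
  have "energy (\<lambda>x. \<Sum>k. ennreal ((1/2) ^ Suc k) * g k x) \<le> (\<integral>\<^sup>+x. (\<Sum>k. ennreal_powr (g k x) p) \<partial>M)"
    unfolding energy_def by (intro nn_integral_mono ennreal_powr_suminf_le p_pos)
  also have "\<dots> = (\<Sum>k. energy (g k))"
    by (simp add: nn_integral_suminf energy_def)
  finally show ?thesis .
qed

lemma Lp_borel_iff: "\<rho> \<in> Lp_borel \<mu> p \<longleftrightarrow> \<rho> \<in> borel_measurable borel \<and> energy \<rho> < \<infinity>"
  unfolding Lp_borel_def by (simp only: mem_Collect_eq Lp_norm_finite_iff)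

lemma Lp_borel_measurable: "\<rho> \<in> Lp_borel \<mu> p \<Longrightarrow> \<rho> \<in> borel_measurable borel"
  by (simp add: Lp_borel_iff)

lemma Lp_borel_add:
  assumes "\<rho> \<in> Lp_borel \<mu> p" "\<sigma> \<in> Lp_borel \<mu> p"
  shows "(\<lambda>x. \<rho> x + \<sigma> x) \<in> Lp_borel \<mu> p"
proof -
  have [measurable]: "\<rho> \<in> borel_measurable borel" "\<sigma> \<in> borel_measurable borel"
    using assms by (auto simp: Lp_borel_iff)
  have "energy (\<lambda>x. \<rho> x + \<sigma> x) \<le> ennreal_powr 2 p * (energy \<rho> + energy \<sigma>)"
    by (intro energy_add) measurable
  also have "\<dots> < \<infinity>" using assms
    by (auto simp: Lp_borel_iff ennreal_mult_less_top ennreal_powr_less_top_iff[unfolded infinity_ennreal_def])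
  finally show ?thesis by (simp add: Lp_borel_iff)
qed

lemma Lp_borel_cmult:
  assumes "\<rho> \<in> Lp_borel \<mu> p" "k < \<infinity>"
  shows "(\<lambda>x. k * \<rho> x) \<in> Lp_borel \<mu> p"
  using assms energy_cmult[OF measurable_M[OF Lp_borel_measurable[OF assms(1)]], of k]
  by (auto simp: Lp_borel_iff ennreal_mult_less_top ennreal_powr_less_top_iff[unfolded infinity_ennreal_def])

lemma Lp_borel_mono:
  assumes "\<rho> \<in> Lp_borel \<mu> p" "\<sigma> \<in> borel_measurable borel" "AE x in M. \<sigma> x \<le> \<rho> x"
  shows "\<sigma> \<in> Lp_borel \<mu> p"
  using assms energy_mono_AE[OF assms(3)] by (auto simp: Lp_borel_iff)

lemma Lp_borel_finite_AE:
  assumes "\<rho> \<in> Lp_borel \<mu> p" shows "AE x in M. \<rho> x < \<infinity>"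
proof -
  have [measurable]: "\<rho> \<in> borel_measurable borel" using assms by (simp add: Lp_borel_iff)
  have "AE x in M. ennreal_powr (\<rho> x) p \<noteq> \<infinity>"
    using assms by (intro nn_integral_noteq_infinite) (auto simp: Lp_borel_iff energy_def)
  then show ?thesis
    by eventually_elim (auto simp: less_top[symmetric])
qed

text \<open>This weight costs no energy, yet its integral is infinite along every curve that spends
  positive length in \<open>B\<close>; such curves therefore form a negligible family.\<close>

lemma Lp_borel_null:
  assumes "B \<in> sets borel" "B \<in> null_sets M"
  shows "(\<lambda>x. \<infinity> * indicator B x) \<in> Lp_borel \<mu> p"
proof -
  have "AE x in M. x \<notin> B" using assms(2) by (rule AE_not_in)
  then have "AE x in M. \<infinity> * indicator B x = (0::ennreal)" by eventually_elim auto
  from energy_cong_AE[OF this] have "energy (\<lambda>x. \<infinity> * indicator B x) = 0" by (simp add: energy_def)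
  then show ?thesis using assms by (auto simp: Lp_borel_iff)
qed

text \<open>The property holds for \<open>p\<close>-almost every curve. The exceptional family is
  recorded only by a weight \<open>\<sigma>\<close>; nonrectifiable curves have infinite integral by
  convention, so they are always exceptional.\<close>

definition ae_curve :: "('a curve \<Rightarrow> bool) \<Rightarrow> bool" where
  "ae_curve P \<longleftrightarrow> (\<exists>\<sigma>\<in>Lp_borel \<mu> p. \<forall>c\<in>curves. curve_integral \<sigma> c < \<infinity> \<longrightarrow> P c)"

lemma ae_curve_finite: "\<rho> \<in> Lp_borel \<mu> p \<Longrightarrow> ae_curve (\<lambda>c. curve_integral \<rho> c < \<infinity>)"
  unfolding ae_curve_def by blast

lemma ae_curve_mono:
  "ae_curve P \<Longrightarrow> (\<And>c. c \<in> curves \<Longrightarrow> P c \<Longrightarrow> Q c) \<Longrightarrow> ae_curve Q"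
  unfolding ae_curve_def by blast

lemma ae_curve_conj:
  assumes "ae_curve P" "ae_curve Q" shows "ae_curve (\<lambda>c. P c \<and> Q c)"
proof -
  obtain \<rho> \<sigma> where *: "\<rho> \<in> Lp_borel \<mu> p" "\<And>c. c \<in> curves \<Longrightarrow> curve_integral \<rho> c < \<infinity> \<Longrightarrow> P c"
     "\<sigma> \<in> Lp_borel \<mu> p" "\<And>c. c \<in> curves \<Longrightarrow> curve_integral \<sigma> c < \<infinity> \<Longrightarrow> Q c"
    using assms unfolding ae_curve_def by blast
  have "P c \<and> Q c" if "c \<in> curves" "curve_integral (\<lambda>x. \<rho> x + \<sigma> x) c < \<infinity>" for c
    using that * by (auto simp: curve_integral_add Lp_borel_measurable)
  then show ?thesis unfolding ae_curve_def using Lp_borel_add[OF *(1,3)] by blast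
qed

lemma ex_small_scaling:
  assumes "\<rho> \<in> Lp_borel \<mu> p" "0 < \<delta>"
  shows "\<exists>k>0. energy (\<lambda>x. ennreal k * \<rho> x) \<le> ennreal \<delta>"
proof -
  obtain E where E: "energy \<rho> = ennreal E" "0 \<le> E"
    using assms(1) by (cases "energy \<rho>") (auto simp: Lp_borel_iff)
  \<comment> \<open>Scaling by \<open>?k\<close> multiplies the energy by
    \<open>\<delta> / (E + 1)\<close>; the added 1 keeps the quotient meaningful and the factor
    positive when \<open>E\<close> is 0.\<close>
  let ?k = "(\<delta> / (E + 1)) powr (1 / p)"
  have "energy (\<lambda>x. ennreal ?k * \<rho> x) = ennreal (?k powr p) * ennreal E"
    using energy_cmult[OF measurable_M[OF Lp_borel_measurable[OF assms(1)]]] E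
    by (simp add: ennreal_powr_ennreal)
  also have "\<dots> = ennreal (\<delta> / (E + 1) * E)"
    using p_pos E assms(2) by (simp add: powr_powr ennreal_mult[symmetric])
  also have "\<dots> \<le> ennreal \<delta>" using E assms(2) by (intro ennreal_leI) (simp add: field_simps)
  finally show ?thesis using assms(2) E by (intro exI[of _ ?k]) auto
qed

text \<open>Countable unions of negligible families are negligible: the weights are scaled until
  their energies are summable, and their weighted sum still dominates a positive multiple of each of
  them, so it is infinite along every curve that is exceptional for some \<open>n\<close>.\<close>

lemma ae_curve_all:
  assumes "\<And>n::nat. ae_curve (P n)" shows "ae_curve (\<lambda>c. \<forall>n. P n c)"
proof -
  have "\<forall>n. \<exists>\<sigma>\<in>Lp_borel \<mu> p. \<forall>c\<in>curves. curve_integral \<sigma> c < \<infinity> \<longrightarrow> P n c"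
    using assms unfolding ae_curve_def by blast
  then obtain \<sigma> where \<sigma>: "\<And>n. \<sigma> n \<in> Lp_borel \<mu> p"
    "\<And>n c. c \<in> curves \<Longrightarrow> curve_integral (\<sigma> n) c < \<infinity> \<Longrightarrow> P n c"
    by metis
  have "\<forall>n. \<exists>k>0. energy (\<lambda>x. ennreal k * \<sigma> n x) \<le> ennreal ((1/2) ^ Suc n)"
    using ex_small_scaling[OF \<sigma>(1)] by simp
  then obtain k where k: "\<And>n. k n > 0" "\<And>n. energy (\<lambda>x. ennreal (k n) * \<sigma> n x) \<le> ennreal ((1/2) ^ Suc n)"
    by metis
  note [measurable] = Lp_borel_measurable[OF \<sigma>(1)]
  let ?\<tau> = "\<lambda>x. \<Sum>n. ennreal ((1/2) ^ Suc n) * (ennreal (k n) * \<sigma> n x)"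
  have "energy ?\<tau> \<le> (\<Sum>n. energy (\<lambda>x. ennreal (k n) * \<sigma> n x))"
    by (intro energy_suminf) measurable
  also have "\<dots> \<le> (\<Sum>n. ennreal ((1/2) ^ Suc n))"
    by (intro suminf_le k) auto
  also note suminf_half
  finally have \<tau>: "?\<tau> \<in> Lp_borel \<mu> p"
    by (auto simp: Lp_borel_iff intro: order.strict_trans1)
  have "P n c" if c: "c \<in> curves" "curve_integral ?\<tau> c < \<infinity>" for n c
  proof -
    let ?r = "ennreal ((1/2) ^ Suc n) * ennreal (k n)"
    have "?r * curve_integral (\<sigma> n) c = curve_integral (\<lambda>x. \<Sum>i\<in>{n}. ennreal ((1/2) ^ Suc i) * (ennreal (k i) * \<sigma> i x)) c"
      using k(1)[of n] curve_integral_cmult[OF Lp_borel_measurable[OF \<sigma>(1)] c(1), of ?r n]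
      by (simp add: mult.assoc)
    also have "\<dots> \<le> curve_integral ?\<tau> c"
      by (intro curve_integral_mono sum_le_suminf) auto
    finally have "?r * curve_integral (\<sigma> n) c < \<infinity>" using c(2) by (rule order.strict_trans1)
    then have "curve_integral (\<sigma> n) c < \<infinity>"
      using k(1)[of n] by (auto simp: ennreal_mult_less_top)
    then show ?thesis using \<sigma>(2) c(1) by blast
  qed
  then show ?thesis unfolding ae_curve_def using \<tau> by blast
qed

text \<open>The integral of the weight over a subcurve is at most that over the whole curve. Hence
  one weight excludes every curve with an exceptional subcurve, although the subcurves are
  uncountably many.\<close>

lemma ae_curve_subcurves:
  assumes "ae_curve P"
  shows "ae_curve (\<lambda>(a, b, \<gamma>). rectifiable_curve a b \<gamma> \<and>
    (\<forall>s t. a \<le> s \<longrightarrow> s \<le> t \<longrightarrow> t \<le> b \<longrightarrow> P (s, t, \<gamma>)))"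
proof -
  obtain \<sigma> where \<sigma>: "\<sigma> \<in> Lp_borel \<mu> p" "\<And>c. c \<in> curves \<Longrightarrow> curve_integral \<sigma> c < \<infinity> \<Longrightarrow> P c"
    using assms unfolding ae_curve_def by blast
  show ?thesis unfolding ae_curve_def
  proof (rule bexI[OF _ \<sigma>(1)], clarify, intro conjI allI impI)
    fix a b and \<gamma> :: "real \<Rightarrow> 'a"
    assume c: "(a, b, \<gamma>) \<in> curves" "curve_integral \<sigma> (a, b, \<gamma>) < \<infinity>"
    then interpret rectifiable_curve a b \<gamma> by (rule curve_integral_finite_rectifiable)
    show "rectifiable_curve a b \<gamma>" by unfold_locales
    fix s t assume st: "a \<le> s" "s \<le> t" "t \<le> b"
    show "P (s, t, \<gamma>)"
    proof (rule \<sigma>(2))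
      show "(s, t, \<gamma>) \<in> curves" using st cont by (auto simp: curves_def intro: continuous_on_subset)
      show "curve_integral \<sigma> (s, t, \<gamma>) < \<infinity>"
        using curve_integral_subcurve_le[OF Lp_borel_measurable[OF \<sigma>(1)] st] c(2) by (rule order.strict_trans1)
    qed
  qed
qed

text \<open>The weight is infinite on a Borel null set that covers the failures of \<open>P\<close>.
  If its integral along a curve is finite, the curve spends zero length in that set.\<close>

lemma ae_curve_null:
  assumes "AE x in M. P x"
  shows "ae_curve (\<lambda>(a, b, \<gamma>). AE t in length_measure a b \<gamma>. t \<in> {a<..b} \<longrightarrow> P (\<gamma> t))"
proof -
  obtain B where B: "B \<in> sets borel" "B \<in> null_sets M" "\<And>x. x \<notin> B \<Longrightarrow> P x"
    using AE_borel_cover[OF assms] by metis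
  show ?thesis unfolding ae_curve_def
  proof (rule bexI[OF _ Lp_borel_null[OF B(1,2)]], clarify)
    fix a b and \<gamma> :: "real \<Rightarrow> 'a"
    assume c: "(a, b, \<gamma>) \<in> curves" "curve_integral (\<lambda>x. \<infinity> * indicator B x) (a, b, \<gamma>) < \<infinity>"
    then interpret rectifiable_curve a b \<gamma> by (rule curve_integral_finite_rectifiable)
    have m: "(\<lambda>x. \<infinity> * indicator B x :: ennreal) \<in> borel_measurable borel" using B by simp
    have "AE t in \<nu>. \<infinity> * indicator B (\<gamma> t) * indicator {a<..b} t \<noteq> (\<infinity>::ennreal)"
      using c(2) measurable_along_curve(2)[OF m, of a b] unfolding curve_integral_eq[OF m]
      by (intro nn_integral_noteq_infinite) auto
    then show "AE t in \<nu>. t \<in> {a<..b} \<longrightarrow> P (\<gamma> t)"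
      by eventually_elim (auto split: split_indicator_asm intro: B(3))
  qed
qed

lemma weak_upper_gradient_iff:
  "weak_upper_gradient \<mu> p u \<rho> \<longleftrightarrow> \<rho> \<in> borel_measurable borel \<and>
     ae_curve (\<lambda>(a, b, \<gamma>). ennreal (norm (u (\<gamma> a) - u (\<gamma> b))) \<le> curve_integral \<rho> (a, b, \<gamma>))"
  (is "_ \<longleftrightarrow> _ \<and> ae_curve ?P")
proof -
  have "(\<exists>\<Gamma>. negligible_family \<mu> p \<Gamma> \<and> (\<forall>c\<in>curves - \<Gamma>. ?P c)) \<longleftrightarrow> ae_curve ?P"
  proof
    assume "\<exists>\<Gamma>. negligible_family \<mu> p \<Gamma> \<and> (\<forall>c\<in>curves - \<Gamma>. ?P c)"
    then show "ae_curve ?P"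
      unfolding negligible_family_def ae_curve_def by (metis (no_types, lifting) DiffI less_irrefl)
  next
    assume "ae_curve ?P"
    then obtain \<sigma> where \<sigma>: "\<sigma> \<in> Lp_borel \<mu> p" "\<And>c. c \<in> curves \<Longrightarrow> curve_integral \<sigma> c < \<infinity> \<Longrightarrow> ?P c"
      unfolding ae_curve_def by blast
    then show "\<exists>\<Gamma>. negligible_family \<mu> p \<Gamma> \<and> (\<forall>c\<in>curves - \<Gamma>. ?P c)"
      unfolding negligible_family_def
      by (intro exI[of _ "{c \<in> curves. curve_integral \<sigma> c = \<infinity>}"])
        (auto simp: less_top[symmetric] simp del: curve_integral.simps)
  qed
  then show ?thesis unfolding weak_upper_gradient_def by auto
qed

end

section \<open>Absolute continuity along curves\<close>

context rectifiable_curve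
begin

text \<open>Its mass on \<open>{s<..t}\<close> is the integral of \<open>\<rho>\<close> over the
  corresponding subcurve. Upper gradient inequalities on all subcurves thereby become a comparison
  of measures on the parameter line.\<close>

definition gradient_measure :: "('a \<Rightarrow> ennreal) \<Rightarrow> real measure" where
  "gradient_measure \<rho> = density \<nu> (\<lambda>x. \<rho> (\<gamma> x) * indicator {a<..b} x)"

lemma sets_gradient_measure [simp, measurable_cong]: "sets (gradient_measure \<rho>) = sets borel"
  and space_gradient_measure [simp]: "space (gradient_measure \<rho>) = UNIV"
  by (simp_all add: gradient_measure_def)

lemma emeasure_gradient_measure:
  assumes "\<rho> \<in> borel_measurable borel" "B \<in> sets borel"
  shows "emeasure (gradient_measure \<rho>) B = (\<integral>\<^sup>+x. \<rho> (\<gamma> x) * indicator {a<..b} x * indicator B x \<partial>\<nu>)"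
  unfolding gradient_measure_def using assms measurable_along_curve(2)[OF assms(1), of a b]
  by (subst emeasure_density) auto

lemma gradient_measure_Ioc:
  assumes \<rho>: "\<rho> \<in> borel_measurable borel" and "a \<le> s" "s \<le> t" "t \<le> b"
  shows "emeasure (gradient_measure \<rho>) {s<..t} = curve_integral \<rho> (s, t, \<gamma>)"
  unfolding emeasure_gradient_measure[OF \<rho>, of "{s<..t}", simplified] curve_integral_subcurve[OF assms]
  using assms by (intro nn_integral_cong) (auto split: split_indicator)

lemma finite_gradient_measure:
  assumes \<rho>: "\<rho> \<in> borel_measurable borel" and fin: "curve_integral \<rho> (a, b, \<gamma>) < \<infinity>"
  shows "finite_measure (gradient_measure \<rho>)"
  using fin emeasure_gradient_measure[OF \<rho>, of UNIV] curve_integral_eq[OF \<rho>]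
  by (intro finite_measureI) (auto simp del: curve_integral.simps)

lemma gradient_measure_null:
  assumes \<rho>: "\<rho> \<in> borel_measurable borel" and B: "B \<in> sets borel" "emeasure \<nu> B = 0"
  shows "emeasure (gradient_measure \<rho>) B = 0"
proof -
  have "AE x in \<nu>. x \<notin> B" using B by (intro AE_not_in) (auto simp: null_sets_def)
  then have "(\<integral>\<^sup>+x. \<rho> (\<gamma> x) * indicator {a<..b} x * indicator B x \<partial>\<nu>) = (\<integral>\<^sup>+x. 0 \<partial>\<nu>)"
    by (intro nn_integral_cong_AE) auto
  then show ?thesis using emeasure_gradient_measure[OF \<rho> B(1)] by simp
qed

text \<open>The intersection of the sets is null for the length measure, hence for the gradient
  measure, which has a density; finiteness then gives continuity from above.\<close>

lemma gradient_measure_tendsto_0: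
  assumes \<rho>: "\<rho> \<in> borel_measurable borel" and fin: "curve_integral \<rho> (a, b, \<gamma>) < \<infinity>"
    and A: "\<And>n. A n \<in> sets borel" "decseq A" and lim: "(\<lambda>n. emeasure \<nu> (A n)) \<longlonglongrightarrow> 0"
  shows "(\<lambda>n. emeasure (gradient_measure \<rho>) (A n)) \<longlonglongrightarrow> 0"
proof -
  interpret m: finite_measure "gradient_measure \<rho>" by (rule finite_gradient_measure[OF \<rho> fin])
  interpret n: finite_measure \<nu> by (rule finite_length_measure)
  have "(\<lambda>n. emeasure \<nu> (A n)) \<longlonglongrightarrow> emeasure \<nu> (\<Inter>n. A n)"
    using A by (intro Lim_emeasure_decseq) auto
  then have "emeasure \<nu> (\<Inter>n. A n) = 0" using lim LIMSEQ_unique by blast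
  then have "emeasure (gradient_measure \<rho>) (\<Inter>n. A n) = 0"
    using A by (intro gradient_measure_null[OF \<rho>]) auto
  moreover have "(\<lambda>n. emeasure (gradient_measure \<rho>) (A n)) \<longlonglongrightarrow> emeasure (gradient_measure \<rho>) (\<Inter>n. A n)"
    using A by (intro Lim_emeasure_decseq) auto
  ultimately show ?thesis by simp
qed

lemma ex_arc_length:
  assumes "0 \<le> l" "l \<le> arc_length b"
  shows "\<exists>t\<in>{a..b}. arc_length t = l"
proof -
  have "arc_length a = 0" using a_le_b by (simp add: arc_length_def)
  moreover have "continuous_on {a..b} arc_length"
    using continuous_on_arc_length by (rule continuous_on_subset) simp
  ultimately show ?thesis
    using IVT'[of arc_length a l b] assms a_le_b by auto
qed

lemma length_measure_Ioc_arc_length: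
  assumes "s \<le> t" shows "emeasure \<nu> {s<..t} = ennreal (arc_length t - arc_length s)"
  using assms by (simp add: length_measure_Ioc_clamp arc_length_diff(1))

lemma arc_length_less_imp: "arc_length s < arc_length t \<Longrightarrow> s < t"
  using arc_length_diff(2)[of t s] by fastforce

lemma arc_length_pos:
  assumes "\<gamma> a \<noteq> \<gamma> b" shows "0 < arc_length b"
proof -
  have "0 < ennreal (dist (\<gamma> a) (\<gamma> b))" using assms by simp
  also have "\<dots> \<le> curve_length a b \<gamma>" using a_le_b by (rule dist_le_curve_length)
  finally show ?thesis using rectifiable a_le_b by (simp add: arc_length_def enn2real_positive_iff)
qed

lemma AE_length_measure_ex:
  assumes "AE t in \<nu>. t \<in> {a<..b} \<longrightarrow> P t" "A \<subseteq> {a<..b}" "A \<in> sets borel" "emeasure \<nu> A \<noteq> 0"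
  shows "\<exists>t\<in>A. P t"
proof (rule ccontr)
  assume none: "\<not> ?thesis"
  from assms(1) have "AE t in \<nu>. t \<notin> A" by eventually_elim (use none assms(2) in auto)
  then show False using assms(3,4) AE_iff_measurable[of A \<nu> "\<lambda>t. t \<notin> A"] by auto
qed

text \<open>The curve may stand still at first, so short parameter intervals after \<open>a\<close>
  can have zero length measure and need not meet \<open>P\<close>. The intervals are therefore
  chosen by arc length: \<open>{a<..t n}\<close> has positive length \<open>?L / Suc n\<close>,
  which tends to 0, and so does the integral of \<open>\<rho>\<close> over it.\<close>

lemma ex_near_start:
  assumes \<rho>: "\<rho> \<in> borel_measurable borel" and fin: "curve_integral \<rho> (a, b, \<gamma>) < \<infinity>"
    and AE: "AE t in \<nu>. t \<in> {a<..b} \<longrightarrow> P t" and ne: "\<gamma> a \<noteq> \<gamma> b" and \<epsilon>: "0 < \<epsilon>"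
  shows "\<exists>s\<in>{a<..b}. P s \<and> curve_integral \<rho> (a, s, \<gamma>) < \<epsilon>"
proof -
  let ?L = "arc_length b"
  have L: "0 < ?L" by (rule arc_length_pos[OF ne])
  have "\<forall>n. \<exists>t\<in>{a..b}. arc_length t = ?L / real (Suc n)"
    using L by (intro allI ex_arc_length) (auto simp: field_simps)
  then obtain t where t: "\<And>n. t n \<in> {a..b}" "\<And>n. arc_length (t n) = ?L / real (Suc n)" by metis
  have a0: "arc_length a = 0" using a_le_b by (simp add: arc_length_def)
  have \<nu>: "emeasure \<nu> {a<..t n} = ennreal (?L / real (Suc n))" for n
    using t[of n] by (simp add: length_measure_Ioc_arc_length a0)
  have "decseq (\<lambda>n. {a<..t n})"
  proof (rule decseq_SucI)
    fix n
    have "arc_length (t (Suc n)) < arc_length (t n)"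
      using L unfolding t by (simp add: divide_strict_left_mono)
    then show "{a<..t (Suc n)} \<le> {a<..t n}" using arc_length_less_imp by fastforce
  qed
  moreover have "(\<lambda>n. emeasure \<nu> {a<..t n}) \<longlonglongrightarrow> 0"
  proof -
    have "(\<lambda>n. ennreal (?L / real (Suc n))) \<longlonglongrightarrow> ennreal 0"
      using tendsto_mult_right_zero[OF LIMSEQ_inverse_real_of_nat, of ?L]
      by (intro tendsto_ennrealI) (simp add: field_simps)
    then show ?thesis by (simp add: \<nu>)
  qed
  ultimately have "(\<lambda>n. emeasure (gradient_measure \<rho>) {a<..t n}) \<longlonglongrightarrow> 0"
    by (intro gradient_measure_tendsto_0[OF \<rho> fin]) auto
  from order_tendstoD(2)[OF this \<epsilon>] obtain n where n: "emeasure (gradient_measure \<rho>) {a<..t n} < \<epsilon>"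
    by (auto simp: eventually_sequentially)
  have "\<exists>s\<in>{a<..t n}. P s"
    using t(1)[of n] L by (intro AE_length_measure_ex[OF AE]) (auto simp: \<nu> ennreal_eq_0_iff not_le divide_pos_pos)
  then obtain s where s: "s \<in> {a<..t n}" "P s" by blast
  have "curve_integral \<rho> (a, s, \<gamma>) = emeasure (gradient_measure \<rho>) {a<..s}"
    using s t(1)[of n] by (intro gradient_measure_Ioc[OF \<rho>, symmetric]) auto
  also have "\<dots> \<le> emeasure (gradient_measure \<rho>) {a<..t n}"
    using s by (intro emeasure_mono) auto
  also note n
  finally show ?thesis using s t(1)[of n] by (intro bexI[of _ s]) auto
qed

lemma ex_near_end:
  assumes \<rho>: "\<rho> \<in> borel_measurable borel" and fin: "curve_integral \<rho> (a, b, \<gamma>) < \<infinity>"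
    and AE: "AE t in \<nu>. t \<in> {a<..b} \<longrightarrow> P t" and ne: "\<gamma> a \<noteq> \<gamma> b" and \<epsilon>: "0 < \<epsilon>"
  shows "\<exists>s\<in>{a<..b}. P s \<and> curve_integral \<rho> (s, b, \<gamma>) < \<epsilon>"
proof -
  let ?L = "arc_length b"
  have L: "0 < ?L" by (rule arc_length_pos[OF ne])
  have "\<forall>n. \<exists>t\<in>{a..b}. arc_length t = ?L - ?L / real (Suc n)"
    using L by (intro allI ex_arc_length) (auto simp: field_simps)
  then obtain t where t: "\<And>n. t n \<in> {a..b}" "\<And>n. arc_length (t n) = ?L - ?L / real (Suc n)" by metis
  have \<nu>: "emeasure \<nu> {t n<..b} = ennreal (?L / real (Suc n))" for n
    using t[of n] by (simp add: length_measure_Ioc_arc_length)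
  have "decseq (\<lambda>n. {t n<..b})"
  proof (rule decseq_SucI)
    fix n
    have "arc_length (t n) < arc_length (t (Suc n))"
      using L unfolding t by (simp add: divide_strict_left_mono)
    then show "{t (Suc n)<..b} \<le> {t n<..b}" using arc_length_less_imp by fastforce
  qed
  moreover have "(\<lambda>n. emeasure \<nu> {t n<..b}) \<longlonglongrightarrow> 0"
  proof -
    have "(\<lambda>n. ennreal (?L / real (Suc n))) \<longlonglongrightarrow> ennreal 0"
      using tendsto_mult_right_zero[OF LIMSEQ_inverse_real_of_nat, of ?L]
      by (intro tendsto_ennrealI) (simp add: field_simps)
    then show ?thesis by (simp add: \<nu>)
  qed
  ultimately have "(\<lambda>n. emeasure (gradient_measure \<rho>) {t n<..b}) \<longlonglongrightarrow> 0"
    by (intro gradient_measure_tendsto_0[OF \<rho> fin]) auto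
  from order_tendstoD(2)[OF this \<epsilon>] obtain n where n: "emeasure (gradient_measure \<rho>) {t n<..b} < \<epsilon>"
    by (auto simp: eventually_sequentially)
  have "\<exists>s\<in>{t n<..b}. P s"
    using t(1)[of n] L by (intro AE_length_measure_ex[OF AE]) (auto simp: \<nu> ennreal_eq_0_iff not_le divide_pos_pos)
  then obtain s where s: "s \<in> {t n<..b}" "P s" by blast
  have "curve_integral \<rho> (s, b, \<gamma>) = emeasure (gradient_measure \<rho>) {s<..b}"
    using s t(1)[of n] by (intro gradient_measure_Ioc[OF \<rho>, symmetric]) auto
  also have "\<dots> \<le> emeasure (gradient_measure \<rho>) {t n<..b}"
    using s by (intro emeasure_mono) auto
  also note n
  finally show ?thesis using s t(1)[of n] by (intro bexI[of _ s]) auto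
qed

text \<open>The length measure of \<open>w\<close> is dominated by both gradient measures, hence by the first where
  \<open>\<rho> \<le> \<sigma>\<close> and by the second elsewhere.\<close>

lemma dist_le_curve_integral_min:
  fixes w :: "real \<Rightarrow> 'b::metric_space"
  assumes \<rho>: "\<rho> \<in> borel_measurable borel" "curve_integral \<rho> (a, b, \<gamma>) < \<infinity>"
    and \<sigma>: "\<sigma> \<in> borel_measurable borel" "curve_integral \<sigma> (a, b, \<gamma>) < \<infinity>"
    and w\<rho>: "\<And>s t. a \<le> s \<Longrightarrow> s \<le> t \<Longrightarrow> t \<le> b \<Longrightarrow> ennreal (dist (w s) (w t)) \<le> curve_integral \<rho> (s, t, \<gamma>)"
    and w\<sigma>: "\<And>s t. a \<le> s \<Longrightarrow> s \<le> t \<Longrightarrow> t \<le> b \<Longrightarrow> ennreal (dist (w s) (w t)) \<le> curve_integral \<sigma> (s, t, \<gamma>)"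
  shows "ennreal (dist (w a) (w b)) \<le> curve_integral (\<lambda>x. min (\<rho> x) (\<sigma> x)) (a, b, \<gamma>)"
proof -
  \<comment> \<open>The inequalities on the pieces of a partition add up, because the gradient
    measure is additive over the adjacent half-open pieces.\<close>
  have length_le: "curve_length s t w \<le> emeasure (gradient_measure \<tau>) {s<..t}"
    if \<tau>: "\<tau> \<in> borel_measurable borel"
      and w: "\<And>s t. a \<le> s \<Longrightarrow> s \<le> t \<Longrightarrow> t \<le> b \<Longrightarrow> ennreal (dist (w s) (w t)) \<le> curve_integral \<tau> (s, t, \<gamma>)"
      and st: "a \<le> s" "t \<le> b" for \<tau> s t
  proof (rule curve_length_least)
    fix n and r :: "nat \<Rightarrow> real"
    assume r: "\<And>i. i \<le> n \<Longrightarrow> r i \<in> {s..t}" "\<And>i. i < n \<Longrightarrow> r i \<le> r (Suc i)"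
    have "(\<Sum>i<k. ennreal (dist (w (r i)) (w (r (Suc i))))) \<le> emeasure (gradient_measure \<tau>) {r 0<..r k} \<and> r 0 \<le> r k"
      if "k \<le> n" for k
      using that
    proof (induction k)
      case (Suc k)
      then have IH: "(\<Sum>i<k. ennreal (dist (w (r i)) (w (r (Suc i))))) \<le> emeasure (gradient_measure \<tau>) {r 0<..r k}"
        and o: "r 0 \<le> r k" "r k \<le> r (Suc k)" using r(2)[of k] by auto
      have "(\<Sum>i<Suc k. ennreal (dist (w (r i)) (w (r (Suc i))))) \<le>
          emeasure (gradient_measure \<tau>) {r 0<..r k} + curve_integral \<tau> (r k, r (Suc k), \<gamma>)"
        unfolding sum.lessThan_Suc using Suc.prems r(1)[of k] r(1)[of "Suc k"] st o
        by (intro add_mono IH w) auto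
      also have "curve_integral \<tau> (r k, r (Suc k), \<gamma>) = emeasure (gradient_measure \<tau>) {r k<..r (Suc k)}"
        using Suc.prems r(1)[of k] r(1)[of "Suc k"] st o by (intro gradient_measure_Ioc[OF \<tau>, symmetric]) auto
      also have "emeasure (gradient_measure \<tau>) {r 0<..r k} + \<dots> = emeasure (gradient_measure \<tau>) ({r 0<..r k} \<union> {r k<..r (Suc k)})"
        by (intro plus_emeasure) auto
      also have "{r 0<..r k} \<union> {r k<..r (Suc k)} = {r 0<..r (Suc k)}" using o by auto
      finally show ?case using o by simp
    qed simp
    from this[of n] have "(\<Sum>i<n. ennreal (dist (w (r i)) (w (r (Suc i))))) \<le> emeasure (gradient_measure \<tau>) {r 0<..r n}"
      by simp
    also have "\<dots> \<le> emeasure (gradient_measure \<tau>) {s<..t}"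
      using r(1)[of 0] r(1)[of n] by (intro emeasure_mono) auto
    finally show "(\<Sum>i<n. ennreal (dist (w (r i)) (w (r (Suc i))))) \<le> emeasure (gradient_measure \<tau>) {s<..t}" .
  qed
  interpret R: finite_borel_measure "gradient_measure \<rho>"
    using finite_gradient_measure[OF \<rho>] by (simp add: finite_borel_measure_def finite_borel_measure_axioms_def)
  have cdf: "isCont (cdf (gradient_measure \<rho>)) x" for x
    using gradient_measure_null[OF \<rho>(1), of "{x}"] by (simp add: R.isCont_cdf measure_def)
  \<comment> \<open>The gradient measure has no atoms, so its distribution function is continuous.
    It dominates the increments of \<open>w\<close>, which makes \<open>w\<close> continuous, as is
    needed before \<open>w\<close> can have a length measure of its own.\<close>
  have dist_cdf: "dist (w s) (w t) \<le> dist (cdf (gradient_measure \<rho>) s) (cdf (gradient_measure \<rho>) t)"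
    if "s \<in> {a..b}" "t \<in> {a..b}" for s t
  proof -
    have *: "dist (w s) (w t) \<le> dist (cdf (gradient_measure \<rho>) s) (cdf (gradient_measure \<rho>) t)"
      if "a \<le> s" "s < t" "t \<le> b" for s t
    proof -
      have "ennreal (dist (w s) (w t)) \<le> ennreal (measure (gradient_measure \<rho>) {s<..t})"
        using w\<rho>[of s t] gradient_measure_Ioc[OF \<rho>(1), of s t] that by (simp add: R.emeasure_eq_measure del: curve_integral.simps)
      then have "dist (w s) (w t) \<le> measure (gradient_measure \<rho>) {s<..t}" by simp
      also have "\<dots> = cdf (gradient_measure \<rho>) t - cdf (gradient_measure \<rho>) s"
        using that by (simp add: R.cdf_diff_eq)
      finally show ?thesis by (simp add: dist_real_def)
    qed
    consider "s < t" | "s = t" | "t < s" by linarith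
    then show ?thesis using *[of s t] *[of t s] that by cases (auto simp: dist_commute)
  qed
  have "continuous_on {a..b} w"
    unfolding continuous_on tendsto_dist_iff[of w]
  proof
    fix t assume t: "t \<in> {a..b}"
    have "((\<lambda>x. cdf (gradient_measure \<rho>) x) \<longlongrightarrow> cdf (gradient_measure \<rho>) t) (at t within {a..b})"
      using cdf[of t] unfolding isCont_def by (rule tendsto_within_subset) simp
    then have *: "((\<lambda>x. dist (cdf (gradient_measure \<rho>) x) (cdf (gradient_measure \<rho>) t)) \<longlongrightarrow> 0) (at t within {a..b})"
      by (simp add: tendsto_dist_iff[symmetric])
    show "((\<lambda>x. dist (w x) (w t)) \<longlongrightarrow> 0) (at t within {a..b})"
      by (rule tendsto_sandwich[OF _ _ tendsto_const *])
        (use t in \<open>auto simp: eventually_at_filter intro!: always_eventually dist_cdf\<close>)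
  qed
  moreover have "curve_length a b w < \<infinity>"
    by (rule order.strict_trans1[OF length_le[OF \<rho>(1) w\<rho>, of a b]]) (auto simp: less_top[symmetric])
  ultimately interpret w: rectifiable_curve a b w
    using a_le_b by (auto simp: rectifiable_curve_def)
  have le: "emeasure w.\<nu> B \<le> emeasure (gradient_measure \<tau>) B"
    if \<tau>: "\<tau> \<in> borel_measurable borel" "curve_integral \<tau> (a, b, \<gamma>) < \<infinity>"
      and w: "\<And>s t. a \<le> s \<Longrightarrow> s \<le> t \<Longrightarrow> t \<le> b \<Longrightarrow> ennreal (dist (w s) (w t)) \<le> curve_integral \<tau> (s, t, \<gamma>)"
      and B: "B \<in> sets borel" for \<tau> B
  proof (rule borel_measure_mono_Ioc[OF w.finite_length_measure _ finite_gradient_measure[OF \<tau>] _ _ B])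
    fix s t :: real assume "s \<le> t"
    have "emeasure w.\<nu> {s<..t} \<le> emeasure (gradient_measure \<tau>) {max a (min b s)<..max a (min b t)}"
      unfolding w.length_measure_Ioc_clamp[OF \<open>s \<le> t\<close>] using a_le_b by (intro length_le[OF \<tau>(1) w]) auto
    also have "\<dots> \<le> emeasure (gradient_measure \<tau>) {s<..t}" by (intro emeasure_mono) auto
    finally show "emeasure w.\<nu> {s<..t} \<le> emeasure (gradient_measure \<tau>) {s<..t}" .
  qed auto
  let ?f = "\<lambda>\<tau> x. \<tau> (\<gamma> x) * indicator {a<..b} x :: ennreal"
  note [measurable] = measurable_along_curve(2)[OF \<rho>(1), of a b, simplified]
    measurable_along_curve(2)[OF \<sigma>(1), of a b, simplified]
  define A where "A = {x. ?f \<rho> x \<le> ?f \<sigma> x} \<inter> {a<..b}"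
  define A' where "A' = {x. \<not> ?f \<rho> x \<le> ?f \<sigma> x} \<inter> {a<..b}"
  have A: "A \<in> sets borel" "A' \<in> sets borel" unfolding A_def A'_def by measurable
  have "ennreal (dist (w a) (w b)) \<le> curve_length a b w" using a_le_b by (rule dist_le_curve_length)
  also have "\<dots> = emeasure w.\<nu> {a<..b}" using a_le_b by (simp add: w.length_measure_Ioc)
  also have "{a<..b} = A \<union> A'" by (auto simp: A_def A'_def)
  also have "emeasure w.\<nu> (A \<union> A') = emeasure w.\<nu> A + emeasure w.\<nu> A'"
    using A by (intro plus_emeasure[symmetric]) (auto simp: A_def A'_def)
  also have "\<dots> \<le> emeasure (gradient_measure \<rho>) A + emeasure (gradient_measure \<sigma>) A'"
    by (intro add_mono le \<rho> \<sigma> w\<rho> w\<sigma> A)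
  also have "\<dots> = (\<integral>\<^sup>+x. ?f \<rho> x * indicator A x + ?f \<sigma> x * indicator A' x \<partial>\<nu>)"
    using A \<rho> \<sigma> by (subst nn_integral_add) (auto simp: emeasure_gradient_measure)
  also have "\<dots> = (\<integral>\<^sup>+x. min (\<rho> (\<gamma> x)) (\<sigma> (\<gamma> x)) * indicator {a<..b} x \<partial>\<nu>)"
    by (intro nn_integral_cong) (auto simp: A_def A'_def min_def split: split_indicator)
  also have "\<dots> = curve_integral (\<lambda>x. min (\<rho> x) (\<sigma> x)) (a, b, \<gamma>)"
    using \<rho> \<sigma> by (intro curve_integral_eq[symmetric]) auto
  finally show ?thesis .
qed

end

section \<open>Weak upper gradients\<close>

context newton_sobolev
begin

abbreviation "wug u \<rho> \<equiv> weak_upper_gradient \<mu> p u \<rho>"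
abbreviation "LWG u \<equiv> Lp_weak_upper_gradients \<mu> p u"

lemma LWG_iff: "\<rho> \<in> LWG u \<longleftrightarrow> \<rho> \<in> Lp_borel \<mu> p \<and> wug u \<rho>"
  by (simp add: Lp_weak_upper_gradients_def)

lemma wug_measurable: "wug u \<rho> \<Longrightarrow> \<rho> \<in> borel_measurable borel"
  by (simp add: weak_upper_gradient_def)

text \<open>The null set where the inequality fails has zero length along almost every curve.
  Changing a gradient on a null set is therefore harmless.\<close>

lemma ae_curve_integral_mono:
  assumes "\<rho> \<in> borel_measurable borel" "\<sigma> \<in> borel_measurable borel" "AE x in M. \<rho> x \<le> \<sigma> x"
  shows "ae_curve (\<lambda>c. curve_integral \<rho> c \<le> curve_integral \<sigma> c)"
proof (rule ae_curve_mono[OF ae_curve_null[OF assms(3)]])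
  fix c :: "'a curve"
  assume c: "c \<in> curves"
    "case c of (a, b, \<gamma>) \<Rightarrow> AE t in length_measure a b \<gamma>. t \<in> {a<..b} \<longrightarrow> \<rho> (\<gamma> t) \<le> \<sigma> (\<gamma> t)"
  obtain a b \<gamma> where c_eq: "c = (a, b, \<gamma>)" by (cases c)
  show "curve_integral \<rho> c \<le> curve_integral \<sigma> c"
  proof (cases "curve_length a b \<gamma> < \<infinity>")
    case True
    then interpret rectifiable_curve a b \<gamma>
      using c by (auto simp: c_eq curves_def rectifiable_curve_def)
    show ?thesis
      unfolding c_eq curve_integral_eq[OF assms(1)] curve_integral_eq[OF assms(2)]
      using c(2) unfolding c_eq prod.case
      by (intro nn_integral_mono_AE) (auto split: split_indicator elim!: eventually_mono)
  qed (simp add: c_eq)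
qed

lemma wug_AE_mono:
  assumes "wug u \<rho>" "\<sigma> \<in> borel_measurable borel" "AE x in M. \<rho> x \<le> \<sigma> x"
  shows "wug u \<sigma>"
proof -
  have "ae_curve (\<lambda>(a, b, \<gamma>). ennreal (norm (u (\<gamma> a) - u (\<gamma> b))) \<le> curve_integral \<rho> (a, b, \<gamma>))"
    using assms(1) by (simp add: weak_upper_gradient_iff)
  from ae_curve_conj[OF this ae_curve_integral_mono[OF wug_measurable[OF assms(1)] assms(2,3)]]
  show ?thesis unfolding weak_upper_gradient_iff
    by (intro conjI assms(2), elim ae_curve_mono) (auto simp del: curve_integral.simps intro: order_trans)
qed

text \<open>Formulated through an inequality between increments, so that both sums and differences
  are instances.\<close>

lemma wug_add_gen:
  assumes "wug u \<rho>" "wug v \<sigma>"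
    and le: "\<And>x y. norm (w x - w y) \<le> norm (u x - u y) + norm (v x - v y)"
  shows "wug w (\<lambda>x. \<rho> x + \<sigma> x)"
proof -
  note m [measurable] = wug_measurable[OF assms(1)] wug_measurable[OF assms(2)]
  have "ae_curve (\<lambda>(a, b, \<gamma>). ennreal (norm (u (\<gamma> a) - u (\<gamma> b))) \<le> curve_integral \<rho> (a, b, \<gamma>))"
   "ae_curve (\<lambda>(a, b, \<gamma>). ennreal (norm (v (\<gamma> a) - v (\<gamma> b))) \<le> curve_integral \<sigma> (a, b, \<gamma>))"
    using assms(1,2) by (simp_all add: weak_upper_gradient_iff)
  from ae_curve_conj[OF this]
  have "ae_curve (\<lambda>(a, b, \<gamma>). ennreal (norm (w (\<gamma> a) - w (\<gamma> b))) \<le> curve_integral (\<lambda>x. \<rho> x + \<sigma> x) (a, b, \<gamma>))"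
  proof (rule ae_curve_mono, clarify)
    fix a b and \<gamma> :: "real \<Rightarrow> 'a"
    assume c: "(a, b, \<gamma>) \<in> curves" "ennreal (norm (u (\<gamma> a) - u (\<gamma> b))) \<le> curve_integral \<rho> (a, b, \<gamma>)"
      "ennreal (norm (v (\<gamma> a) - v (\<gamma> b))) \<le> curve_integral \<sigma> (a, b, \<gamma>)"
    have "ennreal (norm (w (\<gamma> a) - w (\<gamma> b))) \<le> ennreal (norm (u (\<gamma> a) - u (\<gamma> b))) + ennreal (norm (v (\<gamma> a) - v (\<gamma> b)))"
      using le[of "\<gamma> a" "\<gamma> b"] by (simp add: ennreal_plus[symmetric] ennreal_leI del: ennreal_plus)
    also have "\<dots> \<le> curve_integral \<rho> (a, b, \<gamma>) + curve_integral \<sigma> (a, b, \<gamma>)" by (intro add_mono c)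
    also have "\<dots> = curve_integral (\<lambda>x. \<rho> x + \<sigma> x) (a, b, \<gamma>)"
      using c(1) m by (simp only: curve_integral_add)
    finally show "ennreal (norm (w (\<gamma> a) - w (\<gamma> b))) \<le> curve_integral (\<lambda>x. \<rho> x + \<sigma> x) (a, b, \<gamma>)" .
  qed
  then show ?thesis unfolding weak_upper_gradient_iff by simp
qed

lemma wug_add: "wug u \<rho> \<Longrightarrow> wug v \<sigma> \<Longrightarrow> wug (\<lambda>x. u x + v x) (\<lambda>x. \<rho> x + \<sigma> x)"
  by (erule (1) wug_add_gen) (metis add_diff_add norm_triangle_ineq)

lemma wug_diff: "wug u \<rho> \<Longrightarrow> wug v \<sigma> \<Longrightarrow> wug (\<lambda>x. u x - v x) (\<lambda>x. \<rho> x + \<sigma> x)"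
proof (erule (1) wug_add_gen)
  fix x y
  have "norm (u x - v x - (u y - v y)) = norm ((u x - u y) - (v x - v y))" by (simp add: algebra_simps)
  also have "\<dots> \<le> norm (u x - u y) + norm (v x - v y)" by (rule norm_triangle_ineq4)
  finally show "norm (u x - v x - (u y - v y)) \<le> norm (u x - u y) + norm (v x - v y)" .
qed

lemma wug_compose:
  assumes "wug u \<rho>" "0 < C" "\<And>x y. norm (T x - T y) \<le> C * norm (x - y)"
  shows "wug (\<lambda>x. T (u x)) (\<lambda>x. ennreal C * \<rho> x)"
proof -
  note m [measurable] = wug_measurable[OF assms(1)]
  have "ae_curve (\<lambda>(a, b, \<gamma>). ennreal (norm (u (\<gamma> a) - u (\<gamma> b))) \<le> curve_integral \<rho> (a, b, \<gamma>))"
    using assms(1) by (simp_all add: weak_upper_gradient_iff)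
  then have "ae_curve (\<lambda>(a, b, \<gamma>). ennreal (norm (T (u (\<gamma> a)) - T (u (\<gamma> b)))) \<le> curve_integral (\<lambda>x. ennreal C * \<rho> x) (a, b, \<gamma>))"
  proof (rule ae_curve_mono, clarify)
    fix a b and \<gamma> :: "real \<Rightarrow> 'a"
    assume c: "(a, b, \<gamma>) \<in> curves" "ennreal (norm (u (\<gamma> a) - u (\<gamma> b))) \<le> curve_integral \<rho> (a, b, \<gamma>)"
    have "ennreal (norm (T (u (\<gamma> a)) - T (u (\<gamma> b)))) \<le> ennreal C * ennreal (norm (u (\<gamma> a) - u (\<gamma> b)))"
      using assms(3)[of "u (\<gamma> a)" "u (\<gamma> b)"] assms(2) by (simp add: ennreal_mult[symmetric] ennreal_leI)
    also have "\<dots> \<le> ennreal C * curve_integral \<rho> (a, b, \<gamma>)" by (intro mult_left_mono c) simp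
    also have "\<dots> = curve_integral (\<lambda>x. ennreal C * \<rho> x) (a, b, \<gamma>)"
      using c(1) m assms(2) by (intro curve_integral_cmult[symmetric]) auto
    finally show "ennreal (norm (T (u (\<gamma> a)) - T (u (\<gamma> b)))) \<le> curve_integral (\<lambda>x. ennreal C * \<rho> x) (a, b, \<gamma>)" .
  qed
  then show ?thesis unfolding weak_upper_gradient_iff by simp
qed

text \<open>The factor \<open>norm (v i) + 1\<close> stays positive when \<open>v i\<close> is 0.
  Vanishing factors do not pass through path integrals: on a nonrectifiable curve the integral of 0
  is infinite, while 0 times infinity is 0.\<close>

lemma wug_sum_scaleR:
  assumes "finite I" "\<And>i. i \<in> I \<Longrightarrow> wug (e i :: 'a \<Rightarrow> real) (\<rho> i)"
  shows "wug (\<lambda>x. \<Sum>i\<in>I. e i x *\<^sub>R v i) (\<lambda>x. \<Sum>i\<in>I. ennreal (norm (v i) + 1) * \<rho> i x)"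
  using assms
proof (induction I rule: finite_induct)
  case empty
  have "(\<lambda>_. 0) \<in> Lp_borel \<mu> p" by (simp add: Lp_borel_iff energy_def)
  then show ?case by (auto simp: weak_upper_gradient_iff ae_curve_def)
next
  case (insert i I)
  have "wug (\<lambda>x. e i x *\<^sub>R v i) (\<lambda>x. ennreal (norm (v i) + 1) * \<rho> i x)"
  proof (rule wug_compose[where T = "\<lambda>r. r *\<^sub>R v i"])
    show "norm (x *\<^sub>R v i - y *\<^sub>R v i) \<le> (norm (v i) + 1) * norm (x - y)" for x y
    proof -
      have "norm (x *\<^sub>R v i - y *\<^sub>R v i) = norm (x - y) * norm (v i)"
        by (simp flip: scaleR_diff_left)
      then show ?thesis by (simp add: ring_distribs mult.commute)
    qed
  qed (use insert in \<open>auto intro: add_nonneg_pos\<close>)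
  from wug_add[OF this insert.IH] insert show ?case by simp
qed

lemma ae_curve_subcurves_wug:
  assumes "wug u \<rho>"
  shows "ae_curve (\<lambda>(a, b, \<gamma>). rectifiable_curve a b \<gamma> \<and> (\<forall>s t. a \<le> s \<longrightarrow> s \<le> t \<longrightarrow> t \<le> b \<longrightarrow>
    ennreal (norm (u (\<gamma> s) - u (\<gamma> t))) \<le> curve_integral \<rho> (s, t, \<gamma>)))"
  using ae_curve_subcurves[of "\<lambda>(a, b, \<gamma>). ennreal (norm (u (\<gamma> a) - u (\<gamma> b))) \<le> curve_integral \<rho> (a, b, \<gamma>)"] assms
  by (simp add: weak_upper_gradient_iff del: curve_integral.simps)

text \<open>Along almost every curve, \<open>u\<close> lies in \<open>Q\<close> at length-almost
  every parameter. Parameters of this kind exist with arbitrarily small integral of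
  \<open>\<rho>\<close> between them and an endpoint, so the values there approach the value at the
  endpoint, and \<open>Q\<close> is closed. A constant curve has no length and escapes the argument;
  the alternative \<open>\<gamma> a = \<gamma> b\<close> is harmless because the increment is then
  zero.\<close>

lemma ae_curve_endpoints_in_closed:
  assumes \<rho>: "\<rho> \<in> LWG u" and Q: "closed Q" and AE: "AE x in M. u x \<in> Q"
  shows "ae_curve (\<lambda>(a, b, \<gamma>). \<gamma> a = \<gamma> b \<or> u (\<gamma> a) \<in> Q \<and> u (\<gamma> b) \<in> Q)"
proof -
  have \<rho>': "\<rho> \<in> Lp_borel \<mu> p" "wug u \<rho>" "\<rho> \<in> borel_measurable borel"
    using \<rho> by (auto simp: LWG_iff Lp_borel_iff)
  from ae_curve_conj[OF ae_curve_subcurves_wug[OF \<rho>'(2)]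
      ae_curve_conj[OF ae_curve_finite[OF \<rho>'(1)] ae_curve_null[OF AE]]]
  show ?thesis
  proof (rule ae_curve_mono, clarify)
    fix a b and \<gamma> :: "real \<Rightarrow> 'a"
    assume "rectifiable_curve a b \<gamma>"
    then interpret rectifiable_curve a b \<gamma> .
    assume ineq: "\<forall>s t. a \<le> s \<longrightarrow> s \<le> t \<longrightarrow> t \<le> b \<longrightarrow>
        ennreal (norm (u (\<gamma> s) - u (\<gamma> t))) \<le> curve_integral \<rho> (s, t, \<gamma>)"
      and fin: "curve_integral \<rho> (a, b, \<gamma>) < \<infinity>"
      and AE': "AE t in \<nu>. t \<in> {a<..b} \<longrightarrow> u (\<gamma> t) \<in> Q"
      and neg: "\<not> (u (\<gamma> a) \<in> Q \<and> u (\<gamma> b) \<in> Q)"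
    show "\<gamma> a = \<gamma> b"
    proof (rule ccontr)
      assume ne: "\<gamma> a \<noteq> \<gamma> b"
      have "u (\<gamma> a) \<in> closure Q"
        unfolding closure_approachable
      proof (intro allI impI)
        fix \<epsilon> :: real assume "0 < \<epsilon>"
        then obtain s where s: "s \<in> {a<..b}" "u (\<gamma> s) \<in> Q" "curve_integral \<rho> (a, s, \<gamma>) < ennreal \<epsilon>"
          using ex_near_start[OF \<rho>'(3) fin AE' ne, of "ennreal \<epsilon>"] by auto
        have "ennreal (norm (u (\<gamma> a) - u (\<gamma> s))) < ennreal \<epsilon>"
          using ineq[rule_format, of a s] s by (auto simp del: curve_integral.simps intro: order.strict_trans1)
        then show "\<exists>y\<in>Q. dist y (u (\<gamma> a)) < \<epsilon>"
          using s by (intro bexI[of _ "u (\<gamma> s)"]) (auto simp: dist_norm norm_minus_commute ennreal_less_iff)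
      qed
      moreover have "u (\<gamma> b) \<in> closure Q"
        unfolding closure_approachable
      proof (intro allI impI)
        fix \<epsilon> :: real assume "0 < \<epsilon>"
        then obtain s where s: "s \<in> {a<..b}" "u (\<gamma> s) \<in> Q" "curve_integral \<rho> (s, b, \<gamma>) < ennreal \<epsilon>"
          using ex_near_end[OF \<rho>'(3) fin AE' ne, of "ennreal \<epsilon>"] by auto
        have "ennreal (norm (u (\<gamma> s) - u (\<gamma> b))) < ennreal \<epsilon>"
          using ineq[rule_format, of s b] s by (auto simp del: curve_integral.simps intro: order.strict_trans1)
        then show "\<exists>y\<in>Q. dist y (u (\<gamma> b)) < \<epsilon>"
          using s by (intro bexI[of _ "u (\<gamma> s)"]) (auto simp: dist_norm ennreal_less_iff)
      qed
      ultimately show False using neg Q by (simp add: closure_closed)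
    qed
  qed
qed

text \<open>The difference \<open>u - v\<close> has an integrable weak upper gradient and lies in
  the closed set {0} almost everywhere. Hence it vanishes at the endpoints of almost every curve
  with distinct endpoints, where \<open>u\<close> and \<open>v\<close> then have the same increment.
  This makes minimal gradients independent of the representative.\<close>

lemma LWG_cong_AE:
  assumes eq: "AE x in M. u x = v x" and \<rho>: "\<rho> \<in> LWG u" and ne: "LWG v \<noteq> {}"
  shows "\<rho> \<in> LWG v"
proof -
  obtain \<sigma> where \<sigma>: "\<sigma> \<in> LWG v" using ne by blast
  have "(\<lambda>x. \<rho> x + \<sigma> x) \<in> LWG (\<lambda>x. u x - v x)"
    using \<rho> \<sigma> by (auto simp: LWG_iff intro: wug_diff Lp_borel_add)
  moreover have "AE x in M. u x - v x \<in> {0}" using eq by eventually_elim simp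
  ultimately have "ae_curve (\<lambda>(a, b, \<gamma>). \<gamma> a = \<gamma> b \<or> u (\<gamma> a) - v (\<gamma> a) \<in> {0} \<and> u (\<gamma> b) - v (\<gamma> b) \<in> {0})"
    using ae_curve_endpoints_in_closed[of _ "\<lambda>x. u x - v x" "{0}"] by simp
  moreover have "ae_curve (\<lambda>(a, b, \<gamma>). ennreal (norm (u (\<gamma> a) - u (\<gamma> b))) \<le> curve_integral \<rho> (a, b, \<gamma>))"
    using \<rho> by (simp add: LWG_iff weak_upper_gradient_iff)
  ultimately have "ae_curve (\<lambda>(a, b, \<gamma>). ennreal (norm (v (\<gamma> a) - v (\<gamma> b))) \<le> curve_integral \<rho> (a, b, \<gamma>))"
    by (rule ae_curve_mono[OF ae_curve_conj]) (auto simp del: curve_integral.simps)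
  then show ?thesis using \<rho> by (simp add: LWG_iff weak_upper_gradient_iff)
qed

text \<open>Neither gradient is smaller along a whole curve, so the two inequalities are needed on
  all subcurves at once; almost every curve provides them.\<close>

lemma LWG_min:
  assumes \<rho>: "\<rho> \<in> LWG u" and \<sigma>: "\<sigma> \<in> LWG u"
  shows "(\<lambda>x. min (\<rho> x) (\<sigma> x)) \<in> LWG u"
proof -
  have L: "\<rho> \<in> Lp_borel \<mu> p" "\<sigma> \<in> Lp_borel \<mu> p" "wug u \<rho>" "wug u \<sigma>"
    and m [measurable]: "\<rho> \<in> borel_measurable borel" "\<sigma> \<in> borel_measurable borel"
    using \<rho> \<sigma> by (auto simp: LWG_iff Lp_borel_iff)
  have "ae_curve (\<lambda>(a, b, \<gamma>). ennreal (norm (u (\<gamma> a) - u (\<gamma> b))) \<le> curve_integral (\<lambda>x. min (\<rho> x) (\<sigma> x)) (a, b, \<gamma>))"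
    using ae_curve_conj[OF ae_curve_conj[OF ae_curve_subcurves_wug[OF L(3)] ae_curve_finite[OF L(1)]]
          ae_curve_conj[OF ae_curve_subcurves_wug[OF L(4)] ae_curve_finite[OF L(2)]]]
  proof (rule ae_curve_mono, clarify)
    fix a b and \<gamma> :: "real \<Rightarrow> 'a"
    assume "rectifiable_curve a b \<gamma>"
    then interpret rectifiable_curve a b \<gamma> .
    assume *: "\<forall>s t. a \<le> s \<longrightarrow> s \<le> t \<longrightarrow> t \<le> b \<longrightarrow>
        ennreal (norm (u (\<gamma> s) - u (\<gamma> t))) \<le> curve_integral \<rho> (s, t, \<gamma>)"
      "curve_integral \<rho> (a, b, \<gamma>) < \<infinity>"
      "\<forall>s t. a \<le> s \<longrightarrow> s \<le> t \<longrightarrow> t \<le> b \<longrightarrow>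
        ennreal (norm (u (\<gamma> s) - u (\<gamma> t))) \<le> curve_integral \<sigma> (s, t, \<gamma>)"
      "curve_integral \<sigma> (a, b, \<gamma>) < \<infinity>"
    show "ennreal (norm (u (\<gamma> a) - u (\<gamma> b))) \<le> curve_integral (\<lambda>x. min (\<rho> x) (\<sigma> x)) (a, b, \<gamma>)"
      using dist_le_curve_integral_min[of \<rho> \<sigma> "\<lambda>t. u (\<gamma> t)", OF m(1) *(2) m(2) *(4)] *(1,3)
      unfolding dist_norm by blast
  qed
  then have "wug u (\<lambda>x. min (\<rho> x) (\<sigma> x))" unfolding weak_upper_gradient_iff by simp
  then show ?thesis
    unfolding LWG_iff using Lp_borel_mono[OF L(1), of "\<lambda>x. min (\<rho> x) (\<sigma> x)"] by simp
qed

text \<open>Monotone convergence along each curve on which \<open>\<rho> 0\<close> has finite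
  integral; almost every curve is of this kind and satisfies all the countably many
  inequalities.\<close>

lemma LWG_INF_decseq:
  assumes \<rho>: "\<And>n::nat. \<rho> n \<in> LWG u" and dec: "\<And>n x. \<rho> (Suc n) x \<le> \<rho> n x"
  shows "(\<lambda>x. INF n. \<rho> n x) \<in> LWG u"
proof -
  have L: "\<rho> n \<in> Lp_borel \<mu> p" "wug u (\<rho> n)" and m [measurable]: "\<rho> n \<in> borel_measurable borel" for n
    using \<rho>[of n] by (auto simp: LWG_iff Lp_borel_iff)
  have "ae_curve (\<lambda>(a, b, \<gamma>). ennreal (norm (u (\<gamma> a) - u (\<gamma> b))) \<le> curve_integral (\<rho> n) (a, b, \<gamma>))" for n
    using L(2)[of n] by (simp add: weak_upper_gradient_iff)
  then have "ae_curve (\<lambda>c. \<forall>n. (\<lambda>(a, b, \<gamma>). ennreal (norm (u (\<gamma> a) - u (\<gamma> b))) \<le> curve_integral (\<rho> n) (a, b, \<gamma>)) c)"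
    by (rule ae_curve_all)
  from ae_curve_conj[OF this ae_curve_finite[OF L(1)[of 0]]]
  have "ae_curve (\<lambda>(a, b, \<gamma>). ennreal (norm (u (\<gamma> a) - u (\<gamma> b))) \<le> curve_integral (\<lambda>x. INF n. \<rho> n x) (a, b, \<gamma>))"
  proof (rule ae_curve_mono, clarify)
    fix a b and \<gamma> :: "real \<Rightarrow> 'a"
    assume c: "(a, b, \<gamma>) \<in> curves" and fin: "curve_integral (\<rho> 0) (a, b, \<gamma>) < \<infinity>"
      and "\<forall>n. ennreal (norm (u (\<gamma> a) - u (\<gamma> b))) \<le> curve_integral (\<rho> n) (a, b, \<gamma>)"
    then have le: "ennreal (norm (u (\<gamma> a) - u (\<gamma> b))) \<le> curve_integral (\<rho> n) (a, b, \<gamma>)" for n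
      by (auto simp del: curve_integral.simps)
    interpret rectifiable_curve a b \<gamma> by (rule curve_integral_finite_rectifiable[OF c fin])
    have "curve_integral (\<lambda>x. INF n. \<rho> n x) (a, b, \<gamma>) = (\<integral>\<^sup>+x. (INF n. \<rho> n (\<gamma> x) * indicator {a<..b} x) \<partial>\<nu>)"
      by (subst curve_integral_eq) (auto intro!: nn_integral_cong split: split_indicator)
    also have "\<dots> = (INF n. \<integral>\<^sup>+x. \<rho> n (\<gamma> x) * indicator {a<..b} x \<partial>\<nu>)"
    proof (rule nn_integral_monotone_convergence_INF_decseq[where i = 0])
      show "decseq (\<lambda>i x. \<rho> i (\<gamma> x) * indicator {a<..b} x)"
        using dec by (intro decseq_SucI) (auto simp: le_fun_def intro!: mult_right_mono)
      show "(\<lambda>x. \<rho> i (\<gamma> x) * indicator {a<..b} x) \<in> borel_measurable \<nu>" for i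
        using measurable_along_curve(2)[OF m, of a b i] by simp
      show "(\<integral>\<^sup>+x. \<rho> 0 (\<gamma> x) * indicator {a<..b} x \<partial>\<nu>) < \<infinity>"
        using fin unfolding curve_integral_eq[OF m] .
    qed
    finally have eq: "curve_integral (\<lambda>x. INF n. \<rho> n x) (a, b, \<gamma>) =
        (INF n. \<integral>\<^sup>+x. \<rho> n (\<gamma> x) * indicator {a<..b} x \<partial>\<nu>)" .
    show "ennreal (norm (u (\<gamma> a) - u (\<gamma> b))) \<le> curve_integral (\<lambda>x. INF n. \<rho> n x) (a, b, \<gamma>)"
      using le unfolding eq curve_integral_eq[OF m] by (intro INF_greatest)
  qed
  then have "wug u (\<lambda>x. INF n. \<rho> n x)" unfolding weak_upper_gradient_iff by simp
  then show ?thesis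
    unfolding LWG_iff using Lp_borel_mono[OF L(1)[of 0], of "\<lambda>x. INF n. \<rho> n x"] by (auto intro: INF_lower)
qed

text \<open>The energy attains its minimum without any weak compactness, which would fail for
  exponent 1: running minima turn a minimizing sequence into a decreasing one, and its infimum is
  again a gradient. A minimizer lies below every other gradient \<open>\<sigma>\<close>, since
  otherwise its minimum with \<open>\<sigma>\<close> would have less energy.\<close>

lemma ex_minimal_LWG:
  assumes "LWG u \<noteq> {}"
  shows "\<exists>\<rho>\<in>LWG u. \<forall>\<sigma>\<in>LWG u. AE x in M. \<rho> x \<le> \<sigma> x"
proof -
  define I where "I = (INF \<rho>\<in>LWG u. energy \<rho>)"
  obtain f where f: "range f \<subseteq> energy ` LWG u" "I = (INF n::nat. f n)"
    using ennreal_Inf_countable_INF[of "energy ` LWG u"] assms unfolding I_def by auto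
  have "\<forall>n. \<exists>\<rho>. \<rho> \<in> LWG u \<and> energy \<rho> = f n" using f(1) by (auto simp: image_subset_iff image_iff) metis
  then obtain r where r: "\<And>n. r n \<in> LWG u" "\<And>n. energy (r n) = f n" by metis
  define g where "g = rec_nat (r 0) (\<lambda>n h x. min (h x) (r (Suc n) x))"
  have g: "g n \<in> LWG u" "g n x \<le> r n x" "g (Suc n) x \<le> g n x" for n x
  proof -
    show "g n \<in> LWG u" by (induction n) (auto simp: g_def r intro: LWG_min)
    show "g n x \<le> r n x" by (cases n) (auto simp: g_def)
    show "g (Suc n) x \<le> g n x" by (simp add: g_def)
  qed
  define \<rho> where "\<rho> = (\<lambda>x. INF n. g n x)"
  have \<rho>: "\<rho> \<in> LWG u" unfolding \<rho>_def by (rule LWG_INF_decseq) (rule g)+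
  have "energy \<rho> \<le> f n" for n
  proof -
    have "energy \<rho> \<le> energy (r n)"
      by (rule energy_mono_AE) (auto simp: \<rho>_def intro!: AE_I2 INF_lower2[of n] g)
    then show ?thesis by (simp add: r)
  qed
  then have "energy \<rho> \<le> I" unfolding f(2) by (rule INF_greatest)
  have "AE x in M. \<rho> x \<le> \<sigma> x" if \<sigma>: "\<sigma> \<in> LWG u" for \<sigma>
  proof -
    let ?m = "\<lambda>x. min (\<rho> x) (\<sigma> x)"
    have m: "?m \<in> LWG u" by (rule LWG_min[OF \<rho> \<sigma>])
    have [measurable]: "\<rho> \<in> borel_measurable borel" "\<sigma> \<in> borel_measurable borel"
      using \<rho> \<sigma> by (auto simp: LWG_iff Lp_borel_iff)
    have "energy \<rho> \<le> energy ?m" using \<open>energy \<rho> \<le> I\<close> m unfolding I_def by (meson INF_lower order_trans)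
    moreover have "energy ?m \<le> energy \<rho>" by (intro energy_mono_AE) auto
    ultimately have eq: "energy \<rho> = energy ?m" by simp
    have fin: "energy \<rho> < \<infinity>" using \<rho> by (auto simp: LWG_iff Lp_borel_iff)
    have "(\<integral>\<^sup>+x. ennreal_powr (\<rho> x) p - ennreal_powr (?m x) p \<partial>M) = energy \<rho> - energy ?m"
      unfolding energy_def using fin p_pos eq
      by (intro nn_integral_diff) (auto simp: energy_def intro!: ennreal_powr_mono)
    then have "(\<integral>\<^sup>+x. ennreal_powr (\<rho> x) p - ennreal_powr (?m x) p \<partial>M) = 0"
      using fin eq by simp
    then have "AE x in M. ennreal_powr (\<rho> x) p - ennreal_powr (?m x) p = 0"
      by (subst (asm) nn_integral_0_iff_AE) auto
    then show ?thesis
    proof eventually_elim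
      case (elim x)
      then have "ennreal_powr (\<rho> x) p \<le> ennreal_powr (?m x) p"
        by (rule ennreal_minus_eq_0)
      then have "ennreal_powr (ennreal_powr (\<rho> x) p) (1 / p) \<le> ennreal_powr (ennreal_powr (?m x) p) (1 / p)"
        by (rule ennreal_powr_mono) (use p_pos in simp)
      then have "\<rho> x \<le> ?m x" using p_pos by (simp add: ennreal_powr_powr)
      then show ?case by simp
    qed
  qed
  then show ?thesis using \<rho> by blast
qed

section \<open>Minimal gradients of classes of functions\<close>

lemma is_minimal_gradientD:
  assumes "is_minimal_gradient \<mu> p u \<rho>"
  obtains u' where "AE x in M. u' x = u x" "\<rho> \<in> LWG u'" "\<And>\<sigma>. \<sigma> \<in> LWG u' \<Longrightarrow> AE x in M. \<rho> x \<le> \<sigma> x"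
  using assms unfolding is_minimal_gradient_def by blast

text \<open>Minimality is defined for one hidden representative; integrable gradients of any other
  representative transfer to it.\<close>

lemma is_minimal_gradient_least:
  assumes "is_minimal_gradient \<mu> p u \<rho>" "AE x in M. v x = u x" "\<sigma> \<in> LWG v"
  shows "AE x in M. \<rho> x \<le> \<sigma> x"
proof -
  obtain u' where u': "AE x in M. u' x = u x" "\<rho> \<in> LWG u'" "\<And>\<sigma>. \<sigma> \<in> LWG u' \<Longrightarrow> AE x in M. \<rho> x \<le> \<sigma> x"
    using assms(1) by (rule is_minimal_gradientD) (rule that)
  have "AE x in M. v x = u' x" using assms(2) u'(1) by eventually_elim simp
  then have "\<sigma> \<in> LWG u'" using assms(3) u'(2) by (intro LWG_cong_AE[of v u']) auto
  then show ?thesis by (rule u'(3))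
qed

lemma is_minimal_gradient_SOME:
  assumes "AE x in M. v x = u x" "LWG v \<noteq> {}"
  shows "is_minimal_gradient \<mu> p u (SOME \<rho>. is_minimal_gradient \<mu> p u \<rho>)"
  using ex_minimal_LWG[OF assms(2)] assms(1)
  by (intro someI_ex[of "is_minimal_gradient \<mu> p u"]) (auto simp: is_minimal_gradient_def)

end

section \<open>Lipschitz functions and Fuglede limits\<close>

text \<open>For an integrable gradient only the length inside the support of \<open>f\<close> may be
  charged. If the curve meets the zero set, \<open>f (\<gamma> a)\<close> is bounded by the length
  up to the first zero and \<open>f (\<gamma> b)\<close> by the length after the last one. Both are
  estimated by the length of the whole set, whence the factor 2.\<close>

lemma (in rectifiable_curve) lipschitz_along_curve:
  fixes f :: "'a \<Rightarrow> 'v::real_normed_vector"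
  assumes lip: "L-lipschitz_on UNIV f"
  shows "ennreal (norm (f (\<gamma> a) - f (\<gamma> b))) \<le>
    ennreal (2 * L) * emeasure \<nu> {t \<in> {a<..b}. f (\<gamma> t) \<noteq> 0}"
proof -
  let ?A = "{t \<in> {a<..b}. f (\<gamma> t) \<noteq> 0}"
  define S where "S = {a..b} \<inter> (\<lambda>t. f (\<gamma> t)) -` {0}"
  have L: "0 \<le> L" using lip by (rule lipschitz_on_nonneg)
  have f: "continuous_on UNIV f" using lip by (rule lipschitz_on_continuous_on)
  have "continuous_on {a..b} (\<lambda>t. f (\<gamma> t))"
    by (rule continuous_on_compose2[OF f cont]) simp
  then have S: "closed S" unfolding S_def by (intro continuous_closed_preimage) auto
  have A_eq: "?A = {a<..b} - S" by (auto simp: S_def)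
  then have A: "?A \<in> sets borel" using S by simp
  have len: "ennreal (norm (f (\<gamma> s) - f (\<gamma> t))) \<le> ennreal L * emeasure \<nu> {s<..t}"
    if "a \<le> s" "s \<le> t" "t \<le> b" for s t
  proof -
    have "ennreal (norm (f (\<gamma> s) - f (\<gamma> t))) \<le> ennreal (L * dist (\<gamma> s) (\<gamma> t))"
      using lipschitz_onD[OF lip, of "\<gamma> s" "\<gamma> t"] by (intro ennreal_leI) (simp add: dist_norm)
    also have "\<dots> = ennreal L * ennreal (dist (\<gamma> s) (\<gamma> t))" using L by (simp add: ennreal_mult)
    also have "\<dots> \<le> ennreal L * emeasure \<nu> {s<..t}"
      using that by (intro mult_left_mono) (auto simp: length_measure_Ioc dist_le_curve_length)
    finally show ?thesis .
  qed
  have two: "ennreal L * x + ennreal L * x = ennreal (2 * L) * x" for x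
    using L by (simp add: ennreal_mult mult_2[symmetric] mult.assoc)
  show ?thesis
  proof (cases "S = {}")
    case True
    then have "?A = {a<..b}" using A_eq by simp
    then have "ennreal (norm (f (\<gamma> a) - f (\<gamma> b))) \<le> ennreal L * emeasure \<nu> ?A"
      using len[of a b] a_le_b by simp
    also have "\<dots> \<le> ennreal L * emeasure \<nu> ?A + ennreal L * emeasure \<nu> ?A" by simp
    finally show ?thesis unfolding two .
  next
    case False
    have bdd: "bdd_below S" "bdd_above S" by (auto simp: S_def)
    have i: "Inf S \<in> S" and s: "Sup S \<in> S"
      using closed_contains_Inf[OF False bdd(1) S] closed_contains_Sup[OF False bdd(2) S] by auto
    have "ennreal (norm (f (\<gamma> a))) \<le> ennreal L * emeasure \<nu> {a<..Inf S}"
      using len[of a "Inf S"] i by (auto simp: S_def)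
    \<comment> \<open>The parameter \<open>Inf S\<close> belongs to the zero set and has to be split
      off; a single parameter carries no length.\<close>
    also have "emeasure \<nu> {a<..Inf S} \<le> emeasure \<nu> ({a<..<Inf S} \<union> {Inf S})" by (intro emeasure_mono) auto
    also have "\<dots> \<le> emeasure \<nu> {a<..<Inf S} + emeasure \<nu> {Inf S}" by (intro emeasure_subadditive) auto
    also have "\<dots> \<le> emeasure \<nu> ?A"
    proof -
      have "x \<notin> S" if "x < Inf S" for x using that bdd(1) cInf_lower[of x S] by force
      then have "{a<..<Inf S} \<subseteq> ?A" using i by (auto simp: S_def)
      then show ?thesis using A by (auto intro!: emeasure_mono)
    qed
    finally have 1: "ennreal (norm (f (\<gamma> a))) \<le> ennreal L * emeasure \<nu> ?A"
      by (simp add: mult_left_mono)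
    have "ennreal (norm (f (\<gamma> b))) \<le> ennreal L * emeasure \<nu> {Sup S<..b}"
      using len[of "Sup S" b] s by (auto simp: S_def)
    also have "emeasure \<nu> {Sup S<..b} \<le> emeasure \<nu> ?A"
    proof -
      have "x \<notin> S" if "Sup S < x" for x using that bdd(2) cSup_upper[of x S] by force
      then have "{Sup S<..b} \<subseteq> ?A" using s by (auto simp: S_def)
      then show ?thesis using A by (auto intro!: emeasure_mono)
    qed
    finally have 2: "ennreal (norm (f (\<gamma> b))) \<le> ennreal L * emeasure \<nu> ?A"
      by (simp add: mult_left_mono)
    have "ennreal (norm (f (\<gamma> a) - f (\<gamma> b))) \<le> ennreal (norm (f (\<gamma> a)) + norm (f (\<gamma> b)))"
      by (intro ennreal_leI norm_triangle_ineq4)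
    also have "\<dots> = ennreal (norm (f (\<gamma> a))) + ennreal (norm (f (\<gamma> b)))" by simp
    also have "\<dots> \<le> ennreal L * emeasure \<nu> ?A + ennreal L * emeasure \<nu> ?A" by (intro add_mono 1 2)
    finally show ?thesis unfolding two .
  qed
qed

lemma suminf_ennreal_finite_tendsto_0:
  fixes f :: "nat \<Rightarrow> ennreal"
  assumes "(\<Sum>k. f k) < \<infinity>" shows "f \<longlonglongrightarrow> 0"
proof -
  have "f k < \<infinity>" for k
  proof -
    have "f k = (\<Sum>i\<in>{k}. f i)" by simp
    also have "\<dots> \<le> (\<Sum>k. f k)" by (intro sum_le_suminf) auto
    finally show ?thesis using assms by (rule order.strict_trans1)
  qed
  then have f: "f k = ennreal (enn2real (f k))" for k by (simp add: less_top)
  have "(\<Sum>k. ennreal (enn2real (f k))) \<noteq> top" using assms f by simp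
  then have "summable (\<lambda>k. enn2real (f k))" by (intro summable_suminf_not_top) auto
  then have "(\<lambda>k. ennreal (enn2real (f k))) \<longlonglongrightarrow> ennreal 0"
    by (intro tendsto_ennrealI summable_LIMSEQ_zero)
  then show ?thesis using f by simp
qed

context newton_sobolev
begin

text \<open>The gradient lives on a bounded set, and balls have finite measure. This provides the
  minimal gradients of the approximating functions.\<close>

lemma lipschitz_LWG:
  fixes f :: "'a \<Rightarrow> 'v::real_normed_vector"
  assumes "f \<in> lipschitz_bounded_support"
  shows "LWG f \<noteq> {}"
proof -
  obtain L where lip: "L-lipschitz_on UNIV f" and bdd: "bounded {x. f x \<noteq> 0}"
    using assms by (auto simp: lipschitz_bounded_support_def)
  have "continuous_on UNIV f" using lip by (rule lipschitz_on_continuous_on)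
  then have "open (f -` (- {0}))" by (rule open_vimage[rotated]) auto
  then have supp: "open {x. f x \<noteq> 0}" by (simp add: vimage_def)
  let ?\<rho> = "\<lambda>x. ennreal (2 * L) * indicator {x. f x \<noteq> 0} x"
  have \<rho>: "?\<rho> \<in> borel_measurable borel" using borel_open[OF supp] by simp
  have "energy ?\<rho> < \<infinity>"
  proof -
    obtain x r where r: "0 < r" "{x. f x \<noteq> 0} \<subseteq> ball x r"
      using bounded_subset_ballD[OF bdd] by blast
    have "energy ?\<rho> = ennreal_powr (ennreal (2 * L)) p * energy (indicator {x. f x \<noteq> 0})"
      using supp by (intro energy_cmult) (auto intro!: measurable_M)
    also have "energy (indicator {x. f x \<noteq> 0}) \<le> (\<integral>\<^sup>+y. indicator (ball x r) y \<partial>M)"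
      unfolding energy_def using r by (intro nn_integral_mono) (auto split: split_indicator)
    also have "\<dots> = \<mu> (ball x r)"
      using subsetD[OF borel_subset_M borel_open[OF open_ball]] by (simp add: emeasure_M)
    finally have "energy ?\<rho> \<le> ennreal_powr (ennreal (2 * L)) p * \<mu> (ball x r)"
      by (simp add: mult_left_mono)
    also have "\<dots> < \<infinity>" using mms r(1) by (auto simp: metric_measure_space_def ennreal_mult_less_top
          ennreal_powr_less_top_iff[unfolded infinity_ennreal_def])
    finally show ?thesis .
  qed
  then have "?\<rho> \<in> Lp_borel \<mu> p" using \<rho> by (simp add: Lp_borel_iff)
  moreover have "ae_curve (\<lambda>(a, b, \<gamma>). ennreal (norm (f (\<gamma> a) - f (\<gamma> b))) \<le> curve_integral ?\<rho> (a, b, \<gamma>))"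
    unfolding ae_curve_def
  proof (rule bexI[OF _ calculation], clarify)
    fix a b and \<gamma> :: "real \<Rightarrow> 'a"
    assume c: "(a, b, \<gamma>) \<in> curves" "curve_integral ?\<rho> (a, b, \<gamma>) < \<infinity>"
    then interpret rectifiable_curve a b \<gamma> by (rule curve_integral_finite_rectifiable)
    let ?A = "{t \<in> {a<..b}. f (\<gamma> t) \<noteq> 0}"
    have "(\<lambda>t. indicator {x. f x \<noteq> 0} (\<gamma> t) * indicator {a<..b} t :: ennreal) \<in> borel_measurable borel"
      using supp by (intro measurable_along_curve) auto
    also have "(\<lambda>t. indicator {x. f x \<noteq> 0} (\<gamma> t) * indicator {a<..b} t :: ennreal) = indicator ?A"
      by (auto split: split_indicator)
    finally have A: "?A \<in> sets borel" by (simp add: borel_measurable_indicator_iff)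
    have "curve_integral ?\<rho> (a, b, \<gamma>) = (\<integral>\<^sup>+t. ennreal (2 * L) * indicator ?A t \<partial>\<nu>)"
      unfolding curve_integral_eq[OF \<rho>] by (intro nn_integral_cong) (auto split: split_indicator)
    also have "\<dots> = ennreal (2 * L) * emeasure \<nu> ?A"
      using A by (intro nn_integral_cmult_indicator) simp
    finally show "ennreal (norm (f (\<gamma> a) - f (\<gamma> b))) \<le> curve_integral ?\<rho> (a, b, \<gamma>)"
      using lipschitz_along_curve[OF lip] by (simp only:)
  qed
  ultimately show ?thesis using \<rho> by (auto simp: LWG_iff weak_upper_gradient_iff)
qed

text \<open>Fuglede's lemma in the form needed here. Along a subsequence the errors \<open>d\<close>
  tend to 0 so fast that their sum has finite energy. On almost every curve the integral of this sum
  is finite, so the integrals of the single errors tend to 0 and the inequalities pass to the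
  limit.\<close>

lemma wug_limit:
  assumes w: "\<And>n. wug (w n) (h n)" and h: "h' \<in> borel_measurable borel"
    and d: "\<And>n. d n \<in> borel_measurable borel" "\<And>n x. h n x \<le> h' x + d n x"
      "(\<lambda>n. energy (d n)) \<longlonglongrightarrow> 0"
    and lim: "ae_curve (\<lambda>(a, b, \<gamma>). \<gamma> a = \<gamma> b \<or>
      (\<lambda>n. w n (\<gamma> a)) \<longlonglongrightarrow> u (\<gamma> a) \<and> (\<lambda>n. w n (\<gamma> b)) \<longlonglongrightarrow> u (\<gamma> b))"
  shows "wug u h'"
proof -
  note [measurable] = d(1)
  \<comment> \<open>Multiplying \<open>d (r k)\<close> by \<open>2 ^ Suc k\<close> multiplies its
    energy by \<open>(2 ^ Suc k) powr p\<close>, which leaves at most \<open>(1/2) ^ Suc k\<close>.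
    The factor cancels the weights in \<open>energy_suminf\<close>, and the bounds sum to 1.\<close>
  define \<delta> where "\<delta> k = (1/2) ^ Suc k / (2 ^ Suc k) powr p" for k :: nat
  have \<delta>: "0 < \<delta> k" for k by (simp add: \<delta>_def)
  have "\<exists>n\<ge>k. energy (d n) < ennreal (\<delta> k)" for k
  proof -
    have "\<forall>\<^sub>F n in sequentially. energy (d n) < ennreal (\<delta> k)"
      using \<delta>[of k] by (intro order_tendstoD(2)[OF d(3)]) simp
    then show ?thesis unfolding eventually_sequentially by (metis nle_le order_refl)
  qed
  then obtain r where r: "\<And>k. r k \<ge> k" "\<And>k. energy (d (r k)) < ennreal (\<delta> k)" by metis
  have r_lim: "filterlim r sequentially sequentially"
    using r(1) by (intro filterlim_at_top_mono[OF filterlim_ident]) auto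
  let ?\<sigma> = "\<lambda>x. \<Sum>k. d (r k) x"
  have "?\<sigma> \<in> Lp_borel \<mu> p"
  proof -
    have half: "ennreal ((1/2) ^ Suc k) * (ennreal (2 ^ Suc k) * y) = y" for k y
    proof -
      have "ennreal ((1/2) ^ Suc k) * ennreal (2 ^ Suc k) = ennreal ((1/2) ^ Suc k * 2 ^ Suc k)"
        by (intro ennreal_mult[symmetric]) auto
      also have "(1/2) ^ Suc k * 2 ^ Suc k = (1::real)" unfolding power_mult_distrib[symmetric] by simp
      finally show ?thesis by (simp add: mult.assoc[symmetric])
    qed
    have "energy (\<lambda>x. \<Sum>k. ennreal ((1/2) ^ Suc k) * (ennreal (2 ^ Suc k) * d (r k) x)) \<le>
        (\<Sum>k. energy (\<lambda>x. ennreal (2 ^ Suc k) * d (r k) x))"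
      by (intro energy_suminf) measurable
    also have "\<dots> \<le> (\<Sum>k. ennreal ((1/2) ^ Suc k))"
    proof (intro suminf_le)
      fix k
      have "energy (\<lambda>x. ennreal (2 ^ Suc k) * d (r k) x) = ennreal ((2 ^ Suc k) powr p) * energy (d (r k))"
        by (subst energy_cmult) (auto simp: ennreal_powr_ennreal intro!: measurable_M d(1))
      also have "\<dots> \<le> ennreal ((2 ^ Suc k) powr p) * ennreal (\<delta> k)"
        using r(2)[of k] by (intro mult_left_mono) auto
      also have "\<dots> = ennreal ((1/2) ^ Suc k)"
        using \<delta>[of k] by (subst ennreal_mult[symmetric]) (auto simp: \<delta>_def)
      finally show "energy (\<lambda>x. ennreal (2 ^ Suc k) * d (r k) x) \<le> ennreal ((1/2) ^ Suc k)" .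
    qed auto
    also note suminf_half
    finally have "energy ?\<sigma> \<le> 1" unfolding half .
    then show ?thesis by (auto simp: Lp_borel_iff intro: order.strict_trans1)
  qed
  moreover have "ae_curve (\<lambda>c. \<forall>n. (\<lambda>(a, b, \<gamma>). ennreal (norm (w n (\<gamma> a) - w n (\<gamma> b))) \<le> curve_integral (h n) (a, b, \<gamma>)) c)"
    using w by (intro ae_curve_all) (simp add: weak_upper_gradient_iff)
  ultimately have "ae_curve (\<lambda>c. (curve_integral ?\<sigma> c < \<infinity> \<and>
      (\<forall>n. (\<lambda>(a, b, \<gamma>). ennreal (norm (w n (\<gamma> a) - w n (\<gamma> b))) \<le> curve_integral (h n) (a, b, \<gamma>)) c)) \<and>
      (\<lambda>(a, b, \<gamma>). \<gamma> a = \<gamma> b \<or>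
      (\<lambda>n. w n (\<gamma> a)) \<longlonglongrightarrow> u (\<gamma> a) \<and> (\<lambda>n. w n (\<gamma> b)) \<longlonglongrightarrow> u (\<gamma> b)) c)"
    by (intro ae_curve_conj lim ae_curve_finite)
  then have "ae_curve (\<lambda>(a, b, \<gamma>). ennreal (norm (u (\<gamma> a) - u (\<gamma> b))) \<le> curve_integral h' (a, b, \<gamma>))"
  proof (rule ae_curve_mono, clarify)
    fix a b and \<gamma> :: "real \<Rightarrow> 'a"
    assume c: "(a, b, \<gamma>) \<in> curves" and fin: "curve_integral ?\<sigma> (a, b, \<gamma>) < \<infinity>"
      and le: "\<forall>n. ennreal (norm (w n (\<gamma> a) - w n (\<gamma> b))) \<le> curve_integral (h n) (a, b, \<gamma>)"
      and "\<gamma> a = \<gamma> b \<or> (\<lambda>n. w n (\<gamma> a)) \<longlonglongrightarrow> u (\<gamma> a) \<and> (\<lambda>n. w n (\<gamma> b)) \<longlonglongrightarrow> u (\<gamma> b)"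
    then consider "\<gamma> a = \<gamma> b" | "(\<lambda>n. w n (\<gamma> a)) \<longlonglongrightarrow> u (\<gamma> a)" "(\<lambda>n. w n (\<gamma> b)) \<longlonglongrightarrow> u (\<gamma> b)" by blast
    then show "ennreal (norm (u (\<gamma> a) - u (\<gamma> b))) \<le> curve_integral h' (a, b, \<gamma>)"
    proof cases
      case 2
      have "(\<lambda>n. ennreal (norm (w n (\<gamma> a) - w n (\<gamma> b)))) \<longlonglongrightarrow> ennreal (norm (u (\<gamma> a) - u (\<gamma> b)))"
        by (intro tendsto_intros 2)
      then have l: "(\<lambda>k. ennreal (norm (w (r k) (\<gamma> a) - w (r k) (\<gamma> b)))) \<longlonglongrightarrow> ennreal (norm (u (\<gamma> a) - u (\<gamma> b)))"
        using r_lim by (rule filterlim_compose)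
      have "(\<lambda>k. curve_integral (d (r k)) (a, b, \<gamma>)) \<longlonglongrightarrow> 0"
        using fin unfolding curve_integral_suminf[OF d(1) c] by (rule suminf_ennreal_finite_tendsto_0)
      then have rr: "(\<lambda>k. curve_integral h' (a, b, \<gamma>) + curve_integral (d (r k)) (a, b, \<gamma>)) \<longlonglongrightarrow> curve_integral h' (a, b, \<gamma>) + 0"
        by (intro tendsto_add tendsto_const)
      have "ennreal (norm (w (r k) (\<gamma> a) - w (r k) (\<gamma> b))) \<le> curve_integral h' (a, b, \<gamma>) + curve_integral (d (r k)) (a, b, \<gamma>)" for k
      proof -
        have "ennreal (norm (w (r k) (\<gamma> a) - w (r k) (\<gamma> b))) \<le> curve_integral (h (r k)) (a, b, \<gamma>)"
          using le by blast
        also have "\<dots> \<le> curve_integral (\<lambda>x. h' x + d (r k) x) (a, b, \<gamma>)"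
          by (intro curve_integral_mono d)
        also have "\<dots> = curve_integral h' (a, b, \<gamma>) + curve_integral (d (r k)) (a, b, \<gamma>)"
          by (intro curve_integral_add h d c)
        finally show ?thesis .
      qed
      then have "ennreal (norm (u (\<gamma> a) - u (\<gamma> b))) \<le> curve_integral h' (a, b, \<gamma>) + 0"
        by (intro LIMSEQ_le[OF l rr]) blast
      then show ?thesis by (simp only: add_0_right)
    qed simp
  qed
  then show ?thesis using h by (simp add: weak_upper_gradient_iff)
qed

end

section \<open>Lower semicontinuity of the energy under contractions\<close>

lemma powr_le_self:
  fixes x q :: real
  assumes "0 \<le> x" "x \<le> 1" "1 \<le> q" shows "x powr q \<le> x"
  using powr_mono'[of 1 q x] assms by (cases "x = 0") auto

context newton_sobolev
begin

text \<open>Moves \<open>g\<close> into the measure. From then on only the bounded factor varies, on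
  a measure space that is finite when \<open>g\<close> has finite energy.\<close>

lemma energy_density:
  assumes [measurable]: "g \<in> borel_measurable borel" "c \<in> borel_measurable borel" and c: "\<And>x. 0 \<le> c x"
  shows "energy (\<lambda>x. ennreal (c x) * g x) =
    (\<integral>\<^sup>+x. ennreal (c x powr p) \<partial>density M (\<lambda>x. ennreal_powr (g x) p))"
proof -
  have "energy (\<lambda>x. ennreal (c x) * g x) = (\<integral>\<^sup>+x. ennreal_powr (g x) p * ennreal (c x powr p) \<partial>M)"
    unfolding energy_def
    by (intro nn_integral_cong) (simp add: ennreal_powr_mult[OF p_pos] ennreal_powr_ennreal c mult.commute)
  also have "\<dots> = (\<integral>\<^sup>+x. ennreal (c x powr p) \<partial>density M (\<lambda>x. ennreal_powr (g x) p))"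
    by (intro nn_integral_density[symmetric]) measurable
  finally show ?thesis .
qed

text \<open>Only four properties of the maps are used: they are contractions, their classes
  decrease, the classes contain midpoints, and any selection converges to the identity along
  \<open>u\<close> at the endpoints of almost every curve. The bound holds for every gradient
  \<open>h\<close>, so it may be applied to a minimal one.\<close>

lemma minimal_gradient_approximation:
  fixes u :: "'a \<Rightarrow> 'v::real_normed_vector" and C :: "nat \<Rightarrow> ('v \<Rightarrow> 'v) set"
  assumes g: "g \<in> LWG u" and g_min: "\<And>\<sigma>. \<sigma> \<in> LWG u \<Longrightarrow> AE x in M. g x \<le> \<sigma> x"
    and C_ne: "\<And>n. C n \<noteq> {}" and C_dec: "\<And>m n. m \<le> n \<Longrightarrow> C n \<subseteq> C m"
    and C_lip: "\<And>n S x y. S \<in> C n \<Longrightarrow> norm (S x - S y) \<le> norm (x - y)"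
    and C_mid: "\<And>n S T. S \<in> C n \<Longrightarrow> T \<in> C n \<Longrightarrow> (\<lambda>v. (1/2) *\<^sub>R (S v + T v)) \<in> C n"
    and C_lim: "\<And>S. (\<And>n. S n \<in> C n) \<Longrightarrow> ae_curve (\<lambda>(a, b, \<gamma>). \<gamma> a = \<gamma> b \<or>
      (\<lambda>n. S n (u (\<gamma> a))) \<longlonglongrightarrow> u (\<gamma> a) \<and> (\<lambda>n. S n (u (\<gamma> b))) \<longlonglongrightarrow> u (\<gamma> b))"
    and \<epsilon>: "0 < \<epsilon>"
  shows "\<exists>n. \<forall>S\<in>C n. \<forall>h\<in>LWG (\<lambda>x. S (u x)). energy (\<lambda>x. g x - h x) \<le> ennreal \<epsilon>"
proof -
  have gL: "g \<in> Lp_borel \<mu> p" "wug u g" and [measurable]: "g \<in> borel_measurable borel"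
    using g by (auto simp: LWG_iff Lp_borel_iff)
  have [measurable]: "g \<in> borel_measurable M" by (rule measurable_M) measurable
  have g_comp: "wug (\<lambda>x. S (u x)) g" if "S \<in> C n" for S n
    using wug_compose[OF gL(2), of 1 S] C_lip[OF that] by simp
  define m where "m = density M (\<lambda>x. ennreal_powr (g x) p)"
  have m_sets [simp, measurable_cong]: "sets m = sets M" and m_space [simp]: "space m = UNIV"
    by (simp_all add: m_def)
  have "emeasure m UNIV = energy g"
    unfolding m_def energy_def using sets.top[of M] by (subst emeasure_density) auto
  then interpret m: finite_measure m
    using gL(1) by (intro finite_measureI) (auto simp: Lp_borel_iff)
  have mm: "f \<in> borel_measurable m" if "f \<in> borel_measurable borel" for f :: "'a \<Rightarrow> real"
    using measurable_M[OF that] by (simp cong: measurable_cong_sets)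
  \<comment> \<open>Ratios to \<open>g\<close> are recorded instead of gradients. The constant 1
    belongs to each \<open>\<Theta> n\<close> because the maps are contractions, and
    \<open>m0\<close> is the value of \<open>\<Phi>\<close> at it, the largest possible one.\<close>
  define \<Theta> where "\<Theta> n = {\<theta>. \<theta> \<in> borel_measurable borel \<and> (\<forall>x. 0 \<le> \<theta> x \<and> \<theta> x \<le> 1) \<and>
      (\<exists>S\<in>C n. wug (\<lambda>x. S (u x)) (\<lambda>x. ennreal (\<theta> x) * g x))}" for n
  define \<Phi> where "\<Phi> \<theta> = (\<integral>x. (\<theta> x)\<^sup>2 \<partial>m)" for \<theta> :: "'a \<Rightarrow> real"
  define m0 where "m0 = measure m UNIV"
  have \<Theta>D: "\<theta> \<in> borel_measurable borel" "0 \<le> \<theta> x" "\<theta> x \<le> 1" if "\<theta> \<in> \<Theta> n" for \<theta> n x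
    using that by (auto simp: \<Theta>_def)
  have int: "integrable m f" if "f \<in> borel_measurable borel" "\<And>x. \<bar>f x\<bar> \<le> 1" for f :: "'a \<Rightarrow> real"
    using that by (intro m.integrable_const_bound[where B = 1] mm) auto
  have sq_le: "\<bar>x\<^sup>2\<bar> \<le> (1::real)" if "0 \<le> x" "x \<le> 1" for x
    using that by (simp add: power_le_one)
  have int_sq: "integrable m (\<lambda>x. (\<theta> x)\<^sup>2)" if "\<theta> \<in> \<Theta> n" for \<theta> n
    using \<Theta>D[OF that] by (intro int sq_le) auto
  have \<Phi>_nonneg: "0 \<le> \<Phi> \<theta>" for \<theta> unfolding \<Phi>_def by (intro integral_nonneg_AE) auto
  have \<Phi>_le: "\<Phi> \<theta> \<le> m0" if "\<theta> \<in> \<Theta> n" for \<theta> n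
  proof -
    have "\<Phi> \<theta> \<le> (\<integral>x. 1 \<partial>m)" unfolding \<Phi>_def
      using \<Theta>D[OF that] by (intro integral_mono int_sq[OF that]) (auto simp: power_le_one)
    then show ?thesis by (simp add: m0_def)
  qed
  have \<Theta>_ne: "(\<lambda>_. 1) \<in> \<Theta> n" for n
    using C_ne[of n] g_comp by (auto simp: \<Theta>_def)
  have \<Theta>_dec: "\<Theta> n \<subseteq> \<Theta> k" if "k \<le> n" for n k
    using C_dec[OF that] by (auto simp: \<Theta>_def)
  have \<Theta>_mid: "(\<lambda>x. (\<theta> x + \<theta>' x) / 2) \<in> \<Theta> n" if th: "\<theta> \<in> \<Theta> n" "\<theta>' \<in> \<Theta> n" for \<theta> \<theta>' n
  proof -
    obtain S T where S: "S \<in> C n" "wug (\<lambda>x. S (u x)) (\<lambda>x. ennreal (\<theta> x) * g x)"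
      and T: "T \<in> C n" "wug (\<lambda>x. T (u x)) (\<lambda>x. ennreal (\<theta>' x) * g x)"
      using th by (auto simp: \<Theta>_def)
    have "wug (\<lambda>x. (1/2) *\<^sub>R (S (u x) + T (u x)))
        (\<lambda>x. ennreal (1/2) * (ennreal (\<theta> x) * g x + ennreal (\<theta>' x) * g x))"
      by (rule wug_compose[OF wug_add[OF S(2) T(2)], where T = "\<lambda>v. (1/2) *\<^sub>R v"])
        (auto simp flip: scaleR_diff_right)
    also have "(\<lambda>x. ennreal (1/2) * (ennreal (\<theta> x) * g x + ennreal (\<theta>' x) * g x)) =
        (\<lambda>x. ennreal ((\<theta> x + \<theta>' x) / 2) * g x)"
    proof
      fix x
      note nn = \<Theta>D(2)[OF th(1), of x] \<Theta>D(2)[OF th(2), of x]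
      have "ennreal ((\<theta> x + \<theta>' x) / 2) = ennreal ((1/2) * (\<theta> x + \<theta>' x))" by simp
      also have "\<dots> = ennreal (1/2) * ennreal (\<theta> x + \<theta>' x)" using nn by (intro ennreal_mult) auto
      also have "\<dots> = ennreal (1/2) * (ennreal (\<theta> x) + ennreal (\<theta>' x))" using nn by (simp only: ennreal_plus)
      finally show "ennreal (1/2) * (ennreal (\<theta> x) * g x + ennreal (\<theta>' x) * g x) = ennreal ((\<theta> x + \<theta>' x) / 2) * g x"
        by (simp only: distrib_right distrib_left mult.assoc)
    qed
    finally show ?thesis
      using C_mid[OF S(1) T(1)] \<Theta>D[OF th(1)] \<Theta>D[OF th(2)]
      unfolding \<Theta>_def by (auto intro!: bexI[of _ "\<lambda>v. (1/2) *\<^sub>R (S v + T v)"] add_nonneg_nonneg)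
        (smt (verit))
  qed
  \<comment> \<open>If this failed, the infimum of \<open>\<Phi>\<close> would stay below
    \<open>m0 - \<epsilon>\<close> at every stage; almost minimizers would then converge to the
    ratio of a gradient of \<open>u\<close> that is too small.\<close>
  have "\<exists>n. \<forall>\<theta>\<in>\<Theta> n. m0 - \<epsilon> \<le> \<Phi> \<theta>"
  proof (rule ccontr)
    assume "\<not> ?thesis"
    then have "\<forall>n. \<exists>\<theta>\<in>\<Theta> n. \<Phi> \<theta> < m0 - \<epsilon>" by (auto simp: not_le)
    define I where "I n = (INF \<theta>\<in>\<Theta> n. \<Phi> \<theta>)" for n
    have bdd: "bdd_below (\<Phi> ` \<Theta> n)" for n by (intro bdd_belowI2[where m = 0] \<Phi>_nonneg)
    have I_lower: "I n \<le> \<Phi> \<theta>" if "\<theta> \<in> \<Theta> n" for n \<theta>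
      unfolding I_def by (rule cINF_lower[OF bdd that])
    have I_less: "I n < m0 - \<epsilon>" for n
    proof -
      obtain \<theta> where "\<theta> \<in> \<Theta> n" "\<Phi> \<theta> < m0 - \<epsilon>"
        using \<open>\<forall>n. \<exists>\<theta>\<in>\<Theta> n. \<Phi> \<theta> < m0 - \<epsilon>\<close> by blast
      then show ?thesis using I_lower by fastforce
    qed
    have I_mono: "I k \<le> I n" if "k \<le> n" for k n
      unfolding I_def using \<Theta>_ne[of n] \<Theta>_dec[OF that] bdd by (intro cINF_superset_mono) auto
    have "\<forall>n. \<exists>\<theta>\<in>\<Theta> n. \<Phi> \<theta> < I n + 1 / Suc n"
    proof
      fix n
      have "I n < I n + 1 / Suc n" by simp
      then show "\<exists>\<theta>\<in>\<Theta> n. \<Phi> \<theta> < I n + 1 / Suc n"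
        using \<Theta>_ne[of n] bdd[of n] unfolding I_def[of n] by (subst (asm) cINF_less_iff) auto
    qed
    then obtain \<theta> where \<theta>: "\<And>n. \<theta> n \<in> \<Theta> n" "\<And>n. \<Phi> (\<theta> n) < I n + 1 / Suc n" by metis
    note \<theta>D = \<Theta>D[OF \<theta>(1)]
    note [measurable] = \<theta>D(1)
    \<comment> \<open>Both functions belong to the larger class \<open>\<Theta> i\<close>, hence so
      does their midpoint, and \<open>\<Phi>\<close> is at least \<open>I i\<close> there. The
      parallelogram identity turns this into a bound on the distance.\<close>
    have par: "(\<integral>x. (\<theta> i x - \<theta> j x)\<^sup>2 \<partial>m) \<le> 2 * (I j - I i) + 2 / Suc i + 2 / Suc j" if "i \<le> j" for i j
    proof -
      have mid: "(\<lambda>x. (\<theta> i x + \<theta> j x) / 2) \<in> \<Theta> i"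
        using \<theta>(1)[of i] \<theta>(1)[of j] \<Theta>_dec[OF that] by (intro \<Theta>_mid) auto
      have "(\<integral>x. (\<theta> i x - \<theta> j x)\<^sup>2 \<partial>m) =
          (\<integral>x. 2 * (\<theta> i x)\<^sup>2 + 2 * (\<theta> j x)\<^sup>2 - 4 * ((\<theta> i x + \<theta> j x) / 2)\<^sup>2 \<partial>m)"
        by (intro Bochner_Integration.integral_cong) (auto simp: power2_eq_square field_simps)
      also have "\<dots> = 2 * \<Phi> (\<theta> i) + 2 * \<Phi> (\<theta> j) - 4 * \<Phi> (\<lambda>x. (\<theta> i x + \<theta> j x) / 2)"
        using int_sq[OF \<theta>(1)[of i]] int_sq[OF \<theta>(1)[of j]] int_sq[OF mid]
        by (simp only: \<Phi>_def Bochner_Integration.integral_diff Bochner_Integration.integral_add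
            Bochner_Integration.integrable_add integrable_mult_right integral_mult_right_zero)
      also have "\<dots> \<le> 2 * (I i + 1 / Suc i) + 2 * (I j + 1 / Suc j) - 4 * I i"
        using \<theta>(2)[of i] \<theta>(2)[of j] I_lower[OF mid]
        by (intro diff_mono add_mono mult_left_mono) auto
      also have "\<dots> = 2 * (I j - I i) + 2 / Suc i + 2 / Suc j" by (simp add: algebra_simps)
      finally show ?thesis .
    qed
    have "incseq I" using I_mono by (auto simp: incseq_def)
    moreover have "\<forall>n. I n \<le> m0" using I_less \<epsilon> by (smt (verit))
    ultimately obtain l where l: "I \<longlonglongrightarrow> l" "\<forall>n. I n \<le> l" by (rule incseq_convergent)
    have inv: "(\<lambda>n. 1 / Suc n) \<longlonglongrightarrow> (0::real)"
      using LIMSEQ_inverse_real_of_nat by (simp add: inverse_eq_divide)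
    have sq_small: "\<exists>N. \<forall>i\<ge>N. \<forall>j\<ge>N. (\<integral>x. (\<theta> i x - \<theta> j x)\<^sup>2 \<partial>m) < e" if "0 < e" for e
    proof -
      have "(\<lambda>n. 2 * (l - I n) + 2 * (1 / Suc n) + 2 * (1 / Suc n)) \<longlonglongrightarrow> 2 * (l - l) + 2 * 0 + 2 * 0"
        by (intro tendsto_intros l inv)
      then have "\<forall>\<^sub>F n in sequentially. 2 * (l - I n) + 2 * (1 / Suc n) + 2 * (1 / Suc n) < e"
        using that by (intro order_tendstoD(2)) auto
      then obtain N where N: "\<And>n. n \<ge> N \<Longrightarrow> 2 * (l - I n) + 2 * (1 / Suc n) + 2 * (1 / Suc n) < e"
        by (auto simp: eventually_sequentially)
      have *: "(\<integral>x. (\<theta> i x - \<theta> j x)\<^sup>2 \<partial>m) < e" if "N \<le> i" "i \<le> j" for i j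
      proof -
        have "(\<integral>x. (\<theta> i x - \<theta> j x)\<^sup>2 \<partial>m) \<le> 2 * (I j - I i) + 2 / Suc i + 2 / Suc j" by (rule par[OF that(2)])
        also have "\<dots> \<le> 2 * (l - I i) + 2 * (1 / Suc i) + 2 * (1 / Suc i)"
          using l(2)[rule_format, of j] that(2) frac_le[of 2 2 "Suc i" "Suc j"] by simp
        also have "\<dots> < e" using N that by simp
        finally show ?thesis .
      qed
      have "(\<integral>x. (\<theta> i x - \<theta> j x)\<^sup>2 \<partial>m) < e" if "N \<le> i" "N \<le> j" for i j
        using *[of i j] *[of j i] that by (cases "i \<le> j") (auto simp: power2_commute)
      then show ?thesis by blast
    qed
    have diff_le: "\<bar>\<theta> i x - \<theta> j x\<bar> \<le> 1" for i j x
      using \<theta>D(2,3)[of i x] \<theta>D(2,3)[of j x] by (simp add: abs_le_iff)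
    \<comment> \<open>Almost everywhere convergent subsequences are extracted from sequences that
      are Cauchy in the first power. On the finite measure \<open>m\<close> this follows from the
      squares by \<open>\<bar>y\<bar> \<le> \<delta> + y\<^sup>2 / \<delta>\<close>, with
      \<open>\<delta>\<close> so small that the constant contributes at most
      \<open>e / 2\<close>.\<close>
    have L1: "\<exists>N. \<forall>i\<ge>N. \<forall>j\<ge>N. (\<integral>x. norm (\<theta> i x - \<theta> j x) \<partial>m) < e" if e: "0 < e" for e
    proof -
      have m0: "0 \<le> m0" by (simp add: m0_def)
      define \<delta> where "\<delta> = e / (2 * (m0 + 1))"
      have \<delta>: "0 < \<delta>" using e m0 by (simp add: \<delta>_def)
      have "\<delta> * m0 \<le> e / 2" using e m0 by (simp add: \<delta>_def field_simps)
      obtain N where N: "\<And>i j. i \<ge> N \<Longrightarrow> j \<ge> N \<Longrightarrow> (\<integral>x. (\<theta> i x - \<theta> j x)\<^sup>2 \<partial>m) < \<delta> * (e / 2)"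
        using sq_small[of "\<delta> * (e / 2)"] \<delta> e by auto
      have abs_le: "\<bar>y\<bar> \<le> \<delta> + y\<^sup>2 / \<delta>" for y
      proof (cases "\<bar>y\<bar> \<le> \<delta>")
        case False
        then have "\<bar>y\<bar> * \<delta> \<le> \<bar>y\<bar> * \<bar>y\<bar>" using \<delta> by (intro mult_left_mono) auto
        then have "\<bar>y\<bar> \<le> y\<^sup>2 / \<delta>" using \<delta> by (simp add: pos_le_divide_eq power2_eq_square)
        then show ?thesis using \<delta> by simp
      qed (use \<delta> in \<open>simp add: add_increasing2\<close>)
      have "(\<integral>x. norm (\<theta> i x - \<theta> j x) \<partial>m) < e" if ij: "N \<le> i" "N \<le> j" for i j
      proof -
        have i2: "integrable m (\<lambda>x. (\<theta> i x - \<theta> j x)\<^sup>2)"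
          using diff_le by (intro int) (auto simp: abs_square_le_1)
        have "(\<integral>x. norm (\<theta> i x - \<theta> j x) \<partial>m) \<le> (\<integral>x. \<delta> + (\<theta> i x - \<theta> j x)\<^sup>2 / \<delta> \<partial>m)"
        proof (rule integral_mono)
          show "integrable m (\<lambda>x. norm (\<theta> i x - \<theta> j x))" using diff_le by (intro int) auto
          show "integrable m (\<lambda>x. \<delta> + (\<theta> i x - \<theta> j x)\<^sup>2 / \<delta>)" using i2 by simp
        qed (simp add: abs_le)
        also have "\<dots> = \<delta> * m0 + (\<integral>x. (\<theta> i x - \<theta> j x)\<^sup>2 \<partial>m) / \<delta>"
          using i2 by (simp add: m0_def)
        also have "\<dots> < e / 2 + e / 2"
          using \<open>\<delta> * m0 \<le> e / 2\<close> N[OF ij] \<delta> by (intro add_le_less_mono) (simp_all add: pos_divide_less_eq mult.commute)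
        finally show ?thesis by simp
      qed
      then show ?thesis by blast
    qed
    obtain r where r: "strict_mono r" "AE x in m. Cauchy (\<lambda>i. \<theta> (r i) x)"
      using cauchy_L1_AE_cauchy_subseq[of m \<theta>] L1 int[OF \<theta>D(1)] \<theta>D(2,3) by (metis abs_of_nonneg)
    \<comment> \<open>Where the sequence diverges, \<open>lim\<close> has an unknown value; clamping
      gives the bounds everywhere and changes nothing at points of convergence.\<close>
    define \<theta>' where "\<theta>' x = max 0 (min 1 (lim (\<lambda>i. \<theta> (r i) x)))" for x
    have [measurable]: "\<theta>' \<in> borel_measurable borel" unfolding \<theta>'_def[abs_def] by measurable
    have \<theta>'_bound: "0 \<le> \<theta>' x" "\<theta>' x \<le> 1" for x by (auto simp: \<theta>'_def)
    have lim: "AE x in m. (\<lambda>i. \<theta> (r i) x) \<longlonglongrightarrow> \<theta>' x"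
      using r(2)
    proof eventually_elim
      case (elim x)
      then have *: "(\<lambda>i. \<theta> (r i) x) \<longlonglongrightarrow> lim (\<lambda>i. \<theta> (r i) x)"
        by (simp add: Cauchy_convergent_iff convergent_LIMSEQ_iff)
      have "0 \<le> lim (\<lambda>i. \<theta> (r i) x)" "lim (\<lambda>i. \<theta> (r i) x) \<le> 1"
        using \<theta>D(2,3) by (auto intro: LIMSEQ_le_const[OF *] LIMSEQ_le_const2[OF *])
      then show ?case using * by (simp add: \<theta>'_def)
    qed
    have en: "(\<lambda>i. energy (\<lambda>x. ennreal \<bar>\<theta> (r i) x - \<theta>' x\<bar> * g x)) \<longlonglongrightarrow> 0"
    proof -
      have "(\<lambda>i. \<integral>\<^sup>+x. ennreal (\<bar>\<theta> (r i) x - \<theta>' x\<bar> powr p) \<partial>m) \<longlonglongrightarrow> (\<integral>\<^sup>+x. 0 \<partial>m)"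
      proof (rule nn_integral_dominated_convergence[where w = "\<lambda>_. 1"])
        show "(\<lambda>x. ennreal (\<bar>\<theta> (r i) x - \<theta>' x\<bar> powr p)) \<in> borel_measurable m" for i
          by (intro measurable_compose[OF _ measurable_ennreal] mm) measurable
        have "\<bar>\<theta> (r i) x - \<theta>' x\<bar> powr p \<le> 1" for i x
          using \<theta>D(2,3)[of "r i" x] \<theta>'_bound[of x] p_pos
          by (intro powr_le1) (auto simp: abs_le_iff)
        then show "AE x in m. ennreal (\<bar>\<theta> (r i) x - \<theta>' x\<bar> powr p) \<le> 1" for i by simp
        show "AE x in m. (\<lambda>i. ennreal (\<bar>\<theta> (r i) x - \<theta>' x\<bar> powr p)) \<longlonglongrightarrow> 0"
          using lim
        proof eventually_elim
          case (elim x)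
          have "(\<lambda>i. ennreal (\<bar>\<theta> (r i) x - \<theta>' x\<bar> powr p)) \<longlonglongrightarrow> ennreal (\<bar>\<theta>' x - \<theta>' x\<bar> powr p)"
            using p_pos by (intro tendsto_ennrealI tendsto_powr' tendsto_intros elim) auto
          then show ?case by simp
        qed
      qed (auto simp: m.emeasure_eq_measure)
      then show ?thesis by (simp add: energy_density m_def)
    qed
    \<comment> \<open>As \<open>r n\<close> is at least \<open>n\<close>, the subsequence still
      selects its maps from \<open>C n\<close>, as the convergence hypothesis demands.\<close>
    have "\<forall>n. \<exists>S. S \<in> C n \<and> wug (\<lambda>x. S (u x)) (\<lambda>x. ennreal (\<theta> (r n) x) * g x)"
    proof
      fix n
      have "\<theta> (r n) \<in> \<Theta> n" using \<theta>(1)[of "r n"] \<Theta>_dec[of n "r n"] seq_suble[OF r(1), of n] by blast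
      then show "\<exists>S. S \<in> C n \<and> wug (\<lambda>x. S (u x)) (\<lambda>x. ennreal (\<theta> (r n) x) * g x)"
        by (auto simp: \<Theta>_def)
    qed
    then obtain S where S: "\<And>n. S n \<in> C n" "\<And>n. wug (\<lambda>x. S n (u x)) (\<lambda>x. ennreal (\<theta> (r n) x) * g x)" by metis
    have "wug u (\<lambda>x. ennreal (\<theta>' x) * g x)"
    proof (rule wug_limit[OF S(2) _ _ _ en C_lim[OF S(1)]])
      fix n x
      have "ennreal (\<theta> (r n) x) \<le> ennreal (\<theta>' x + \<bar>\<theta> (r n) x - \<theta>' x\<bar>)" by (intro ennreal_leI) simp
      also have "\<dots> = ennreal (\<theta>' x) + ennreal \<bar>\<theta> (r n) x - \<theta>' x\<bar>" using \<theta>'_bound by simp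
      finally show "ennreal (\<theta> (r n) x) * g x \<le> ennreal (\<theta>' x) * g x + ennreal \<bar>\<theta> (r n) x - \<theta>' x\<bar> * g x"
        unfolding distrib_right[symmetric] by (rule mult_right_mono) simp
    qed measurable
    moreover have "(\<lambda>x. ennreal (\<theta>' x) * g x) \<in> Lp_borel \<mu> p"
    proof (rule Lp_borel_mono[OF gL(1)])
      have "ennreal (\<theta>' x) * g x \<le> 1 * g x" for x using \<theta>'_bound[of x] by (intro mult_right_mono) auto
      then show "AE x in M. ennreal (\<theta>' x) * g x \<le> g x" by simp
    qed measurable
    \<comment> \<open>Minimality of \<open>g\<close> leaves no room: the ratio must be 1 wherever
      \<open>g\<close> is positive and finite, that is, almost everywhere for
      \<open>m\<close>.\<close>
    ultimately have "AE x in M. g x \<le> ennreal (\<theta>' x) * g x" by (intro g_min) (simp add: LWG_iff)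
    then have "AE x in M. 0 < ennreal_powr (g x) p \<longrightarrow> \<theta>' x = 1"
      using Lp_borel_finite_AE[OF gL(1)]
    proof eventually_elim
      case (elim x)
      show ?case
      proof
        assume "0 < ennreal_powr (g x) p"
        then have "g x \<noteq> 0" by (metis ennreal_powr_0 less_irrefl)
        then obtain y where y: "g x = ennreal y" "0 < y" using elim(2) by (cases "g x") auto
        then have "y \<le> \<theta>' x * y" using elim(1) \<theta>'_bound[of x] by (simp add: ennreal_mult[symmetric])
        then show "\<theta>' x = 1" using y(2) \<theta>'_bound[of x] by simp
      qed
    qed
    then have one: "AE x in m. \<theta>' x = 1" unfolding m_def by (subst AE_density) auto
    have "(\<lambda>i. \<Phi> (\<theta> (r i))) \<longlonglongrightarrow> (\<integral>x. 1 \<partial>m)"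
      unfolding \<Phi>_def
    proof (rule integral_dominated_convergence[where w = "\<lambda>_. 1"])
      show "AE x in m. (\<lambda>i. (\<theta> (r i) x)\<^sup>2) \<longlonglongrightarrow> 1"
        using lim one
      proof eventually_elim
        case (elim x)
        have "(\<lambda>i. (\<theta> (r i) x)\<^sup>2) \<longlonglongrightarrow> (\<theta>' x)\<^sup>2" by (intro tendsto_intros elim)
        then show ?case using elim by simp
      qed
      show "(\<lambda>x. (\<theta> (r i) x)\<^sup>2) \<in> borel_measurable m" for i by (intro mm) measurable
      show "AE x in m. norm ((\<theta> (r i) x)\<^sup>2) \<le> 1" for i
        using sq_le[OF \<theta>D(2,3)] by simp
    qed auto
    then have "(\<lambda>i. \<Phi> (\<theta> (r i))) \<longlonglongrightarrow> m0" by (simp add: m0_def)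
    moreover have "(\<lambda>i. (m0 - \<epsilon>) + 1 / Suc (r i)) \<longlonglongrightarrow> (m0 - \<epsilon>) + 0"
      using LIMSEQ_subseq_LIMSEQ[OF inv r(1)] by (intro tendsto_add tendsto_const) (simp add: o_def)
    moreover have "\<Phi> (\<theta> (r i)) \<le> (m0 - \<epsilon>) + 1 / Suc (r i)" for i
      using \<theta>(2)[of "r i"] I_less[of "r i"] by linarith
    ultimately have "m0 \<le> m0 - \<epsilon> + 0" by (intro LIMSEQ_le) auto
    then show False using \<epsilon> by simp
  qed
  then obtain n where n: "\<And>\<theta>. \<theta> \<in> \<Theta> n \<Longrightarrow> m0 - \<epsilon> \<le> \<Phi> \<theta>" by blast
  have "energy (\<lambda>x. g x - h x) \<le> ennreal \<epsilon>" if S: "S \<in> C n" and h: "h \<in> LWG (\<lambda>x. S (u x))" for S h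
  proof -
    have "g \<in> LWG (\<lambda>x. S (u x))" using g_comp[OF S] gL by (simp add: LWG_iff)
    \<comment> \<open>An arbitrary gradient may exceed \<open>g\<close>; after truncation its ratio
      to \<open>g\<close> lies in [0, 1].\<close>
    then have h': "(\<lambda>x. min (h x) (g x)) \<in> LWG (\<lambda>x. S (u x))" by (rule LWG_min[OF h])
    have [measurable]: "h \<in> borel_measurable borel" using h by (simp add: LWG_iff Lp_borel_iff)
    \<comment> \<open>The outer \<open>min 1\<close> gives the bound at every point without a case
      distinction. Where \<open>g\<close> is 0 the value of the quotient is immaterial, since it is
      multiplied by \<open>g\<close>.\<close>
    define \<theta> where "\<theta> x = min 1 (enn2real (min (h x) (g x) / g x))" for x
    have [measurable]: "\<theta> \<in> borel_measurable borel" unfolding \<theta>_def[abs_def] by measurable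
    have \<theta>_bound: "0 \<le> \<theta> x" "\<theta> x \<le> 1" for x by (auto simp: \<theta>_def)
    have eq: "AE x in M. ennreal (\<theta> x) * g x = min (h x) (g x)"
      using Lp_borel_finite_AE[OF gL(1)]
    proof eventually_elim
      case (elim x)
      show ?case
      proof (cases "g x = 0")
        case False
        then obtain y where y: "g x = ennreal y" "0 < y" using elim by (cases "g x") auto
        obtain z where z: "min (h x) (g x) = ennreal z" "0 \<le> z" "z \<le> y"
          using y by (cases "min (h x) (g x)") (auto simp: min_def top_unique split: if_splits)
        have "\<theta> x = z / y" using y z by (simp add: \<theta>_def divide_ennreal)
        then show ?thesis using y z by (simp add: ennreal_mult[symmetric])
      qed simp
    qed
    have "wug (\<lambda>x. S (u x)) (\<lambda>x. ennreal (\<theta> x) * g x)"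
    proof (rule wug_AE_mono)
      show "wug (\<lambda>x. S (u x)) (\<lambda>x. min (h x) (g x))" using h' by (simp add: LWG_iff)
      show "AE x in M. min (h x) (g x) \<le> ennreal (\<theta> x) * g x" using eq by eventually_elim simp
    qed measurable
    then have \<theta>: "\<theta> \<in> \<Theta> n" using S \<theta>_bound by (auto simp: \<Theta>_def)
    have "energy (\<lambda>x. g x - h x) \<le> energy (\<lambda>x. ennreal (1 - \<theta> x) * g x)"
    proof (rule energy_mono_AE)
      show "AE x in M. g x - h x \<le> ennreal (1 - \<theta> x) * g x"
        using eq Lp_borel_finite_AE[OF gL(1)]
      proof eventually_elim
        case (elim x)
        have "g x = ennreal (\<theta> x + (1 - \<theta> x)) * g x" by simp
        also have "\<dots> = min (h x) (g x) + ennreal (1 - \<theta> x) * g x"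
          unfolding elim(1)[symmetric] using \<theta>_bound[of x] by (subst ennreal_plus) (auto simp: distrib_right)
        also have "\<dots> \<le> h x + ennreal (1 - \<theta> x) * g x" by (intro add_right_mono) simp
        finally show ?case using elim(2) by (auto simp: ennreal_minus_le_iff)
      qed
    qed
    also have "\<dots> = (\<integral>\<^sup>+x. ennreal ((1 - \<theta> x) powr p) \<partial>m)"
      unfolding m_def using \<theta>_bound by (intro energy_density) auto
    \<comment> \<open>Here the quadratic functional controls the p-energy: for numbers in [0, 1],
      powers with exponent at least 1 decrease the value.\<close>
    also have "\<dots> \<le> (\<integral>\<^sup>+x. ennreal (1 - (\<theta> x)\<^sup>2) \<partial>m)"
    proof (intro nn_integral_mono ennreal_leI)
      fix x
      have "(1 - \<theta> x) powr p \<le> 1 - \<theta> x" using \<theta>_bound[of x] p_ge_1 by (intro powr_le_self) auto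
      also have "\<dots> \<le> 1 - (\<theta> x)\<^sup>2"
        using \<theta>_bound[of x] mult_left_le[of "\<theta> x" "\<theta> x"] by (simp add: power2_eq_square)
      finally show "(1 - \<theta> x) powr p \<le> 1 - (\<theta> x)\<^sup>2" .
    qed
    also have "\<dots> = ennreal (\<integral>x. 1 - (\<theta> x)\<^sup>2 \<partial>m)"
      using int_sq[OF \<theta>] \<theta>_bound by (intro nn_integral_eq_integral) (auto simp: power_le_one)
    also have "(\<integral>x. 1 - (\<theta> x)\<^sup>2 \<partial>m) = m0 - \<Phi> \<theta>"
      using int_sq[OF \<theta>] by (simp add: \<Phi>_def m0_def)
    also have "ennreal (m0 - \<Phi> \<theta>) \<le> ennreal \<epsilon>" using n[OF \<theta>] by (intro ennreal_leI) simp
    finally show ?thesis .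
  qed
  then show ?thesis by blast
qed

end

section \<open>Approximation of finite rank functions\<close>

text \<open>The bound makes the coefficients of a convergent sequence Cauchy, and the limits of the
  coefficients represent its limit.\<close>

lemma closed_span_if_coeff_bound:
  fixes B :: "'v::real_normed_vector set"
  assumes B: "finite B" and K: "\<And>c b. b \<in> B \<Longrightarrow> \<bar>c b\<bar> \<le> K * norm (\<Sum>b\<in>B. c b *\<^sub>R b)"
  shows "closed (span B)"
  unfolding closed_sequential_limits
proof (intro allI impI, elim conjE)
  fix x l assume x: "\<forall>n. x n \<in> span B" and l: "x \<longlonglongrightarrow> l"
  have "\<forall>n. \<exists>c. x n = (\<Sum>b\<in>B. c b *\<^sub>R b)" using x by (auto simp: real_vector.span_finite[OF B])
  then obtain c where c: "\<And>n. x n = (\<Sum>b\<in>B. c n b *\<^sub>R b)" by metis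
  have "convergent (\<lambda>n. c n b)" if b: "b \<in> B" for b
  proof -
    have le: "\<bar>c m b - c n b\<bar> \<le> \<bar>K\<bar> * norm (x m - x n)" for m n
    proof -
      have "\<bar>c m b - c n b\<bar> \<le> K * norm (x m - x n)"
        using K[OF b, of "\<lambda>b. c m b - c n b"] by (simp add: c scaleR_diff_left sum_subtractf)
      also have "\<dots> \<le> \<bar>K\<bar> * norm (x m - x n)" by (intro mult_right_mono) auto
      finally show ?thesis .
    qed
    have "Cauchy (\<lambda>n. c n b)"
    proof (rule CauchyI)
      fix e :: real assume "0 < e"
      then obtain N where N: "\<And>m n. m \<ge> N \<Longrightarrow> n \<ge> N \<Longrightarrow> norm (x m - x n) < e / (\<bar>K\<bar> + 1)"
        using CauchyD[OF LIMSEQ_imp_Cauchy[OF l], of "e / (\<bar>K\<bar> + 1)"] by auto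
      have "norm (c m b - c n b) < e" if "m \<ge> N" "n \<ge> N" for m n
      proof -
        have "norm (c m b - c n b) \<le> (\<bar>K\<bar> + 1) * norm (x m - x n)"
          using le[of m n] by (simp add: ring_distribs add_increasing2)
        also have "\<dots> < e" using N[OF that] by (simp add: pos_less_divide_eq mult.commute)
        finally show ?thesis .
      qed
      then show "\<exists>N. \<forall>m\<ge>N. \<forall>n\<ge>N. norm (c m b - c n b) < e" by blast
    qed
    then show ?thesis by (rule Cauchy_convergent)
  qed
  then have "\<forall>b\<in>B. \<exists>d. (\<lambda>n. c n b) \<longlonglongrightarrow> d" by (auto simp: convergent_def)
  then obtain d where d: "\<And>b. b \<in> B \<Longrightarrow> (\<lambda>n. c n b) \<longlonglongrightarrow> d b" by metis
  have "(\<lambda>n. \<Sum>b\<in>B. c n b *\<^sub>R b) \<longlonglongrightarrow> (\<Sum>b\<in>B. d b *\<^sub>R b)" by (intro tendsto_intros d)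
  then have "l = (\<Sum>b\<in>B. d b *\<^sub>R b)" using l LIMSEQ_unique unfolding c by blast
  then show "l \<in> span B" by (auto simp: real_vector.span_finite[OF B])
qed

text \<open>Boundedness of coordinates on a finite-dimensional subspace, by adding one vector at a
  time. The induction hypothesis makes the smaller span closed, so the new vector has positive
  distance from it, and this distance bounds the new coefficient.\<close>

lemma independent_coeff_bound:
  fixes B :: "'v::real_normed_vector set"
  assumes "finite B" "independent B"
  shows "\<exists>K>0. \<forall>c. \<forall>b\<in>B. \<bar>c b\<bar> \<le> K * norm (\<Sum>b\<in>B. c b *\<^sub>R b)"
  using assms
proof (induction B rule: finite_induct)
  case empty
  then show ?case by (auto intro: exI[of _ 1])
next
  case (insert b0 B)
  have ind: "independent B" and b0: "b0 \<notin> span B"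
    using insert by (auto simp: real_vector.independent_insert)
  obtain K where K: "0 < K" "\<And>c b. b \<in> B \<Longrightarrow> \<bar>c b\<bar> \<le> K * norm (\<Sum>b\<in>B. c b *\<^sub>R b)"
    using insert.IH[OF ind] by blast
  have cl: "closed (span B)" using closed_span_if_coeff_bound[OF insert.hyps(1) K(2)] .
  define \<delta> where "\<delta> = infdist b0 (span B)"
  have ne: "span B \<noteq> {}" using real_vector.span_zero by blast
  have \<delta>: "0 < \<delta>" unfolding \<delta>_def by (rule infdist_pos_not_in_closed[OF cl ne b0])
  \<comment> \<open>The new coefficient is at most \<open>norm z / \<delta>\<close>. The others are
    at most \<open>K\<close> times the norm of the remainder after removing the \<open>b0\<close>
    part, which is at most \<open>(1 + norm b0 / \<delta>) * norm z\<close>.\<close>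
  define K' where "K' = 1 / \<delta> + K * (1 + norm b0 / \<delta>)"
  have "\<bar>c b\<bar> \<le> K' * norm (\<Sum>b\<in>insert b0 B. c b *\<^sub>R b)" if b: "b \<in> insert b0 B" for c b
  proof -
    define y where "y = (\<Sum>b\<in>B. c b *\<^sub>R b)"
    define z where "z = (\<Sum>b\<in>insert b0 B. c b *\<^sub>R b)"
    have z: "z = c b0 *\<^sub>R b0 + y" using insert.hyps by (simp add: z_def y_def)
    have c0: "\<bar>c b0\<bar> \<le> norm z / \<delta>"
    proof (cases "c b0 = 0")
      case False
      have "(- 1 / c b0) *\<^sub>R y \<in> span B"
        unfolding y_def by (intro real_vector.span_scale real_vector.span_sum real_vector.span_base)
      then have "\<delta> \<le> norm (b0 - (- 1 / c b0) *\<^sub>R y)"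
        unfolding \<delta>_def dist_norm[symmetric] by (rule infdist_le)
      then have "\<bar>c b0\<bar> * \<delta> \<le> \<bar>c b0\<bar> * norm (b0 - (- 1 / c b0) *\<^sub>R y)"
        by (intro mult_left_mono) auto
      also have "\<dots> = norm (c b0 *\<^sub>R (b0 - (- 1 / c b0) *\<^sub>R y))" by simp
      also have "c b0 *\<^sub>R (b0 - (- 1 / c b0) *\<^sub>R y) = z" using False by (simp add: z scaleR_add_right)
      finally show ?thesis using \<delta> by (simp add: pos_le_divide_eq)
    qed (use \<delta> in simp)
    show ?thesis
    proof (cases "b = b0")
      case True
      have "norm z / \<delta> \<le> K' * norm z"
        using \<delta> K(1) by (simp add: K'_def ring_distribs)
      then show ?thesis using c0 True by (simp add: z_def)
    next
      case False
      then have "\<bar>c b\<bar> \<le> K * norm y" using b K(2)[of b c] by (simp add: y_def)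
      also have "norm y \<le> norm z + \<bar>c b0\<bar> * norm b0"
        using norm_triangle_ineq4[of z "c b0 *\<^sub>R b0"] by (simp add: z)
      also have "\<dots> \<le> norm z + norm z / \<delta> * norm b0" using c0 by (intro add_left_mono mult_right_mono) auto
      finally have "\<bar>c b\<bar> \<le> K * (norm z + norm z / \<delta> * norm b0)" using K(1) by (simp add: mult_left_mono)
      also have "\<dots> \<le> K' * norm z" using \<delta> K(1) by (simp add: K'_def ring_distribs mult_ac)
      finally show ?thesis by (simp add: z_def)
    qed
  qed
  moreover have "0 < K'" using \<delta> K(1) by (simp add: K'_def add_pos_nonneg)
  ultimately show ?case by blast
qed

text \<open>A basis is chosen inside the spanning set, and the coordinates of \<open>T v\<close> are
  Lipschitz in \<open>v\<close> with constant \<open>K * norm T\<close>. The final constant is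
  enlarged by 1 so that it is positive even if \<open>T\<close> is 0.\<close>

lemma finite_rank_coordinates:
  fixes T :: "'v::real_normed_vector \<Rightarrow>\<^sub>L 'v"
  assumes "finite B0" "range (blinfun_apply T) \<subseteq> span B0"
  obtains B K and c :: "'v \<Rightarrow> 'v \<Rightarrow> real" where "finite B" "0 < K"
    "\<And>v. blinfun_apply T v = (\<Sum>b\<in>B. c b v *\<^sub>R b)"
    "\<And>b x y. b \<in> B \<Longrightarrow> \<bar>c b x - c b y\<bar> \<le> K * norm (x - y)"
    "\<And>b. b \<in> B \<Longrightarrow> c b 0 = 0"
proof -
  obtain B where B: "B \<subseteq> B0" "independent B" "B0 \<subseteq> span B"
    using real_vector.maximal_independent_subset[of B0] by blast
  have fin: "finite B" using B(1) assms(1) by (rule finite_subset)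
  have span: "blinfun_apply T v \<in> span B" for v
    using assms(2) real_vector.span_minimal[OF B(3) real_vector.subspace_span] by blast
  obtain K where K: "0 < K" "\<And>c b. b \<in> B \<Longrightarrow> \<bar>c b\<bar> \<le> K * norm (\<Sum>b\<in>B. c b *\<^sub>R b)"
    using independent_coeff_bound[OF fin B(2)] by blast
  define c where "c b v = representation B (blinfun_apply T v) b" for b v
  have sum: "blinfun_apply T v = (\<Sum>b\<in>B. c b v *\<^sub>R b)" for v
    unfolding c_def by (rule real_vector.sum_representation_eq[symmetric, OF B(2) span fin order_refl])
  have diff: "\<bar>c b x - c b y\<bar> \<le> K * norm T * norm (x - y)" if "b \<in> B" for b x y
  proof -
    have "\<bar>c b x - c b y\<bar> \<le> K * norm (blinfun_apply T x - blinfun_apply T y)"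
      using K(2)[OF that, of "\<lambda>b. c b x - c b y"] by (simp add: sum scaleR_diff_left sum_subtractf)
    also have "\<dots> \<le> K * (norm T * norm (x - y))"
      using K(1) norm_blinfun[of T "x - y"] by (intro mult_left_mono) (auto simp: blinfun.diff_right)
    finally show ?thesis by (simp add: mult.assoc)
  qed
  have zero: "c b 0 = 0" if "b \<in> B" for b
    using K(2)[OF that, of "\<lambda>b. c b 0"] sum[of 0] by (simp add: blinfun.zero_right)
  show ?thesis
  proof (rule that[of B "K * norm T + 1" c])
    show "0 < K * norm T + 1" using K(1) by (intro add_nonneg_pos) auto
    show "\<bar>c b x - c b y\<bar> \<le> (K * norm T + 1) * norm (x - y)" if "b \<in> B" for b x y
      using diff[OF that, of x y] by (simp add: ring_distribs add_increasing2)
  qed (use fin sum zero in auto)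
qed

lemma lipschitz_bounded_support_sum_scaleR:
  assumes I: "finite I" and f: "\<And>i. i \<in> I \<Longrightarrow> (f i :: 'a::metric_space \<Rightarrow> real) \<in> lipschitz_bounded_support"
  shows "(\<lambda>x. \<Sum>i\<in>I. f i x *\<^sub>R v i) \<in> lipschitz_bounded_support"
proof -
  have "\<forall>i\<in>I. \<exists>L. L-lipschitz_on UNIV (f i)" using f by (auto simp: lipschitz_bounded_support_def)
  then obtain L where L: "\<And>i. i \<in> I \<Longrightarrow> (L i)-lipschitz_on UNIV (f i)" by metis
  have "(\<Sum>i\<in>I. L i * norm (v i))-lipschitz_on UNIV (\<lambda>x. \<Sum>i\<in>I. f i x *\<^sub>R v i)"
  proof (rule lipschitz_onI)
    fix x y :: 'a
    have "dist (\<Sum>i\<in>I. f i x *\<^sub>R v i) (\<Sum>i\<in>I. f i y *\<^sub>R v i) = norm (\<Sum>i\<in>I. (f i x - f i y) *\<^sub>R v i)"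
      by (simp add: dist_norm scaleR_diff_left sum_subtractf)
    also have "\<dots> \<le> (\<Sum>i\<in>I. \<bar>f i x - f i y\<bar> * norm (v i))" by (rule order_trans[OF norm_sum]) simp
    also have "\<dots> \<le> (\<Sum>i\<in>I. (L i * dist x y) * norm (v i))"
      using lipschitz_onD[OF L] by (intro sum_mono mult_right_mono) (auto simp: dist_real_def)
    also have "\<dots> = (\<Sum>i\<in>I. L i * norm (v i)) * dist x y" by (simp add: sum_distrib_left mult_ac)
    finally show "dist (\<Sum>i\<in>I. f i x *\<^sub>R v i) (\<Sum>i\<in>I. f i y *\<^sub>R v i) \<le> (\<Sum>i\<in>I. L i * norm (v i)) * dist x y" .
  qed (use L lipschitz_on_nonneg in \<open>auto intro!: sum_nonneg mult_nonneg_nonneg\<close>)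
  moreover have "bounded {x. (\<Sum>i\<in>I. f i x *\<^sub>R v i) \<noteq> 0}"
  proof (rule bounded_subset)
    show "bounded (\<Union>i\<in>I. {x. f i x \<noteq> 0})"
      using f I by (intro bounded_UN) (auto simp: lipschitz_bounded_support_def)
    show "{x. (\<Sum>i\<in>I. f i x *\<^sub>R v i) \<noteq> 0} \<subseteq> (\<Union>i\<in>I. {x. f i x \<noteq> 0})"
    proof clarify
      fix x assume "(\<Sum>i\<in>I. f i x *\<^sub>R v i) \<noteq> 0"
      then obtain i where "i \<in> I" "f i x *\<^sub>R v i \<noteq> 0" by (rule sum.not_neutral_contains_not_neutral)
      then show "x \<in> (\<Union>i\<in>I. {x. f i x \<noteq> 0})" by auto
    qed
  qed
  ultimately show ?thesis unfolding lipschitz_bounded_support_def by blast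
qed

context newton_sobolev
begin

section \<open>Approximation of scalar and of finite rank Sobolev functions\<close>

lemma measurable_vector_compose:
  fixes \<phi> :: "'v::real_normed_vector \<Rightarrow> real"
  assumes "vector_measurable \<mu> u" "continuous_on UNIV \<phi>"
  shows "(\<lambda>x. \<phi> (u x)) \<in> borel_measurable M"
proof (rule borel_measurableI)
  fix S :: "real set" assume "open S"
  then have "open (\<phi> -` S)" using assms(2) by (rule open_vimage)
  then have "u -` (\<phi> -` S) \<in> sets M" using assms(1) by (auto simp: vector_measurable_def sets_M)
  then show "(\<lambda>x. \<phi> (u x)) -` S \<inter> space M \<in> sets M" by (simp add: vimage_def)
qed

lemma vector_measurable_compose:
  fixes \<phi> :: "'v::real_normed_vector \<Rightarrow> 'w::real_normed_vector"
  assumes u: "vector_measurable \<mu> u" and \<phi>: "continuous_on UNIV \<phi>"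
  shows "vector_measurable \<mu> (\<lambda>x. \<phi> (u x))"
proof -
  obtain N where N: "\<mu> N = 0" "separable_space (top_of_set (u ` (- N)))"
    using u by (auto simp: vector_measurable_def)
  have "continuous_map (top_of_set (u ` (- N))) (top_of_set ((\<lambda>x. \<phi> (u x)) ` (- N))) \<phi>"
    using \<phi> by (auto intro: continuous_on_subset)
  from separable_space_continuous_map_image[OF N(2) this]
  have "separable_space (top_of_set ((\<lambda>x. \<phi> (u x)) ` (- N)))" by (simp add: image_image)
  moreover have "(\<lambda>x. \<phi> (u x)) -` U \<in> caratheodory_sets \<mu>" if "open U" for U
  proof -
    have "open (\<phi> -` U)" using that \<phi> by (rule open_vimage)
    then have "u -` (\<phi> -` U) \<in> caratheodory_sets \<mu>" using u by (simp add: vector_measurable_def)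
    then show ?thesis by (simp add: vimage_def)
  qed
  ultimately show ?thesis using N(1) unfolding vector_measurable_def by blast
qed

text \<open>Density in norm speaks about the minimal gradient of the class of \<open>w - f\<close>.
  The function \<open>e\<close> is a representative of this class for which that gradient is a
  genuine weak upper gradient; its existence rests on \<open>w\<close> and \<open>f\<close> both
  having integrable gradients.\<close>

lemma lipschitz_approximation_real:
  fixes w :: "'a \<Rightarrow> real"
  assumes dense: "lipschitz_dense_in_norm \<mu> p TYPE(real)" and w: "w \<in> sobolev_space \<mu> p" and \<eta>: "0 < \<eta>"
  obtains f e \<rho> where "f \<in> lipschitz_bounded_support" "AE x in M. e x = w x - f x" "\<rho> \<in> LWG e"
    "energy \<rho> < ennreal \<eta>" "energy (\<lambda>x. ennreal \<bar>w x - f x\<bar>) < ennreal \<eta>"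
proof -
  \<comment> \<open>The threshold \<open>\<eta> powr (1 / p)\<close> for the norm corresponds to the
    threshold \<open>\<eta>\<close> for the energy.\<close>
  obtain f where f: "f \<in> lipschitz_bounded_support"
    "sobolev_norm \<mu> p (\<lambda>x. w x - f x) < ennreal (\<eta> powr (1 / p))"
    using dense w \<eta> unfolding lipschitz_dense_in_norm_def by (metis powr_gt_zero less_irrefl)
  obtain w' \<sigma> where w': "AE x in M. w' x = w x" "\<sigma> \<in> LWG w'"
    using w by (auto simp: sobolev_space_def)
  obtain \<tau> where \<tau>: "\<tau> \<in> LWG f" using lipschitz_LWG[OF f(1)] by blast
  have "(\<lambda>x. \<sigma> x + \<tau> x) \<in> LWG (\<lambda>x. w' x - f x)"
    using w'(2) \<tau> by (auto simp: LWG_iff intro: wug_diff Lp_borel_add)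
  moreover have "AE x in M. w' x - f x = w x - f x" using w'(1) by eventually_elim simp
  ultimately have min: "is_minimal_gradient \<mu> p (\<lambda>x. w x - f x) (SOME \<rho>. is_minimal_gradient \<mu> p (\<lambda>x. w x - f x) \<rho>)"
    by (intro is_minimal_gradient_SOME[of "\<lambda>x. w' x - f x"]) blast+
  define \<rho> where "\<rho> = (SOME \<rho>. is_minimal_gradient \<mu> p (\<lambda>x. w x - f x) \<rho>)"
  obtain e where e: "AE x in M. e x = w x - f x" "\<rho> \<in> LWG e"
    using is_minimal_gradientD[OF min[folded \<rho>_def]] by metis
  have "\<rho> \<in> Lp_borel \<mu> p" using e(2) by (simp add: LWG_iff)
  from Lp_borel_finite_AE[OF this]
  have eq: "AE x in M. \<rho> x = ennreal (norm (minimal_gradient \<mu> p (\<lambda>x. w x - f x) x))"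
    by eventually_elim (simp add: minimal_gradient_def \<rho>_def[symmetric] less_top)
  have n: "Lp_norm \<mu> p (\<lambda>x. ennreal (norm (w x - f x))) < ennreal (\<eta> powr (1 / p))"
    "Lp_norm \<mu> p (\<lambda>x. ennreal (norm (minimal_gradient \<mu> p (\<lambda>x. w x - f x) x))) < ennreal (\<eta> powr (1 / p))"
    using f(2) unfolding sobolev_norm_def Lp_vec_norm_def
    by (auto intro: order.strict_trans1[rotated])
  show ?thesis
  proof (rule that[OF f(1) e])
    show "energy \<rho> < ennreal \<eta>"
      unfolding energy_cong_AE[OF eq] by (rule energy_less[OF n(2) \<eta>])
    show "energy (\<lambda>x. ennreal \<bar>w x - f x\<bar>) < ennreal \<eta>"
      using energy_less[OF n(1) \<eta>] by simp
  qed
qed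

text \<open>Each coordinate of \<open>T (u x)\<close> is a scalar Sobolev function and is
  approximated separately. The majorant \<open>R\<close> is built from the real coordinate errors,
  so its measurability is immediate, and it stands in for the norm of the vector-valued error in
  later energy estimates.\<close>

lemma lipschitz_approximation_finite_rank:
  fixes u :: "'a \<Rightarrow> 'v::real_normed_vector" and T :: "'v \<Rightarrow>\<^sub>L 'v"
  assumes dense: "lipschitz_dense_in_norm \<mu> p TYPE(real)"
    and u: "u \<in> sobolev_space \<mu> p"
    and T: "finite B0" "range (blinfun_apply T) \<subseteq> span B0" and \<eta>: "0 < \<eta>"
  obtains f e E R where "f \<in> lipschitz_bounded_support" "AE x in M. e x = T (u x) - f x" "E \<in> LWG e"
    "energy E \<le> ennreal \<eta>" "R \<in> borel_measurable M"
    "\<And>x. ennreal (norm (T (u x) - f x)) \<le> R x" "energy R \<le> ennreal \<eta>"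
proof -
  obtain B K and c :: "'v \<Rightarrow> 'v \<Rightarrow> real" where B: "finite B" and K: "0 < K"
    and sum: "\<And>v. blinfun_apply T v = (\<Sum>b\<in>B. c b v *\<^sub>R b)"
    and lip: "\<And>b x y. b \<in> B \<Longrightarrow> \<bar>c b x - c b y\<bar> \<le> K * norm (x - y)"
    and zero: "\<And>b. b \<in> B \<Longrightarrow> c b 0 = 0"
    by (rule finite_rank_coordinates[OF T]) (rule that)
  have um: "vector_measurable \<mu> u" and uL: "energy (\<lambda>x. ennreal (norm (u x))) < \<infinity>"
    using u by (auto simp: sobolev_space_def Lp_space_def Lp_vec_norm_def Lp_norm_finite_iff[unfolded infinity_ennreal_def])
  obtain u' \<sigma> where u': "AE x in M. u' x = u x" "\<sigma> \<in> LWG u'"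
    using u by (auto simp: sobolev_space_def)
  have cont: "continuous_on UNIV (c b)" if "b \<in> B" for b
  proof -
    have "K-lipschitz_on UNIV (c b)"
      using lip[OF that] K by (intro lipschitz_onI) (auto simp: dist_norm)
    then show ?thesis by (rule lipschitz_on_continuous_on)
  qed
  have sob: "(\<lambda>x. c b (u x)) \<in> sobolev_space \<mu> p" if b: "b \<in> B" for b
  proof -
    have "energy (\<lambda>x. ennreal (norm (c b (u x)))) \<le> energy (\<lambda>x. ennreal K * ennreal (norm (u x)))"
      using lip[OF b, of _ 0] zero[OF b] K
      by (intro energy_mono_AE AE_I2) (simp add: ennreal_mult[symmetric] ennreal_leI)
    also have "\<dots> = ennreal_powr (ennreal K) p * energy (\<lambda>x. ennreal (norm (u x)))"
      by (intro energy_cmult measurable_compose[OF _ measurable_ennreal]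
          measurable_vector_compose[OF um, of norm]) (intro continuous_intros)
    also have "\<dots> < \<infinity>" using uL by (auto simp: ennreal_mult_less_top ennreal_powr_less_top_iff[unfolded infinity_ennreal_def])
    finally have "(\<lambda>x. c b (u x)) \<in> Lp_space \<mu> p"
      unfolding Lp_space_def Lp_vec_norm_def using vector_measurable_compose[OF um cont[OF b]]
      by (simp only: mem_Collect_eq Lp_norm_finite_iff)
    moreover have "AE x in M. c b (u' x) = c b (u x)" using u'(1) by eventually_elim simp
    moreover have "(\<lambda>x. ennreal K * \<sigma> x) \<in> LWG (\<lambda>x. c b (u' x))"
      using u'(2) lip[OF b] K 
      by (auto simp: LWG_iff intro!: wug_compose[where T = "c b"] Lp_borel_cmult)
    ultimately show ?thesis
      unfolding sobolev_space_def by (intro CollectI conjI exI[of _ "\<lambda>x. c b (u' x)"]) auto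
  qed
  \<comment> \<open>The total constant lost in summing over \<open>B\<close> with the weights
    \<open>norm b + 1\<close>. An accuracy of \<open>\<eta> / (Q + 1)\<close> in each coordinate
    compensates for it, also when \<open>Q\<close> is 0.\<close>
  define Q where "Q = enn2real (ennreal_powr (of_nat (card B)) p * (\<Sum>b\<in>B. ennreal_powr (ennreal (norm b + 1)) p))"
  have Q: "ennreal_powr (of_nat (card B)) p * (\<Sum>b\<in>B. ennreal_powr (ennreal (norm b + 1)) p) = ennreal Q" "0 \<le> Q"
    unfolding Q_def
    by (auto intro!: ennreal_enn2real[symmetric] simp: ennreal_mult_less_top B
        ennreal_powr_less_top_iff[unfolded infinity_ennreal_def] of_nat_less_top)
  define \<eta>' where "\<eta>' = \<eta> / (Q + 1)"
  have \<eta>': "0 < \<eta>'" using \<eta> Q(2) by (simp add: \<eta>'_def)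
  have bound: "energy (\<lambda>x. \<Sum>b\<in>B. ennreal (norm b + 1) * g b x) \<le> ennreal \<eta>"
    if g: "\<And>b. b \<in> B \<Longrightarrow> g b \<in> borel_measurable M" "\<And>b. b \<in> B \<Longrightarrow> energy (g b) < ennreal \<eta>'" for g
  proof -
    have "energy (\<lambda>x. \<Sum>b\<in>B. ennreal (norm b + 1) * g b x) \<le>
        ennreal_powr (of_nat (card B)) p * (\<Sum>b\<in>B. energy (\<lambda>x. ennreal (norm b + 1) * g b x))"
      using g B by (intro energy_sum) auto
    also have "(\<Sum>b\<in>B. energy (\<lambda>x. ennreal (norm b + 1) * g b x)) \<le>
        (\<Sum>b\<in>B. ennreal_powr (ennreal (norm b + 1)) p * ennreal \<eta>')"
      using g by (intro sum_mono) (auto simp: energy_cmult intro!: mult_left_mono intro: less_imp_le)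
    also have "\<dots> = (\<Sum>b\<in>B. ennreal_powr (ennreal (norm b + 1)) p) * ennreal \<eta>'"
      by (simp add: sum_distrib_right)
    finally have "energy (\<lambda>x. \<Sum>b\<in>B. ennreal (norm b + 1) * g b x) \<le> ennreal Q * ennreal \<eta>'"
      unfolding Q(1)[symmetric] by (simp add: mult.assoc mult_left_mono)
    also have "\<dots> = ennreal (Q * \<eta>')" using Q(2) \<eta>' by (simp add: ennreal_mult)
    also have "\<dots> \<le> ennreal \<eta>" using Q(2) \<eta> by (intro ennreal_leI) (simp add: \<eta>'_def field_simps)
    finally show ?thesis .
  qed
  have "\<forall>b\<in>B. \<exists>f e \<rho>. f \<in> lipschitz_bounded_support \<and> (AE x in M. e x = c b (u x) - f x) \<and> \<rho> \<in> LWG e \<and>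
    energy \<rho> < ennreal \<eta>' \<and> energy (\<lambda>x. ennreal \<bar>c b (u x) - f x\<bar>) < ennreal \<eta>'"
  proof
    fix b assume b: "b \<in> B"
    show "\<exists>f e \<rho>. f \<in> lipschitz_bounded_support \<and> (AE x in M. e x = c b (u x) - f x) \<and> \<rho> \<in> LWG e \<and>
      energy \<rho> < ennreal \<eta>' \<and> energy (\<lambda>x. ennreal \<bar>c b (u x) - f x\<bar>) < ennreal \<eta>'"
      by (rule lipschitz_approximation_real[OF dense sob[OF b] \<eta>']) blast
  qed
  from bchoice[OF this] obtain f where "\<forall>b\<in>B. \<exists>e \<rho>. f b \<in> lipschitz_bounded_support \<and>
    (AE x in M. e x = c b (u x) - f b x) \<and> \<rho> \<in> LWG e \<and> energy \<rho> < ennreal \<eta>' \<and>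
    energy (\<lambda>x. ennreal \<bar>c b (u x) - f b x\<bar>) < ennreal \<eta>'" ..
  from bchoice[OF this] obtain e where "\<forall>b\<in>B. \<exists>\<rho>. f b \<in> lipschitz_bounded_support \<and>
    (AE x in M. e b x = c b (u x) - f b x) \<and> \<rho> \<in> LWG (e b) \<and> energy \<rho> < ennreal \<eta>' \<and>
    energy (\<lambda>x. ennreal \<bar>c b (u x) - f b x\<bar>) < ennreal \<eta>'" ..
  from bchoice[OF this] obtain \<rho> where *: "\<forall>b\<in>B. f b \<in> lipschitz_bounded_support \<and>
    (AE x in M. e b x = c b (u x) - f b x) \<and> \<rho> b \<in> LWG (e b) \<and> energy (\<rho> b) < ennreal \<eta>' \<and>
    energy (\<lambda>x. ennreal \<bar>c b (u x) - f b x\<bar>) < ennreal \<eta>'" ..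
  then have f: "\<And>b. b \<in> B \<Longrightarrow> f b \<in> lipschitz_bounded_support"
    and e: "\<And>b. b \<in> B \<Longrightarrow> AE x in M. e b x = c b (u x) - f b x"
    and \<rho>: "\<And>b. b \<in> B \<Longrightarrow> \<rho> b \<in> LWG (e b)" "\<And>b. b \<in> B \<Longrightarrow> energy (\<rho> b) < ennreal \<eta>'"
    and en: "\<And>b. b \<in> B \<Longrightarrow> energy (\<lambda>x. ennreal \<bar>c b (u x) - f b x\<bar>) < ennreal \<eta>'"
    by blast+
  let ?f = "\<lambda>x. \<Sum>b\<in>B. f b x *\<^sub>R b" and ?e = "\<lambda>x. \<Sum>b\<in>B. e b x *\<^sub>R b"
    and ?E = "\<lambda>x. \<Sum>b\<in>B. ennreal (norm b + 1) * \<rho> b x"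
  have fm: "f b \<in> borel_measurable M" if b: "b \<in> B" for b
  proof -
    obtain L where "L-lipschitz_on UNIV (f b)" using f[OF b] by (auto simp: lipschitz_bounded_support_def)
    then have "continuous_on UNIV (f b)" by (rule lipschitz_on_continuous_on)
    then show ?thesis by (intro measurable_M borel_measurable_continuous_onI)
  qed
  show ?thesis
  proof (rule that)
    show "?f \<in> lipschitz_bounded_support"
      using lipschitz_bounded_support_sum_scaleR[OF B, of f "\<lambda>b. b"] f by simp
    have "AE x in M. \<forall>b\<in>B. e b x = c b (u x) - f b x"
      using e B by (simp add: AE_ball_countable countable_finite)
    then show "AE x in M. ?e x = T (u x) - ?f x"
      by eventually_elim (simp add: sum scaleR_diff_left sum_subtractf)
    show E: "energy ?E \<le> ennreal \<eta>"
      using \<rho> by (intro bound) (auto simp: LWG_iff Lp_borel_iff intro: measurable_M)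
    have "wug ?e ?E"
      using wug_sum_scaleR[OF B, of e \<rho> "\<lambda>b. b"] \<rho>(1) by (simp add: LWG_iff)
    then show "?E \<in> LWG ?e"
      using E by (auto simp: LWG_iff Lp_borel_iff wug_measurable intro: order.strict_trans1)
    let ?R = "\<lambda>x. \<Sum>b\<in>B. ennreal (norm b + 1) * ennreal \<bar>c b (u x) - f b x\<bar>"
    show "ennreal (norm (T (u x) - ?f x)) \<le> ?R x" for x
    proof -
      have "norm (T (u x) - ?f x) = norm (\<Sum>b\<in>B. (c b (u x) - f b x) *\<^sub>R b)"
        by (simp add: sum scaleR_diff_left sum_subtractf)
      also have "\<dots> \<le> (\<Sum>b\<in>B. (norm b + 1) * \<bar>c b (u x) - f b x\<bar>)"
        by (rule order_trans[OF norm_sum], rule sum_mono) (simp add: ring_distribs mult.commute)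
      finally have "ennreal (norm (T (u x) - ?f x)) \<le> ennreal (\<Sum>b\<in>B. (norm b + 1) * \<bar>c b (u x) - f b x\<bar>)"
        by (rule ennreal_leI)
      also have "\<dots> = ?R x"
        by (subst sum_ennreal[symmetric]) (auto simp: ennreal_mult simp del: ennreal_plus)
      finally show ?thesis .
    qed
    have Rm: "(\<lambda>x. ennreal \<bar>c b (u x) - f b x\<bar>) \<in> borel_measurable M" if b: "b \<in> B" for b
    proof -
      have [measurable]: "(\<lambda>x. c b (u x)) \<in> borel_measurable M" "f b \<in> borel_measurable M"
        using fm[OF b] measurable_vector_compose[OF um cont[OF b]] by auto
      show ?thesis by measurable
    qed
    then show "?R \<in> borel_measurable M"
      by (intro borel_measurable_sum borel_measurable_times_ennreal) auto
    show "energy ?R \<le> ennreal \<eta>" by (rule bound[OF Rm en])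
  qed
qed

end

section \<open>Density in energy\<close>

text \<open>The index bounds both the number of points and the error, so the sets decrease with
  \<open>n\<close>. They consist of plain functions rather than bounded operators, since only metric
  and midpoint properties are used in the variational argument.\<close>

definition finite_rank_contractions :: "(nat \<Rightarrow> 'v::real_normed_vector) \<Rightarrow> nat \<Rightarrow> ('v \<Rightarrow> 'v) set" where
  "finite_rank_contractions v n = blinfun_apply ` {S :: 'v \<Rightarrow>\<^sub>L 'v.
     (\<exists>B. finite B \<and> range (blinfun_apply S) \<subseteq> span B) \<and> norm S \<le> 1 \<and>
     (\<forall>i\<le>n. norm (v i - blinfun_apply S (v i)) \<le> 1 / Suc n)}"

lemma finite_rank_contractions_nonempty:
  fixes v :: "nat \<Rightarrow> 'v::real_normed_vector"
  assumes "metric_approximation_property TYPE('v)"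
  shows "finite_rank_contractions v n \<noteq> {}"
proof -
  have "compact (v ` {..n})" by (intro finite_imp_compact) simp
  moreover have "0 < 1 / real (Suc n)" by simp
  ultimately obtain S :: "'v \<Rightarrow>\<^sub>L 'v" where "\<exists>B. finite B \<and> range (blinfun_apply S) \<subseteq> span B"
    "norm S \<le> 1" "\<forall>x\<in>v ` {..n}. norm (x - blinfun_apply S x) \<le> 1 / real (Suc n)"
    using assms[unfolded metric_approximation_property_def, rule_format, of "v ` {..n}" "1 / real (Suc n)"] by metis
  then have "blinfun_apply S \<in> finite_rank_contractions v n"
    unfolding finite_rank_contractions_def by (intro imageI CollectI conjI) auto
  then show ?thesis by blast
qed

lemma finite_rank_contractions_antimono:
  assumes "m \<le> n" shows "finite_rank_contractions v n \<subseteq> finite_rank_contractions v m"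
proof -
  have le: "1 / real (Suc n) \<le> 1 / real (Suc m)" using assms by (simp add: frac_le)
  have "norm (v i - blinfun_apply S (v i)) \<le> 1 / Suc m"
    if "\<forall>i\<le>n. norm (v i - blinfun_apply S (v i)) \<le> 1 / Suc n" "i \<le> m" for S i
    using that(1)[rule_format, of i] that(2) assms le by (meson order_trans)
  then show ?thesis unfolding finite_rank_contractions_def by (intro image_mono) blast
qed

lemma finite_rank_contractions_lipschitz:
  assumes "S \<in> finite_rank_contractions v n"
  shows "norm (S x - S y) \<le> norm (x - y)"
proof -
  obtain T :: "'a \<Rightarrow>\<^sub>L 'a" where T: "S = blinfun_apply T" "norm T \<le> 1"
    using assms by (auto simp: finite_rank_contractions_def)
  have "norm (T (x - y)) \<le> norm T * norm (x - y)" by (rule norm_blinfun)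
  also have "\<dots> \<le> 1 * norm (x - y)" using T by (intro mult_right_mono) auto
  finally show ?thesis by (simp add: T blinfun.diff_right)
qed

lemma finite_rank_contractions_midpoint:
  assumes "S \<in> finite_rank_contractions v n" "T \<in> finite_rank_contractions v n"
  shows "(\<lambda>x. (1/2) *\<^sub>R (S x + T x)) \<in> finite_rank_contractions v n"
proof -
  obtain S' B where S: "S = blinfun_apply S'" "finite B" "range (blinfun_apply S') \<subseteq> span B" "norm S' \<le> 1"
    "\<And>i. i \<le> n \<Longrightarrow> norm (v i - blinfun_apply S' (v i)) \<le> 1 / Suc n"
    using assms(1) by (auto simp: finite_rank_contractions_def)
  obtain T' C where T: "T = blinfun_apply T'" "finite C" "range (blinfun_apply T') \<subseteq> span C" "norm T' \<le> 1"
    "\<And>i. i \<le> n \<Longrightarrow> norm (v i - blinfun_apply T' (v i)) \<le> 1 / Suc n"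
    using assms(2) by (auto simp: finite_rank_contractions_def)
  let ?R = "(1/2) *\<^sub>R (S' + T')"
  have R: "blinfun_apply ?R = (\<lambda>x. (1/2) *\<^sub>R (S x + T x))"
    by (simp add: fun_eq_iff S(1) T(1) blinfun.scaleR_left blinfun.add_left)
  have "range (blinfun_apply ?R) \<subseteq> span (B \<union> C)"
  proof clarify
    fix x
    have "S x \<in> span (B \<union> C)" "T x \<in> span (B \<union> C)"
      using S(1,3) T(1,3) real_vector.span_mono[of B "B \<union> C"] real_vector.span_mono[of C "B \<union> C"] by auto
    then show "blinfun_apply ?R x \<in> span (B \<union> C)"
      unfolding R by (intro real_vector.span_scale real_vector.span_add)
  qed
  moreover have "norm ?R \<le> 1"
    using norm_triangle_ineq[of S' T'] S(4) T(4) by simp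
  moreover have "norm (v i - blinfun_apply ?R (v i)) \<le> 1 / Suc n" if "i \<le> n" for i
  proof -
    have "v i = (1/2) *\<^sub>R (v i + v i)" by (simp flip: scaleR_2)
    then have "v i - blinfun_apply ?R (v i) = (1/2) *\<^sub>R ((v i + v i) - (S (v i) + T (v i)))"
      unfolding R by (metis scaleR_diff_right)
    also have "\<dots> = (1/2) *\<^sub>R ((v i - S (v i)) + (v i - T (v i)))"
      by (simp add: algebra_simps)
    finally have "norm (v i - blinfun_apply ?R (v i)) \<le> (1/2) * (norm (v i - S (v i)) + norm (v i - T (v i)))"
      using norm_triangle_ineq[of "v i - S (v i)" "v i - T (v i)"] by simp
    then show ?thesis using S(1) S(5)[OF that] T(1) T(5)[OF that] by simp
  qed
  ultimately show ?thesis
    unfolding finite_rank_contractions_def R[symmetric] using S(2) T(2) by (intro imageI CollectI conjI exI[of _ "B \<union> C"]) auto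
qed

text \<open>Convergence at the points \<open>v i\<close> extends to their closure because all the
  maps share the Lipschitz constant 1; three errors below \<open>e / 3\<close> are added.\<close>

lemma finite_rank_contractions_tendsto:
  assumes S: "\<And>n. S n \<in> finite_rank_contractions v n" and x: "x \<in> closure (range v)"
  shows "(\<lambda>n. S n x) \<longlonglongrightarrow> x"
proof (rule LIMSEQ_I)
  fix e :: real assume "0 < e"
  then obtain i where i: "norm (v i - x) < e / 3"
    using x by (force simp: closure_approachable dist_norm dest: spec[of _ "e / 3"])
  obtain k where k: "1 / real (Suc k) < e / 3"
    using \<open>0 < e\<close> nat_approx_posE[of "e / 3"] by auto
  have "norm (S n x - x) < e" if n: "n \<ge> max i k" for n
  proof -
    have "norm (v i - S n (v i)) \<le> 1 / Suc n" using S[of n] n by (auto simp: finite_rank_contractions_def)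
    also have "\<dots> \<le> 1 / Suc k" using n by (simp add: frac_le)
    finally have "norm (S n (v i) - v i) < e / 3" using k by (simp add: norm_minus_commute)
    moreover have "norm (S n x - S n (v i)) < e / 3"
      using finite_rank_contractions_lipschitz[OF S[of n], of x "v i"] i by (simp add: norm_minus_commute)
    moreover have "norm (S n x - x) \<le> norm (S n x - S n (v i)) + norm (S n (v i) - v i) + norm (v i - x)"
      using norm_triangle_ineq[of "S n x - S n (v i) + (S n (v i) - v i)" "v i - x"]
        norm_triangle_ineq[of "S n x - S n (v i)" "S n (v i) - v i"] by simp
    ultimately show ?thesis using i by simp
  qed
  then show "\<exists>N. \<forall>n\<ge>N. norm (S n x - x) < e" by blast
qed

context newton_sobolev
begin

lemma essential_range_dense_sequence:
  fixes u :: "'a \<Rightarrow> 'v::real_normed_vector"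
  assumes "vector_measurable \<mu> u"
  obtains v :: "nat \<Rightarrow> 'v" where "AE x in M. u x \<in> closure (range v)"
proof -
  obtain N where N: "\<mu> N = 0" "separable_space (top_of_set (u ` (- N)))"
    using assms by (auto simp: vector_measurable_def)
  obtain D where D: "countable D" "D \<subseteq> u ` (- N)" "top_of_set (u ` (- N)) closure_of D = u ` (- N)"
    using N(2) by (auto simp: separable_space_def)
  have "u ` (- N) \<subseteq> closure D" using D(2,3) by (auto simp: closure_of_subtopology Int_absorb1)
  \<comment> \<open>Inserting 0 guarantees a nonempty set to enumerate; the closure can only
    grow.\<close>
  also have "\<dots> \<subseteq> closure (range (from_nat_into (insert 0 D)))"
    using D(1) by (intro closure_mono) (auto simp: range_from_nat_into)
  finally have sub: "u ` (- N) \<subseteq> closure (range (from_nat_into (insert 0 D)))" .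
  obtain B where B: "N \<subseteq> B" "B \<in> null_sets M" using borel_null_cover[OF N(1)] by metis
  have "AE x in M. u x \<in> closure (range (from_nat_into (insert 0 D)))"
    using AE_not_in[OF B(2)] by eventually_elim (use B(1) sub in auto)
  then show ?thesis by (rule that)
qed

text \<open>Dominated convergence: the maps fix 0 and are contractions, so the integrands are
  dominated by the \<open>p\<close>-th power of \<open>2 * norm (u x)\<close>.\<close>

lemma energy_contractions_tendsto:
  fixes u :: "'a \<Rightarrow> 'v::real_normed_vector"
  assumes u: "u \<in> Lp_space \<mu> p" and v: "AE x in M. u x \<in> closure (range v)"
    and S: "\<And>n. S n \<in> finite_rank_contractions v n"
  shows "(\<lambda>n. energy (\<lambda>x. ennreal (norm (u x - S n (u x))))) \<longlonglongrightarrow> 0"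
proof -
  have um: "vector_measurable \<mu> u" and uL: "energy (\<lambda>x. ennreal (norm (u x))) < \<infinity>"
    using u by (auto simp: Lp_space_def Lp_vec_norm_def Lp_norm_finite_iff[unfolded infinity_ennreal_def])
  have Sc: "continuous_on UNIV (S n)" for n
    using S[of n] by (auto simp: finite_rank_contractions_def intro!: continuous_intros)
  have nm: "(\<lambda>x. norm (u x)) \<in> borel_measurable M"
    by (intro measurable_vector_compose[OF um, of norm] continuous_intros)
  have m: "(\<lambda>x. norm (u x - S n (u x))) \<in> borel_measurable M" for n
    by (intro measurable_vector_compose[OF um, of "\<lambda>y. norm (y - S n y)"] continuous_intros Sc)
  have S0: "S n 0 = 0" for n
    using S[of n] by (auto simp: finite_rank_contractions_def blinfun.zero_right)
  have "(\<lambda>n. \<integral>\<^sup>+x. ennreal_powr (ennreal (norm (u x - S n (u x)))) p \<partial>M) \<longlonglongrightarrow> (\<integral>\<^sup>+x. 0 \<partial>M)"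
  proof (rule nn_integral_dominated_convergence[where w = "\<lambda>x. ennreal_powr (2 * ennreal (norm (u x))) p"])
    show "AE x in M. ennreal_powr (ennreal (norm (u x - S n (u x)))) p \<le> ennreal_powr (2 * ennreal (norm (u x))) p" for n
    proof (intro AE_I2 ennreal_powr_mono)
      fix x
      have "norm (u x - S n (u x)) \<le> 2 * norm (u x)"
        using norm_triangle_ineq4[of "u x" "S n (u x)"] finite_rank_contractions_lipschitz[OF S[of n], of "u x" 0] S0 by simp
      then have "ennreal (norm (u x - S n (u x))) \<le> ennreal (2 * norm (u x))" by (rule ennreal_leI)
      then show "ennreal (norm (u x - S n (u x))) \<le> 2 * ennreal (norm (u x))" by (simp add: ennreal_mult)
    qed (use p_pos in simp)
    have "energy (\<lambda>x. 2 * ennreal (norm (u x))) = ennreal_powr 2 p * energy (\<lambda>x. ennreal (norm (u x)))"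
      using nm by (intro energy_cmult) simp
    also have "\<dots> < \<infinity>" using uL by (auto simp: ennreal_mult_less_top ennreal_powr_less_top_iff[unfolded infinity_ennreal_def])
    finally show "(\<integral>\<^sup>+x. ennreal_powr (2 * ennreal (norm (u x))) p \<partial>M) < \<infinity>" by (simp add: energy_def)
    show "AE x in M. (\<lambda>n. ennreal_powr (ennreal (norm (u x - S n (u x)))) p) \<longlonglongrightarrow> 0"
      using v
    proof eventually_elim
      case (elim x)
      have "(\<lambda>n. S n (u x)) \<longlonglongrightarrow> u x" by (rule finite_rank_contractions_tendsto[OF S elim])
      then have "(\<lambda>n. norm (u x - S n (u x)) powr p) \<longlonglongrightarrow> norm (u x - u x) powr p"
        using p_pos by (intro tendsto_powr' tendsto_intros) auto
      then have "(\<lambda>n. ennreal (norm (u x - S n (u x)) powr p)) \<longlonglongrightarrow> ennreal (norm (u x - u x) powr p)"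
        by (rule tendsto_ennrealI)
      then show ?case by (simp add: ennreal_powr_ennreal)
    qed
  qed (use m nm in measurable)
  then show ?thesis by (simp add: energy_def)
qed

lemma lipschitz_approximation:
  fixes u :: "'a \<Rightarrow> 'v::real_normed_vector"
  assumes dense: "lipschitz_dense_in_norm \<mu> p TYPE(real)"
    and map: "metric_approximation_property TYPE('v)"
    and u: "u \<in> sobolev_space \<mu> p" and \<epsilon>: "0 < \<epsilon>"
  shows "\<exists>f\<in>lipschitz_bounded_support. Lp_vec_norm \<mu> p (\<lambda>x. u x - f x) < ennreal \<epsilon> \<and>
    Lp_vec_norm \<mu> p (\<lambda>x. minimal_gradient \<mu> p u x - minimal_gradient \<mu> p f x) < ennreal \<epsilon>"
proof -
  have uL: "u \<in> Lp_space \<mu> p" and um: "vector_measurable \<mu> u"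
    using u by (auto simp: sobolev_space_def Lp_space_def)
  define g where "g = (SOME \<rho>. is_minimal_gradient \<mu> p u \<rho>)"
  have "is_minimal_gradient \<mu> p u g"
    using u is_minimal_gradient_SOME unfolding g_def sobolev_space_def by blast
  then obtain u' where u': "AE x in M. u' x = u x" and g: "g \<in> LWG u'"
    and g_min: "\<And>\<sigma>. \<sigma> \<in> LWG u' \<Longrightarrow> AE x in M. g x \<le> \<sigma> x"
    by (rule is_minimal_gradientD) (rule that)
  obtain v :: "nat \<Rightarrow> 'v" where v: "AE x in M. u x \<in> closure (range v)"
    by (rule essential_range_dense_sequence[OF um])
  \<comment> \<open>Two errors of energy \<open>\<eta>\<close> are added at the cost of a factor
    \<open>2 powr p\<close>, which gives half of \<open>\<epsilon> powr p\<close> and hence a strict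
    inequality.\<close>
  define \<eta> where "\<eta> = \<epsilon> powr p / (4 * 2 powr p)"
  have \<eta>: "0 < \<eta>" using \<epsilon> by (simp add: \<eta>_def)
  have \<eta>2: "ennreal_powr 2 p * (ennreal \<eta> + ennreal \<eta>) < ennreal (\<epsilon> powr p)"
  proof -
    have "ennreal_powr 2 p = ennreal (2 powr p)" using ennreal_powr_ennreal[of 2 p] by simp
    moreover have "ennreal \<eta> + ennreal \<eta> = ennreal (\<eta> + \<eta>)" using \<eta> by (intro ennreal_plus[symmetric]) auto
    ultimately have "ennreal_powr 2 p * (ennreal \<eta> + ennreal \<eta>) = ennreal (2 powr p * (\<eta> + \<eta>))"
      using \<eta> by (simp only:) (intro ennreal_mult[symmetric], auto)
    also have "\<dots> < ennreal (\<epsilon> powr p)"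
      using \<epsilon> by (intro ennreal_lessI) (simp_all add: \<eta>_def)
    finally show ?thesis .
  qed
  let ?C = "finite_rank_contractions v"
  have v': "AE x in M. u' x \<in> closure (range v)" using u' v by eventually_elim simp
  have "\<exists>n. \<forall>S\<in>?C n. \<forall>h\<in>LWG (\<lambda>x. S (u' x)). energy (\<lambda>x. g x - h x) \<le> ennreal \<eta>"
  proof (rule minimal_gradient_approximation[OF g g_min])
    fix S assume S: "\<And>n. S n \<in> ?C n"
    show "ae_curve (\<lambda>(a, b, \<gamma>). \<gamma> a = \<gamma> b \<or>
      (\<lambda>n. S n (u' (\<gamma> a))) \<longlonglongrightarrow> u' (\<gamma> a) \<and> (\<lambda>n. S n (u' (\<gamma> b))) \<longlonglongrightarrow> u' (\<gamma> b))"
      by (rule ae_curve_mono[OF ae_curve_endpoints_in_closed[OF g closed_closure v']])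
        (auto intro: finite_rank_contractions_tendsto[OF S])
  qed (use \<eta> in \<open>auto intro: finite_rank_contractions_lipschitz finite_rank_contractions_midpoint
      simp: finite_rank_contractions_nonempty[OF map] dest: subsetD[OF finite_rank_contractions_antimono]\<close>)
  then obtain n1 where n1: "\<And>S h. S \<in> ?C n1 \<Longrightarrow> h \<in> LWG (\<lambda>x. S (u' x)) \<Longrightarrow> energy (\<lambda>x. g x - h x) \<le> ennreal \<eta>"
    by blast
  have "\<forall>n. \<exists>S. S \<in> ?C n" using finite_rank_contractions_nonempty[OF map] by blast
  then obtain S where S: "\<And>n. S n \<in> ?C n" by metis
  have "\<forall>\<^sub>F n in sequentially. energy (\<lambda>x. ennreal (norm (u x - S n (u x)))) < ennreal \<eta>"
    using \<eta> by (intro order_tendstoD(2)[OF energy_contractions_tendsto[OF uL v S]]) simp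
  \<comment> \<open>One map has to serve two purposes: with index at least \<open>n1\<close> it
    keeps the gradient near \<open>g\<close>, and with a large index it keeps the values near
    \<open>u\<close>.\<close>
  then obtain n where n: "n \<ge> n1" "energy (\<lambda>x. ennreal (norm (u x - S n (u x)))) < ennreal \<eta>"
    unfolding eventually_sequentially by (metis nle_le order_refl)
  obtain T B0 where T: "S n = blinfun_apply T" "finite B0" "range (blinfun_apply T) \<subseteq> span B0"
    using S[of n] by (auto simp: finite_rank_contractions_def)
  have T_lip: "norm (T x - T y) \<le> 1 * norm (x - y)" for x y
    using finite_rank_contractions_lipschitz[OF S[of n]] T(1) by simp
  have "blinfun_apply T \<in> ?C n1"
    using S[of n] finite_rank_contractions_antimono[OF n(1)] unfolding T(1) by blast
  note g_close = n1[OF this]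
  have gT: "g \<in> LWG (\<lambda>x. T (u' x))"
    using g wug_compose[of u' g 1 "blinfun_apply T"] T_lip by (simp add: LWG_iff)
  then obtain \<rho>w where \<rho>w: "\<rho>w \<in> LWG (\<lambda>x. T (u' x))"
    "\<And>\<sigma>. \<sigma> \<in> LWG (\<lambda>x. T (u' x)) \<Longrightarrow> AE x in M. \<rho>w x \<le> \<sigma> x"
    using ex_minimal_LWG[of "\<lambda>x. T (u' x)"] by blast
  obtain f e E R where f: "f \<in> lipschitz_bounded_support" and e: "AE x in M. e x = T (u x) - f x"
    and E: "E \<in> LWG e" "energy E \<le> ennreal \<eta>"
    and R [measurable]: "R \<in> borel_measurable M"
    and Tf: "\<And>x. ennreal (norm (T (u x) - f x)) \<le> R x" "energy R \<le> ennreal \<eta>"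
    by (rule lipschitz_approximation_finite_rank[OF dense u T(2,3) \<eta>]) (rule that)
  define \<rho>f where "\<rho>f = (SOME \<rho>. is_minimal_gradient \<mu> p f \<rho>)"
  have f_min: "is_minimal_gradient \<mu> p f \<rho>f"
    unfolding \<rho>f_def by (rule is_minimal_gradient_SOME[OF _ lipschitz_LWG[OF f]]) simp
  obtain f' where f': "AE x in M. f' x = f x" "\<rho>f \<in> LWG f'"
    by (rule is_minimal_gradientD[OF f_min]) (rule that)
  \<comment> \<open>Almost everywhere \<open>f\<close> is \<open>T \<circ> u'\<close> minus
    \<open>e\<close>, and \<open>T \<circ> u'\<close> is \<open>f'\<close> plus \<open>e\<close>.
    The two resulting inequalities say that the minimal gradients of \<open>f\<close> and of
    \<open>T \<circ> u'\<close> differ by at most \<open>E\<close>.\<close>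
  have upper: "AE x in M. \<rho>f x \<le> \<rho>w x + E x"
  proof (rule is_minimal_gradient_least[OF f_min])
    show "AE x in M. T (u' x) - e x = f x" using u' e by eventually_elim simp
    show "(\<lambda>x. \<rho>w x + E x) \<in> LWG (\<lambda>x. T (u' x) - e x)"
      using \<rho>w(1) E(1) by (auto simp: LWG_iff intro: wug_diff Lp_borel_add)
  qed
  have lower: "AE x in M. \<rho>w x \<le> \<rho>f x + E x"
  proof (rule \<rho>w(2), rule LWG_cong_AE)
    show "AE x in M. f' x + e x = T (u' x)" using u' e f'(1) by eventually_elim simp
    show "(\<lambda>x. \<rho>f x + E x) \<in> LWG (\<lambda>x. f' x + e x)"
      using f'(2) E(1) by (auto simp: LWG_iff intro: wug_add Lp_borel_add)
  qed (use gT in blast)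
  have fin: "AE x in M. g x < \<infinity>" "AE x in M. \<rho>f x < \<infinity>" "AE x in M. E x < \<infinity>" "AE x in M. \<rho>w x < \<infinity>"
    using g f'(2) E(1) \<rho>w(1) by (auto simp: LWG_iff intro!: Lp_borel_finite_AE simp del: infinity_ennreal_def)
  have [measurable]: "g \<in> borel_measurable M" "\<rho>w \<in> borel_measurable M" "E \<in> borel_measurable M"
    using g \<rho>w(1) E(1) by (auto simp: LWG_iff Lp_borel_iff intro: measurable_M)
  have "energy (\<lambda>x. ennreal (norm (minimal_gradient \<mu> p u x - minimal_gradient \<mu> p f x))) \<le>
      energy (\<lambda>x. (g x - \<rho>w x) + E x)"
  proof (rule energy_mono_AE)
    \<comment> \<open>The subtraction \<open>g x - \<rho>w x\<close> is not truncated, because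
      \<open>g\<close> is also a gradient of \<open>T \<circ> u'\<close> and so dominates the
      minimal one almost everywhere.\<close>
    show "AE x in M. ennreal (norm (minimal_gradient \<mu> p u x - minimal_gradient \<mu> p f x)) \<le> (g x - \<rho>w x) + E x"
      using upper lower \<rho>w(2)[OF gT] fin
    proof eventually_elim
      case (elim x)
      obtain a b c d where abcd: "g x = ennreal a" "\<rho>f x = ennreal b" "E x = ennreal c" "\<rho>w x = ennreal d"
        "0 \<le> a" "0 \<le> b" "0 \<le> c" "0 \<le> d"
        using elim(4-7) by (cases "g x"; cases "\<rho>f x"; cases "E x"; cases "\<rho>w x") auto
      have "b \<le> d + c" "d \<le> b + c" "d \<le> a"
        using elim(1-3) abcd by (simp_all add: ennreal_plus[symmetric] del: ennreal_plus)
      then have "\<bar>a - b\<bar> \<le> (a - d) + c" by linarith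
      then have "ennreal \<bar>a - b\<bar> \<le> ennreal (a - d) + ennreal c"
        using \<open>d \<le> a\<close> abcd by (simp add: ennreal_plus[symmetric] ennreal_leI del: ennreal_plus)
      then show ?case using abcd
        by (simp add: minimal_gradient_def g_def[symmetric] \<rho>f_def[symmetric] ennreal_minus)
    qed
  qed
  also have "\<dots> \<le> ennreal_powr 2 p * (energy (\<lambda>x. g x - \<rho>w x) + energy E)"
    by (rule energy_add) measurable
  also have "\<dots> \<le> ennreal_powr 2 p * (ennreal \<eta> + ennreal \<eta>)"
    by (intro mult_left_mono add_mono g_close \<rho>w E) simp
  also note \<eta>2
  finally have 1: "energy (\<lambda>x. ennreal (norm (minimal_gradient \<mu> p u x - minimal_gradient \<mu> p f x))) < ennreal (\<epsilon> powr p)" .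
  have Tm: "(\<lambda>x. norm (u x - T (u x))) \<in> borel_measurable M"
    by (intro measurable_vector_compose[OF um, of "\<lambda>y. norm (y - T y)"] continuous_intros)
  have "energy (\<lambda>x. ennreal (norm (u x - f x))) \<le> energy (\<lambda>x. ennreal (norm (u x - T (u x))) + R x)"
  proof (intro energy_mono_AE AE_I2)
    fix x
    have "norm (u x - f x) \<le> norm (u x - T (u x)) + norm (T (u x) - f x)"
      using norm_triangle_ineq[of "u x - T (u x)" "T (u x) - f x"] by simp
    then have "ennreal (norm (u x - f x)) \<le> ennreal (norm (u x - T (u x))) + ennreal (norm (T (u x) - f x))"
      by (simp add: ennreal_plus[symmetric] ennreal_leI del: ennreal_plus)
    also have "\<dots> \<le> ennreal (norm (u x - T (u x))) + R x" by (intro add_left_mono Tf)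
    finally show "ennreal (norm (u x - f x)) \<le> ennreal (norm (u x - T (u x))) + R x" .
  qed
  also have "\<dots> \<le> ennreal_powr 2 p * (energy (\<lambda>x. ennreal (norm (u x - T (u x)))) + energy R)"
    by (rule energy_add[OF measurable_compose[OF Tm measurable_ennreal] R])
  also have "\<dots> \<le> ennreal_powr 2 p * (ennreal \<eta> + ennreal \<eta>)"
    using n(2) T(1) by (intro mult_left_mono add_mono Tf) auto
  also note \<eta>2
  finally have 2: "energy (\<lambda>x. ennreal (norm (u x - f x))) < ennreal (\<epsilon> powr p)" .
  show ?thesis
    using Lp_norm_less[OF 1 \<epsilon>] Lp_norm_less[OF 2 \<epsilon>] f unfolding Lp_vec_norm_def by blast
qed

end

theorem theorem1p8:
  fixes \<mu> :: "'a::metric_space set \<Rightarrow> ennreal" and p :: real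
  assumes "1 \<le> p"
    and "metric_measure_space \<mu>"
    and "lipschitz_dense_in_norm \<mu> p TYPE(real)"
    and "metric_approximation_property TYPE('v::banach)"
  shows "lipschitz_dense_in_energy \<mu> p TYPE('v)"
  unfolding lipschitz_dense_in_energy_def
proof
  interpret newton_sobolev \<mu> p using assms by unfold_locales
  fix u :: "'a \<Rightarrow> 'v" assume u: "u \<in> sobolev_space \<mu> p"
  let ?D = "\<lambda>f. Lp_vec_norm \<mu> p (\<lambda>x. u x - f x)"
  let ?G = "\<lambda>f. Lp_vec_norm \<mu> p (\<lambda>x. minimal_gradient \<mu> p u x - minimal_gradient \<mu> p f x)"
  have "\<forall>n. \<exists>f. f \<in> lipschitz_bounded_support \<and> ?D f < ennreal (1 / Suc n) \<and> ?G f < ennreal (1 / Suc n)"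
  proof
    fix n
    show "\<exists>f. f \<in> lipschitz_bounded_support \<and> ?D f < ennreal (1 / Suc n) \<and> ?G f < ennreal (1 / Suc n)"
      using lipschitz_approximation[OF assms(3,4) u, of "1 / Suc n"] by auto
  qed
  then obtain f where f: "\<And>n. f n \<in> lipschitz_bounded_support"
    "\<And>n. ?D (f n) < ennreal (1 / Suc n)" "\<And>n. ?G (f n) < ennreal (1 / Suc n)" by metis
  have "(\<lambda>n. ennreal (1 / Suc n) + ennreal (1 / Suc n)) \<longlonglongrightarrow> ennreal 0 + ennreal 0"
    using LIMSEQ_inverse_real_of_nat
    by (intro tendsto_add tendsto_ennrealI) (simp_all add: inverse_eq_divide)
  then have lim: "(\<lambda>n. ennreal (1 / Suc n) + ennreal (1 / Suc n)) \<longlonglongrightarrow> 0" by simp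
  have "(\<lambda>n. ?D (f n) + ?G (f n)) \<longlonglongrightarrow> 0"
  proof (rule tendsto_sandwich[OF _ _ tendsto_const lim])
    show "\<forall>\<^sub>F n in sequentially. ?D (f n) + ?G (f n) \<le> ennreal (1 / Suc n) + ennreal (1 / Suc n)"
      by (intro always_eventually allI add_mono less_imp_le[OF f(2)] less_imp_le[OF f(3)])
  qed simp
  then show "\<exists>f. (\<forall>n. f n \<in> lipschitz_bounded_support) \<and> (\<lambda>n. ?D (f n) + ?G (f n)) \<longlonglongrightarrow> 0"
    using f(1) by blast
qed

end
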